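(* Distance variants of directed LCVS problems are solvable in XP time parameterized by bi-mim-width when a branch decomposition is given. That is: for every fixed $r\in\mathbb{N}$, all fixed finite or co-finite sets $\sigma^+,\sigma^-,\rho^+,\rho^-\subseteq\mathbb{N}$, and either choice of optimization (minimum or maximum), there are a function $f:\mathbb{N}\to\mathbb{N}$ and an algorithm that, given a digraph $G$ on $n$ vertices together with a branch decomposition of $G$ of bi-mim-width $w$, solves the distance-$r$ $(\sigma^+,\sigma^-,\rho^+,\rho^-)$-problem on $G$ in time $O(n^{f(w)})$.
   Context: $\mathbb{N}$ contains $0$. All digraphs are finite, have no multiple edges, and may have loops; $E(G)\subseteq V(G)\times V(G)$, and $(u,v)$ is an edge from $u$ to $v$. $\mathrm{dist}_G(u,v)$ is the length of a shortest directed path from $u$ to $v$. For $r\in\mathbb{N}$, $B_r^+(v)=\{w\in V(G):\mathrm{dist}_G(v,w)\le r\}$ and $B_r^-(v)=\{u\in V(G):\mathrm{dist}_G(u,v)\le r\}$. Distance-$r$ $(\sigma^+,\sigma^-,\rho^+,\rho^-)$-problem: given a digraph $G$, find a set $S\subseteq V(G)$ of minimum (respectively maximum) size such that for every $v\in S$, $|B_r^+(v)\cap S|\in\sigma^+$ and $|B_r^-(v)\cap S|\in\sigma^-$, and for every $v\in V(G)\setminus S$, $|B_r^+(v)\cap S|\in\rho^+$ and $|B_r^-(v)\cap S|\in\rho^-$ (or report that no such set exists). Bi-mim-width: for disjoint $A,B\subseteq V(G)$, $G[A\to B]$ is the bipartite digraph on vertex set $A\cup B$ with edge set $E(G)\cap(A\times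 B)$. Write $\bar A=V(G)\setminus A$. An induced matching is a set $M$ of edges, no two sharing an endpoint, such that no edge of the digraph meets two distinct edges of $M$; $\nu(\cdot)$ is the maximum size of an induced matching. Let $\mathrm{bimim}_G(A)=\nu(G[A\to\bar A])+\nu(G[\bar A\to A])$. A tree is subcubic if it has at least two vertices and every internal vertex has degree $3$. A branch decomposition of $G$ is a pair $(T,L)$ of a subcubic tree $T$ and a bijection $L$ from $V(G)$ to the leaves of $T$. Each edge $e$ of $T$ yields a cut $(A_e,B_e)$ of $G$, where $A_e$ and $B_e$ are the sets of vertices mapped by $L$ to the leaves in the two components of $T-e$. The bi-mim-width of $(T,L)$ is $\max_{e\in E(T)}\mathrm{bimim}_G(A_e)$. *)

theory Defs
  imports "Graph_Theory.Graph_Theory" "HOL-Library.Extended_Nat"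
begin

section \<open>Distances, balls and the distance-r vertex subset problems\<close>

text \<open>
  A finite digraph without multiple edges, possibly with loops, is a record of type
  \<^typ>\<open>'a pair_pre_digraph\<close> satisfying \<^const>\<open>pair_fin_digraph\<close>.
  The distance is infinite when there is no path.
\<close>

definition digraph_dist :: "'a pair_pre_digraph \<Rightarrow> 'a \<Rightarrow> 'a \<Rightarrow> enat" where
  "digraph_dist G u v =
     (INF p \<in> {p. pre_digraph.apath (with_proj G) u p v}. enat (length p))"

definition out_ball :: "'a pair_pre_digraph \<Rightarrow> nat \<Rightarrow> 'a \<Rightarrow> 'a set" where
  "out_ball G r v = {w \<in> pverts G. digraph_dist G v w \<le> enat r}"

definition in_ball :: "'a pair_pre_digraph \<Rightarrow> nat \<Rightarrow> 'a \<Rightarrow> 'a set" where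
  "in_ball G r v = {u \<in> pverts G. digraph_dist G u v \<le> enat r}"

definition dist_feasible ::
  "nat \<Rightarrow> nat set \<Rightarrow> nat set \<Rightarrow> nat set \<Rightarrow> nat set \<Rightarrow> 'a pair_pre_digraph \<Rightarrow> 'a set \<Rightarrow> bool" where
  "dist_feasible r \<sigma>p \<sigma>m \<rho>p \<rho>m G S \<longleftrightarrow>
     S \<subseteq> pverts G \<and>
     (\<forall>v \<in> S. card (out_ball G r v \<inter> S) \<in> \<sigma>p \<and> card (in_ball G r v \<inter> S) \<in> \<sigma>m) \<and>
     (\<forall>v \<in> pverts G - S. card (out_ball G r v \<inter> S) \<in> \<rho>p \<and> card (in_ball G r v \<inter> S) \<in> \<rho>m)"

datatype goal = Minimum | Maximum

definition optimal :: "goal \<Rightarrow> ('a set \<Rightarrow> bool) \<Rightarrow> 'a set \<Rightarrow> bool" where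
  "optimal g F S \<longleftrightarrow> F S \<and>
     (\<forall>S'. F S' \<longrightarrow> (case g of Minimum \<Rightarrow> card S \<le> card S' | Maximum \<Rightarrow> card S' \<le> card S))"

text \<open>The answer \<^term>\<open>None\<close> reports that there is no feasible set.\<close>

definition correct_answer :: "goal \<Rightarrow> ('a set \<Rightarrow> bool) \<Rightarrow> 'a set option \<Rightarrow> bool" where
  "correct_answer g F ans \<longleftrightarrow>
     (case ans of None \<Rightarrow> \<not> (\<exists>S. F S) | Some S \<Rightarrow> optimal g F S)"


section \<open>Bi-mim-width\<close>

definition bip_digraph :: "'a pair_pre_digraph \<Rightarrow> 'a set \<Rightarrow> 'a set \<Rightarrow> 'a pair_pre_digraph" where
  "bip_digraph G A B = \<lparr> pverts = A \<union> B, parcs = parcs G \<inter> (A \<times> B) \<rparr>"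

definition endpoints :: "'a \<times> 'a \<Rightarrow> 'a set" where
  "endpoints e = {fst e, snd e}"

definition meets :: "'a \<times> 'a \<Rightarrow> 'a \<times> 'a \<Rightarrow> bool" where
  "meets e f \<longleftrightarrow> endpoints e \<inter> endpoints f \<noteq> {}"

definition induced_matching :: "'a pair_pre_digraph \<Rightarrow> ('a \<times> 'a) set \<Rightarrow> bool" where
  "induced_matching H M \<longleftrightarrow>
     M \<subseteq> parcs H \<and>
     (\<forall>e \<in> M. \<forall>f \<in> M. e \<noteq> f \<longrightarrow> \<not> meets e f) \<and>
     (\<forall>h \<in> parcs H. \<forall>e \<in> M. \<forall>f \<in> M. e \<noteq> f \<longrightarrow> \<not> (meets h e \<and> meets h f))"

definition max_induced_matching :: "'a pair_pre_digraph \<Rightarrow> nat" where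
  "max_induced_matching H = Max (card ` {M. induced_matching H M})"

definition bimim :: "'a pair_pre_digraph \<Rightarrow> 'a set \<Rightarrow> nat" where
  "bimim G A =
     max_induced_matching (bip_digraph G A (pverts G - A)) +
     max_induced_matching (bip_digraph G (pverts G - A) A)"

text \<open>
  An undirected graph is a symmetric loop-free digraph (\<^const>\<open>pair_graph\<close>), each edge being
  represented by its two orientations. The predicate \<^const>\<open>tree\<close> of the library does not
  fit here: it forbids every directed cycle, and a symmetric digraph with an edge between
  two vertices has the directed cycle that goes along the edge and back. The cycles of the
  undirected graph are the directed cycles of length at least 3.
\<close>

definition undirected_tree :: "'b pair_pre_digraph \<Rightarrow> bool" where
  "undirected_tree T \<longleftrightarrow>
     pair_graph T \<and> connected (with_proj T) \<and>
     \<not> (\<exists>p. pre_digraph.cycle (with_proj T) p \<and> 3 \<le> length p)"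

definition leaves :: "'b pair_pre_digraph \<Rightarrow> 'b set" where
  "leaves T = {x \<in> pverts T. out_degree (with_proj T) x = 1}"

definition subcubic_tree :: "'b pair_pre_digraph \<Rightarrow> bool" where
  "subcubic_tree T \<longleftrightarrow>
     undirected_tree T \<and> 2 \<le> card (pverts T) \<and>
     (\<forall>x \<in> pverts T - leaves T. out_degree (with_proj T) x = 3)"

definition branch_decomposition ::
  "'a pair_pre_digraph \<Rightarrow> 'b pair_pre_digraph \<Rightarrow> ('a \<Rightarrow> 'b) \<Rightarrow> bool" where
  "branch_decomposition G T L \<longleftrightarrow> subcubic_tree T \<and> bij_betw L (pverts G) (leaves T)"

definition delete_edge :: "'b pair_pre_digraph \<Rightarrow> 'b \<times> 'b \<Rightarrow> 'b pair_pre_digraph" where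
  "delete_edge T e =
     \<lparr> pverts = pverts T, parcs = parcs T - {(fst e, snd e), (snd e, fst e)} \<rparr>"

text \<open>
  The side of the cut of an edge that belongs to the component containing the first endpoint.
  The other side is obtained from the opposite orientation of the edge.
\<close>

definition cut_side ::
  "'a pair_pre_digraph \<Rightarrow> 'b pair_pre_digraph \<Rightarrow> ('a \<Rightarrow> 'b) \<Rightarrow> 'b \<times> 'b \<Rightarrow> 'a set" where
  "cut_side G T L e = {v \<in> pverts G. reachable (with_proj (delete_edge T e)) (fst e) (L v)}"

definition bimim_width ::
  "'a pair_pre_digraph \<Rightarrow> 'b pair_pre_digraph \<Rightarrow> ('a \<Rightarrow> 'b) \<Rightarrow> nat" where
  "bimim_width G T L = Max ((\<lambda>e. bimim G (cut_side G T L e)) ` parcs T)"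


section \<open>Model of computation\<close>

text \<open>
  Algorithms are programs of a first-order Lisp whose only data are binary trees over a single
  atom. A program is a finite list of (mutually recursive) function bodies together with a
  main expression; functions are called by their position in the list, and variables are
  positions in the list of arguments. The running time is the number of evaluation steps.

  Every step allocates a bounded number of cells and the only observations are following a
  pointer and testing for the atom, so a computation of \<open>t\<close> steps is simulated by a
  Turing machine or a random access machine, with trees stored with sharing, in time
  polynomial in \<open>t\<close> and the input size; conversely this language simulates these machines
  with polynomial overhead. Hence the notions of polynomial time and of XP time
  coincide with the usual ones.
\<close>

datatype sexp = Atom | Dot sexp sexp

fun car :: "sexp \<Rightarrow> sexp" where
  "car Atom = Atom"
| "car (Dot x y) = x"

fun cdr :: "sexp \<Rightarrow> sexp" where
  "cdr Atom = Atom"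
| "cdr (Dot x y) = y"

datatype expr =
    EVar nat
  | EAtom
  | EDot expr expr
  | ECar expr
  | ECdr expr
  | EIf expr expr expr
  | ECall nat "expr list"

type_synonym prog = "expr list \<times> expr"

text \<open>
  \<open>eval D \<rho> e x t\<close>: with function bodies \<open>D\<close> and argument list \<open>\<rho>\<close>, the expression \<open>e\<close>
  evaluates to \<open>x\<close> in exactly \<open>t\<close> steps. In a conditional the atom counts as false, every
  other value as true.
\<close>

inductive
  eval :: "expr list \<Rightarrow> sexp list \<Rightarrow> expr \<Rightarrow> sexp \<Rightarrow> nat \<Rightarrow> bool" and
  evals :: "expr list \<Rightarrow> sexp list \<Rightarrow> expr list \<Rightarrow> sexp list \<Rightarrow> nat \<Rightarrow> bool"
  for D :: "expr list" where
  eval_Var: "i < length \<rho> \<Longrightarrow> eval D \<rho> (EVar i) (\<rho> ! i) 1"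
| eval_Atom: "eval D \<rho> EAtom Atom 1"
| eval_Dot: "eval D \<rho> a x s \<Longrightarrow> eval D \<rho> b y t \<Longrightarrow> eval D \<rho> (EDot a b) (Dot x y) (s + t + 1)"
| eval_Car: "eval D \<rho> a x t \<Longrightarrow> eval D \<rho> (ECar a) (car x) (t + 1)"
| eval_Cdr: "eval D \<rho> a x t \<Longrightarrow> eval D \<rho> (ECdr a) (cdr x) (t + 1)"
| eval_If_true: "eval D \<rho> c x s \<Longrightarrow> x \<noteq> Atom \<Longrightarrow> eval D \<rho> a y t \<Longrightarrow>
    eval D \<rho> (EIf c a b) y (s + t + 1)"
| eval_If_false: "eval D \<rho> c Atom s \<Longrightarrow> eval D \<rho> b y t \<Longrightarrow>
    eval D \<rho> (EIf c a b) y (s + t + 1)"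
| eval_Call: "evals D \<rho> as xs s \<Longrightarrow> k < length D \<Longrightarrow> eval D xs (D ! k) y t \<Longrightarrow>
    eval D \<rho> (ECall k as) y (s + t + 1)"
| evals_Nil: "evals D \<rho> [] [] 0"
| evals_Cons: "eval D \<rho> a x s \<Longrightarrow> evals D \<rho> as xs t \<Longrightarrow> evals D \<rho> (a # as) (x # xs) (s + t)"

definition runs :: "prog \<Rightarrow> sexp \<Rightarrow> sexp \<Rightarrow> nat \<Rightarrow> bool" where
  "runs P inp out t \<longleftrightarrow> eval (fst P) [inp] (snd P) out t"

inductive_cases eval_VarE: "eval D \<rho> (EVar i) x t"
inductive_cases eval_AtomE: "eval D \<rho> EAtom x t"
inductive_cases eval_DotE: "eval D \<rho> (EDot a b) x t"
inductive_cases eval_CarE: "eval D \<rho> (ECar a) x t"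
inductive_cases eval_CdrE: "eval D \<rho> (ECdr a) x t"
inductive_cases eval_IfE: "eval D \<rho> (EIf c a b) x t"
inductive_cases eval_CallE: "eval D \<rho> (ECall k as) x t"
inductive_cases evals_NilE: "evals D \<rho> [] xs t"
inductive_cases evals_ConsE: "evals D \<rho> (a # as) xs t"

lemma eval_deterministic:
  "eval D \<rho> e x t \<Longrightarrow> (\<And>x' t'. eval D \<rho> e x' t' \<Longrightarrow> x' = x \<and> t' = t)"
  "evals D \<rho> es xs t \<Longrightarrow> (\<And>xs' t'. evals D \<rho> es xs' t' \<Longrightarrow> xs' = xs \<and> t' = t)"
proof (induction rule: eval_evals.inducts)
  case eval_Var then show ?case by (auto elim: eval_VarE)
next
  case eval_Atom then show ?case by (auto elim: eval_AtomE)
next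
  case eval_Dot
  from eval_Dot.prems show ?case
    by (rule eval_DotE) (use eval_Dot.IH in \<open>metis Suc_eq_plus1\<close>)+
next
  case eval_Car
  from eval_Car.prems show ?case
    by (rule eval_CarE) (use eval_Car.IH in \<open>metis Suc_eq_plus1\<close>)+
next
  case eval_Cdr
  from eval_Cdr.prems show ?case
    by (rule eval_CdrE) (use eval_Cdr.IH in \<open>metis Suc_eq_plus1\<close>)+
next
  case eval_If_true
  from eval_If_true.prems show ?case
    by (rule eval_IfE) (use eval_If_true in \<open>metis Suc_eq_plus1\<close>)+
next
  case eval_If_false
  from eval_If_false.prems show ?case
    by (rule eval_IfE) (use eval_If_false.IH in \<open>metis Suc_eq_plus1\<close>)+
next
  case eval_Call
  from eval_Call.prems show ?case
    by (rule eval_CallE) (use eval_Call in \<open>metis Suc_eq_plus1\<close>)+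
next
  case evals_Nil then show ?case by (auto elim: evals_NilE)
next
  case evals_Cons
  from evals_Cons.prems show ?case by (rule evals_ConsE) (use evals_Cons.IH in metis)
qed

lemma runs_deterministic:
  "runs P inp out t \<Longrightarrow> runs P inp out' t' \<Longrightarrow> out' = out \<and> t' = t"
  unfolding runs_def by (rule eval_deterministic(1))


section \<open>Encoding of instances and answers\<close>

text \<open>
  Digraphs given to an algorithm have vertex set \<open>{..<n}\<close>. They are encoded by adjacency
  matrices, and numbers in unary, so the size of the encoding is polynomial in \<open>n\<close>.
  A set of vertices is encoded by its characteristic vector.
\<close>

definition standard_verts :: "nat pair_pre_digraph \<Rightarrow> bool" where
  "standard_verts G \<longleftrightarrow> pverts G = {..<card (pverts G)}"

definition enc_list :: "sexp list \<Rightarrow> sexp" where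
  "enc_list xs = foldr Dot xs Atom"

definition enc_nat :: "nat \<Rightarrow> sexp" where
  "enc_nat n = enc_list (replicate n Atom)"

definition enc_bool :: "bool \<Rightarrow> sexp" where
  "enc_bool b = (if b then Dot Atom Atom else Atom)"

definition enc_digraph :: "nat pair_pre_digraph \<Rightarrow> sexp" where
  "enc_digraph G =
     (let n = card (pverts G) in
      enc_list (map (\<lambda>u. enc_list (map (\<lambda>v. enc_bool ((u, v) \<in> parcs G)) [0..<n])) [0..<n]))"

definition enc_instance ::
  "nat pair_pre_digraph \<Rightarrow> nat pair_pre_digraph \<Rightarrow> (nat \<Rightarrow> nat) \<Rightarrow> sexp" where
  "enc_instance G T L =
     enc_list [enc_digraph G, enc_digraph T,
               enc_list (map (\<lambda>v. enc_nat (L v)) [0..<card (pverts G)])]"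

definition enc_answer :: "nat \<Rightarrow> nat set option \<Rightarrow> sexp" where
  "enc_answer n ans =
     (case ans of
        None \<Rightarrow> Atom
      | Some S \<Rightarrow> Dot Atom (enc_list (map (\<lambda>v. enc_bool (v \<in> S)) [0..<n])))"

end

theory Submission
  imports Defs
begin

text \<open>
  The problem is solved by dynamic programming over the branch decomposition, and the proof has to
  show that the tables stay small, that they suffice, and that a concrete program maintains them in
  the claimed number of steps.

  \<^emph>\<open>Small tables.\<close> Fix a cut \<open>(A, B)\<close>. Since the four sets are finite or cofinite, there is a \<open>d\<close> such
  that only the number of solution vertices in a ball, capped at \<open>d\<close>, matters. Call two subsets of \<open>A\<close>
  equivalent if all balls around vertices outside \<open>A\<close> have the same capped counts. A set all of
  whose elements have private neighbours across the cut at distance at most \<open>r\<close> yields an induced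
  matching of the cut, at the loss of a factor \<open>r\<close>: consider walks from the elements to their private
  neighbours that cross the cut in the same position (\<open>near_private_bound\<close>). Repeatedly extracting
  minimal hitting sets therefore shrinks every subset of \<open>A\<close> to an equivalent one with at most
  \<open>d * r * bimim G A\<close> elements (\<open>capped_balls_subset\<close>). Hence the number of classes is at most
  \<open>(n + 1) ^ (d * r * w)\<close> on either side of each cut of a decomposition of width \<open>w\<close>.

  \<^emph>\<open>Sufficient tables.\<close> For each cut, and for each class of continuations on the other side, one best
  partial solution per class is kept (\<open>represents\<close>). Two neighbouring parts are combined
  by forming all unions and pruning. Exchanging one part of a solution for an equivalent one is
  invisible to the vertices outside this part, so nothing is lost (\<open>unions_represent\<close>,
  \<open>represents_combine\<close>). At a node of the tree the parts met so far always form a side of a tree edge or the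
  complement of one, apart from trivial cases (\<open>bimim_pieces\<close>), so the class bound applies to all of them.

  \<^emph>\<open>The program.\<close> It computes the balls by \<open>r\<close> rounds of growing, then walks through the tree from
  node \<open>0\<close> and combines the tables of the neighbours of each node. Every function has a specification
  that consists of its value and a step bound. All loops run over lists whose length is bounded by a
  number \<open>B\<close>, namely the vertices, the rows of the tree, and the pruned tables, so the total is a
  polynomial in \<open>B\<close> whose coefficients and degree do not depend on the width (\<open>poly_bounded_cSolve\<close>).
  Finally \<open>B\<close> itself is polynomial in \<open>n\<close>, with an exponent linear in \<open>w\<close>. Here the
  tree has at most \<open>2 * n\<close> nodes because its inner nodes have degree 3 (\<open>card_le_leaves\<close>).
\<close>

section \<open>Distances as lengths of walks\<close>

lemma awalk_relpow:
  assumes "pair_wf_digraph G" "pre_digraph.awalk (with_proj G) u p v"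
  shows "(u, v) \<in> parcs G ^^ length p"
proof -
  interpret pair_wf_digraph G by fact
  have "awalk u p v" using assms(2) by simp
  then show ?thesis
  proof (induction p arbitrary: u)
    case Nil then show ?case by (simp add: awalk_Nil_iff)
  next
    case (Cons e p)
    then have "e \<in> parcs G" "fst e = u" "awalk (snd e) p v" by (auto simp: awalk_Cons_iff)
    then show ?case using Cons.IH[of "snd e"] by (metis length_Cons prod.collapse relpow_Suc_I2)
  qed
qed

lemma relpow_awalk:
  assumes "pair_wf_digraph G" "u \<in> pverts G" "(u, v) \<in> parcs G ^^ i"
  shows "\<exists>p. pre_digraph.awalk (with_proj G) u p v \<and> length p = i"
proof -
  interpret pair_wf_digraph G by fact
  have "\<exists>p. awalk u p v \<and> length p = i" using assms(2,3)
  proof (induction i arbitrary: u)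
    case 0 then show ?case by (auto simp: awalk_Nil_iff)
  next
    case (Suc i)
    then obtain w where w: "(u, w) \<in> parcs G" "(w, v) \<in> parcs G ^^ i"
      by (metis relpow_Suc_D2)
    with Suc.IH[of w] obtain p where "awalk w p v" "length p = i"
      by (auto dest: in_arcsD2)
    then show ?case using w by (intro exI[of _ "(u, w) # p"]) (auto simp: awalk_Cons_iff)
  qed
  then show ?thesis by simp
qed

text \<open>
  Cutting out closed subwalks turns a walk into a path and never makes it longer.
\<close>
lemma awalk_shorten:
  assumes "wf_digraph H" "pre_digraph.awalk H u p v"
  shows "\<exists>q. pre_digraph.apath H u q v \<and> length q \<le> length p"
proof -
  interpret wf_digraph H by fact
  from assms(2) show ?thesis
  proof (induction rule: awalk_to_apath_induct)
    case (path p) then show ?case by (auto simp: apath_def)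
  next
    case (decomp p q r s) then show ?case by (fastforce elim!: awalk_cyc_decompE)
  qed
qed

text \<open>
  Shortest paths may be replaced by arbitrary walks, and walks of length \<open>i\<close> are the pairs of the
  \<open>i\<close>-th relational power. All later arguments about distances concatenate and split walks and
  are carried out with relational powers.
\<close>
lemma digraph_dist_le_iff:
  assumes "pair_wf_digraph G" "u \<in> pverts G"
  shows "digraph_dist G u v \<le> enat r \<longleftrightarrow> (\<exists>i\<le>r. (u, v) \<in> parcs G ^^ i)"
proof -
  interpret pair_wf_digraph G by fact
  let ?P = "{p. pre_digraph.apath (with_proj G) u p v}"
  show ?thesis
  proof
    assume le: "digraph_dist G u v \<le> enat r"
    have ne: "?P \<noteq> {}"
    proof
      assume "?P = {}"
      then have "digraph_dist G u v = \<infinity>" unfolding digraph_dist_def by (simp add: top_enat_def)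
      with le show False by simp
    qed
    then have "Inf ((\<lambda>p. enat (length p)) ` ?P) \<in> (\<lambda>p. enat (length p)) ` ?P"
      by (metis (no_types, lifting) Inf_enat_def LeastI_ex equals0I image_is_empty)
    then obtain p where "apath u p v" "digraph_dist G u v = enat (length p)"
      unfolding digraph_dist_def by auto
    then show "\<exists>i\<le>r. (u, v) \<in> parcs G ^^ i"
      using le awalk_relpow[OF assms(1), of u p v] by (auto simp: apath_def)
  next
    assume "\<exists>i\<le>r. (u, v) \<in> parcs G ^^ i"
    then obtain p where "awalk u p v" "length p \<le> r"
      using relpow_awalk[OF assms] by auto
    then obtain q where "q \<in> ?P" "length q \<le> r"
      using awalk_shorten[OF wf_digraph_axioms, of u p v] by auto
    then show "digraph_dist G u v \<le> enat r" unfolding digraph_dist_def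
      by (metis (no_types, lifting) INF_lower2 enat_ord_simps(1))
  qed
qed

section \<open>Trees and the two sides of an edge\<close>

text \<open>
  The component of \<open>x\<close> after the deletion of the edge between \<open>x\<close> and \<open>p\<close>. An undirected edge
  is a pair of opposite arcs, so both have to be removed. Working with plain relations keeps
  the tree arguments free of subgraphs.
\<close>
definition side :: "'b rel \<Rightarrow> 'b \<Rightarrow> 'b \<Rightarrow> 'b set" where
  "side E x p = (E - {(x, p), (p, x)})\<^sup>* `` {x}"

lemma side_step: "z \<in> side E x p \<Longrightarrow> (z, z') \<in> E - {(x, p), (p, x)} \<Longrightarrow> z' \<in> side E x p"
  unfolding side_def by (auto intro: rtrancl_into_rtrancl)

lemma cut_side_eq_side:
  assumes "pair_wf_digraph T" "x \<in> pverts T"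
  shows "cut_side G T L (x, p) = {v \<in> pverts G. L v \<in> side (parcs T) x p}"
proof -
  interpret pair_wf_digraph T by fact
  have "reachable (with_proj (delete_edge T (x, p))) x z \<longleftrightarrow> z \<in> side (parcs T) x p" for z
  proof
    show "reachable (with_proj (delete_edge T (x, p))) x z \<Longrightarrow> z \<in> side (parcs T) x p"
      using rtrancl_on_rtranclI[of x z]
      by (auto simp: reachable_def side_def delete_edge_def)
  next
    assume "z \<in> side (parcs T) x p"
    then have "(x, z) \<in> (parcs T - {(x, p), (p, x)})\<^sup>*" by (auto simp: side_def)
    then have "z \<in> pverts T \<and> (x, z) \<in> rtrancl_on (pverts T) (parcs T - {(x, p), (p, x)})"
      by (induction rule: rtrancl_induct)
         (use assms in \<open>auto intro: rtrancl_on_into_rtrancl_on dest: in_arcsD2\<close>)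
    then show "reachable (with_proj (delete_edge T (x, p))) x z"
      by (simp add: reachable_def delete_edge_def)
  qed
  then show ?thesis by (simp add: cut_side_def)
qed

lemma apath_pair:
  assumes "pair_wf_digraph H" "pre_digraph.apath (with_proj H) x q p"
  shows "set q \<subseteq> parcs H" "pcas x q p" "distinct (pawalk_verts x q)"
proof -
  interpret pair_wf_digraph H by fact
  have "apath x q p" using assms(2) by simp
  then show "set q \<subseteq> parcs H" "pcas x q p" "distinct (pawalk_verts x q)"
    by (auto simp: apath_def awalk_def)
qed

text \<open>
  A path from \<open>x\<close> to \<open>p\<close> that avoids the edge between them has length at least 2, and together
  with that edge it is a cycle of length at least 3.
\<close>
lemma tree_side_separates:
  assumes "undirected_tree T" "(x, p) \<in> parcs T"
  shows "p \<notin> side (parcs T) x p"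
proof
  assume p: "p \<in> side (parcs T) x p"
  let ?H = "delete_edge T (x, p)"
  have pg: "pair_graph T" using assms(1) by (simp add: undirected_tree_def)
  interpret pair_graph T by fact
  have xp: "x \<in> pverts T" "p \<in> pverts T" "x \<noteq> p" "(p, x) \<in> parcs T"
    using no_loops'[OF assms(2)] in_arcsD1[OF assms(2)] in_arcsD2[OF assms(2)]
      arcs_symmetric[OF assms(2)] by simp_all
  have wfH: "pair_wf_digraph ?H" by unfold_locales (auto simp: delete_edge_def dest: in_arcsD1 in_arcsD2)
  obtain i where "(x, p) \<in> parcs ?H ^^ i"
    using p by (auto simp: side_def delete_edge_def rtrancl_power)
  then obtain q0 where "pre_digraph.awalk (with_proj ?H) x q0 p"
    using relpow_awalk[OF wfH, of x p i] xp by (auto simp: delete_edge_def)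
  then obtain q where q: "pre_digraph.apath (with_proj ?H) x q p"
    using awalk_shorten[of "with_proj ?H"] wfH wf_digraph_wp_iff[of ?H] by metis
  have sub: "set q \<subseteq> parcs T - {(x, p), (p, x)}" "pcas x q p" "distinct (pawalk_verts x q)"
    using apath_pair[OF wfH q] by (simp_all add: delete_edge_def)
  have "length q \<noteq> 0" using sub(2) xp(3) by auto
  moreover have "length q \<noteq> Suc 0"
  proof
    assume "length q = Suc 0"
    then obtain e where "q = [e]" by (auto simp: length_Suc_conv)
    then show False using sub(1,2) by (cases e) auto
  qed
  ultimately have len: "2 \<le> length q" by linarith
  have "awalk x q p" using sub(1,2) xp(1) unfolding awalk_def by blast
  then have "awalk p ((p, x) # q) p" using xp(4) by (simp add: awalk_Cons_iff)
  moreover have "tl (pawalk_verts p ((p, x) # q)) = pawalk_verts x q" by simp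
  ultimately have "cycle ((p, x) # q)" using sub unfolding cycle_def by (metis list.distinct(1))
  moreover have "3 \<le> length ((p, x) # q)" using len by simp
  ultimately show False using assms(1) unfolding undirected_tree_def by blast
qed


text \<open>
  What the dynamic program uses about trees: the graph is connected and every edge separates
  its two ends. Acyclicity enters only through \<open>sep\<close>.
\<close>
locale tree_rel =
  fixes E :: "'b rel" and W :: "'b set"
  assumes sub: "E \<subseteq> W \<times> W" and fin: "finite W" and sym: "sym E"
    and sep: "(x, p) \<in> E \<Longrightarrow> p \<notin> side E x p"
    and conn: "x \<in> W \<Longrightarrow> z \<in> W \<Longrightarrow> (x, z) \<in> E\<^sup>*"
begin

abbreviation nbrs :: "'b \<Rightarrow> 'b set" where "nbrs x \<equiv> {y. (x, y) \<in> E}"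

lemma symE: "(x, y) \<in> E \<longleftrightarrow> (y, x) \<in> E"
  using sym by (auto dest: symD)

lemma side_refl: "x \<in> side E x p"
  by (simp add: side_def)

lemma irrefl: "(x, x) \<notin> E"
  using sep[of x x] side_refl by blast

lemma finite_nbrs: "finite (nbrs x)"
  by (rule finite_subset[OF _ fin]) (use sub in auto)

lemma side_sub: "x \<in> W \<Longrightarrow> side E x p \<subseteq> W"
proof
  fix z assume "x \<in> W" "z \<in> side E x p"
  then have "(x, z) \<in> (E - {(x, p), (p, x)})\<^sup>*" by (simp add: side_def)
  then show "z \<in> W" by (induction rule: rtrancl_induct) (use \<open>x \<in> W\<close> sub in auto)
qed

text \<open>
  The deleted edge is the only way out of a side, and it leads to the parent \<open>x\<close>.
\<close>
lemma side_closed: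
  assumes "(y, x) \<in> E" "z \<in> side E y x" "(z, z') \<in> E" "z' \<noteq> x"
  shows "z' \<in> side E y x"
proof -
  have "z \<noteq> x" using sep assms by blast
  then have "(z, z') \<in> E - {(y, x), (x, y)}" using assms by auto
  then show ?thesis using assms(2) side_step by metis
qed

lemma side_children_sub:
  assumes "(x, y) \<in> E" "y \<noteq> p"
  shows "side E y x \<subseteq> side E x p"
proof
  fix z assume "z \<in> side E y x"
  then have "(y, z) \<in> (E - {(y, x), (x, y)})\<^sup>*" by (simp add: side_def)
  then show "z \<in> side E x p"
  proof (induction rule: rtrancl_induct)
    case base then show ?case using assms irrefl by (auto simp: side_def)
  next
    case (step z z')
    have z: "z \<in> side E y x" using step.hyps by (simp add: side_def)
    have z': "z' \<in> side E y x" using side_step[OF z step.hyps(2)] .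
    from z z' have "z \<noteq> x" "z' \<noteq> x" using sep[of y x] assms symE by blast+
    then have "(z, z') \<in> E - {(x, p), (p, x)}" using step by auto
    then show ?case using step.IH side_step by metis
  qed
qed

text \<open>
  A walk that starts in \<open>x\<close> either is at \<open>x\<close> or is inside the side of a neighbour that it has
  entered from \<open>x\<close>: by \<open>side_closed\<close> it can leave such a side only through \<open>x\<close>. This invariant yields
  both the decomposition of a side and that of the whole tree.
\<close>
lemma reach_in_children:
  assumes "(x, z) \<in> F\<^sup>*" "F \<subseteq> E"
  shows "z = x \<or> (\<exists>y. (x, y) \<in> F \<and> z \<in> side E y x)"
  using assms(1)
proof (induction rule: rtrancl_induct)
  case (step z z')
  have zz: "(z, z') \<in> E" using step assms by auto
  from step.IH show ?case
  proof
    assume "z = x"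
    then show ?thesis using step.hyps side_refl by blast
  next
    assume "\<exists>y. (x, y) \<in> F \<and> z \<in> side E y x"
    then obtain y where y: "(x, y) \<in> F" "z \<in> side E y x" by auto
    then have "(y, x) \<in> E" using assms(2) symE by blast
    then show ?thesis using side_closed y zz by blast
  qed
qed simp

lemma side_unfold:
  "side E x p = insert x (\<Union>y \<in> nbrs x - {p}. side E y x)"
proof
  show "side E x p \<subseteq> insert x (\<Union>y \<in> nbrs x - {p}. side E y x)"
  proof
    fix z assume "z \<in> side E x p"
    then have "(x, z) \<in> (E - {(x, p), (p, x)})\<^sup>*" by (simp add: side_def)
    from reach_in_children[OF this] show "z \<in> insert x (\<Union>y \<in> nbrs x - {p}. side E y x)"
      by auto
  qed
  show "insert x (\<Union>y \<in> nbrs x - {p}. side E y x) \<subseteq> side E x p"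
    using side_children_sub side_refl by fastforce
qed

lemma all_unfold:
  assumes "x \<in> W"
  shows "W = insert x (\<Union>y \<in> nbrs x. side E y x)"
proof
  show "W \<subseteq> insert x (\<Union>y \<in> nbrs x. side E y x)"
    using reach_in_children[OF conn[OF assms] order.refl] by blast
  show "insert x (\<Union>y \<in> nbrs x. side E y x) \<subseteq> W"
    using assms side_sub sub by blast
qed

lemma side_not_parent: "(x, y) \<in> E \<Longrightarrow> x \<notin> side E y x"
  using sep symE by blast

text \<open>
  Otherwise walking back from a common vertex to \<open>y'\<close> stays inside the side of \<open>y\<close>, and then the arc
  from \<open>y'\<close> to \<open>x\<close> connects \<open>y\<close> with \<open>x\<close> although the edge between them is deleted.
\<close>
lemma sides_disjoint:
  assumes "(x, y) \<in> E" "(x, y') \<in> E" "y \<noteq> y'"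
  shows "side E y x \<inter> side E y' x = {}"
proof (rule ccontr)
  assume "side E y x \<inter> side E y' x \<noteq> {}"
  then obtain z where z: "z \<in> side E y x" "z \<in> side E y' x" by blast
  from z(2) have "(y', z) \<in> (E - {(y', x), (x, y')})\<^sup>*" by (simp add: side_def)
  then have "z \<in> side E y x \<longrightarrow> y' \<in> side E y x"
  proof (induction rule: rtrancl_induct)
    case (step z z')
    have "z \<in> side E y' x" using step.hyps by (simp add: side_def)
    then have "z \<noteq> x" using side_not_parent assms by blast
    then have "z' \<in> side E y x \<longrightarrow> z \<in> side E y x"
      using side_closed[of y x z' z] step.hyps assms symE by blast
    then show ?case using step.IH by blast
  qed simp
  then have "(y, y') \<in> (E - {(y, x), (x, y)})\<^sup>*" using z by (simp add: side_def)
  then have "y' \<in> side E y x" by (simp add: side_def)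
  moreover have "(y', x) \<in> E - {(y, x), (x, y)}" using assms symE irrefl by auto
  ultimately have "x \<in> side E y x" using side_step by metis
  then show False using side_not_parent assms by blast
qed

text \<open>
  Induction over the subtrees hanging below a node \<open>x\<close> whose parent is \<open>p\<close>. The sides shrink
  because the side of a child misses \<open>x\<close>.
\<close>
lemma side_induct [consumes 1, case_names step]:
  assumes "(x, p) \<in> E"
    and step: "\<And>x p. (x, p) \<in> E \<Longrightarrow> (\<And>y. (x, y) \<in> E \<Longrightarrow> y \<noteq> p \<Longrightarrow> P y x) \<Longrightarrow> P x p"
  shows "P x p"
  using assms(1)
proof (induction "card (side E x p)" arbitrary: x p rule: less_induct)
  case less
  show ?case
  proof (rule step[OF less.prems])
    fix y assume y: "(x, y) \<in> E" "y \<noteq> p"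
    have "x \<in> W" using y sub by auto
    have "side E y x \<subset> side E x p"
      using side_children_sub[OF y] side_not_parent[OF y(1)] side_refl[of x p] by blast
    then have "card (side E y x) < card (side E x p)"
      using side_sub[OF \<open>x \<in> W\<close>] fin by (meson finite_subset psubset_card_mono)
    then show "P y x" using less.hyps[of y x] y symE by blast
  qed
qed

lemma card_children:
  assumes "N \<subseteq> nbrs x" "x \<in> W"
  shows "card (A \<inter> (\<Union>y \<in> N. side E y x)) = (\<Sum>y\<in>N. card (A \<inter> side E y x))"
proof -
  have f: "finite N" using assms finite_nbrs finite_subset by blast
  have "finite (side E y x)" if "y \<in> N" for y
    using side_sub[of y x] that assms sub fin finite_subset by blast
  moreover have "A \<inter> side E y x \<inter> (A \<inter> side E z x) = {}" if "y \<in> N" "z \<in> N" "y \<noteq> z" for y z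
    using sides_disjoint[of x y z] that assms by blast
  ultimately show ?thesis unfolding Int_UN_distrib
    by (intro card_UN_disjoint) (use f in auto)
qed

lemma card_side:
  assumes "x \<in> W"
  shows "card (side E x p) = Suc (\<Sum>y \<in> nbrs x - {p}. card (side E y x))"
proof -
  define U where "U = (\<Union>y \<in> nbrs x - {p}. side E y x)"
  have side: "side E x p = insert x U" unfolding U_def by (rule side_unfold)
  moreover have "finite (side E x p)" using side_sub[OF assms] fin finite_subset by blast
  moreover have "x \<notin> U" using side_not_parent by (auto simp: U_def)
  ultimately have "card (side E x p) = Suc (card U)" by simp
  also have "card U = (\<Sum>y \<in> nbrs x - {p}. card (side E y x))"
    using card_children[OF Diff_subset assms, of UNIV "{p}"] by (simp add: U_def)
  finally show ?thesis .
qed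

text \<open>
  A binary tree with \<open>l\<close> leaves has \<open>2 * l - 1\<close> nodes: a node of degree 3 has two children besides
  its parent, and the bound adds up over them.
\<close>
lemma card_side_le_leaves:
  assumes deg: "\<And>x. x \<in> W \<Longrightarrow> card (nbrs x) = 1 \<or> card (nbrs x) = 3"
    and xp: "(x, p) \<in> E"
  shows "card (side E x p) + 1 \<le> 2 * card ({z \<in> W. card (nbrs z) = 1} \<inter> side E x p)"
    (is "_ \<le> 2 * card (?A \<inter> _)")
  using xp
proof (induction rule: side_induct)
  case (step x p)
  have x: "x \<in> W" using step.hyps sub by auto
  have fin': "finite (?A \<inter> side E x p)" using fin by auto
  have cN: "card (nbrs x - {p}) = card (nbrs x) - 1"
    using step.hyps finite_nbrs[of x] by simp
  show ?case
  proof (cases "card (nbrs x) = 1")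
    case True
    then have "nbrs x - {p} = {}" using cN finite_nbrs[of x] by (metis card_0_eq diff_self_eq_0 finite_Diff)
    then have "card (side E x p) = 1" unfolding card_side[OF x] by (simp only: sum.empty)
    moreover have "x \<in> ?A \<inter> side E x p" using True x side_refl[of x p] by simp
    moreover from this have "0 < card (?A \<inter> side E x p)" using fin' card_gt_0_iff by blast
    ultimately show ?thesis by linarith
  next
    case False
    then have "card (nbrs x - {p}) = 2" using cN deg[OF x] by auto
    moreover have "(\<Sum>y \<in> nbrs x - {p}. card (side E y x) + 1)
        \<le> (\<Sum>y \<in> nbrs x - {p}. 2 * card (?A \<inter> side E y x))"
      by (rule sum_mono) (use step.IH in auto)
    moreover have "(\<Sum>y \<in> nbrs x - {p}. card (?A \<inter> side E y x)) \<le> card (?A \<inter> side E x p)"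
      unfolding card_children[OF Diff_subset x, symmetric]
      by (rule card_mono[OF fin']) (use side_unfold[of x p] in blast)
    ultimately show ?thesis unfolding card_side[OF x] sum.distrib sum_distrib_left[symmetric]
      by simp
  qed
qed

lemma card_le_leaves:
  assumes deg: "\<And>x. x \<in> W \<Longrightarrow> card (nbrs x) = 1 \<or> card (nbrs x) = 3"
    and xp: "(x, p) \<in> E"
  shows "card W \<le> 2 * card {z \<in> W. card (nbrs z) = 1}" (is "_ \<le> 2 * card ?A")
    and "2 \<le> card {z \<in> W. card (nbrs z) = 1}"
proof -
  have x: "x \<in> W" "p \<in> W" using xp sub by auto
  have W: "W = side E x p \<union> side E p x"
    using all_unfold[OF x(1)] side_unfold[of x p] xp
    by blast
  have dis: "side E x p \<inter> side E p x = {}"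
  proof -
    have "side E y x \<inter> side E p x = {}" if "y \<in> nbrs x - {p}" for y
      using sides_disjoint[of x y p] that xp by blast
    then show ?thesis using side_not_parent[OF xp] unfolding side_unfold[of x p] by blast
  qed
  have f: "finite (side E x p)" "finite (side E p x)"
    using side_sub x fin finite_subset by blast+
  have cW: "card W = card (side E x p) + card (side E p x)"
    using card_Un_disjoint[OF f dis] W by simp
  then have cW: "card W = card (side E x p) + card (side E p x)" .
  have le: "card (side E x p) + 1 \<le> 2 * card (?A \<inter> side E x p)"
    "card (side E p x) + 1 \<le> 2 * card (?A \<inter> side E p x)"
    using card_side_le_leaves[OF deg xp] card_side_le_leaves[OF deg, of p x] xp symE by auto
  have "card (?A \<inter> side E x p) + card (?A \<inter> side E p x)
      = card ((?A \<inter> side E x p) \<union> (?A \<inter> side E p x))"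
    by (subst card_Un_disjoint) (use f dis in auto)
  also have "\<dots> \<le> card ?A" by (rule card_mono) (use fin in auto)
  finally have sum: "card (?A \<inter> side E x p) + card (?A \<inter> side E p x) \<le> card ?A" .
  then show "card W \<le> 2 * card ?A" using cW le by linarith
  have "0 < card (?A \<inter> side E x p)" "0 < card (?A \<inter> side E p x)" using le by arith+
  then show "2 \<le> card ?A" using sum by linarith
qed

end

lemma tree_rel_of_tree:
  assumes "undirected_tree T"
  shows "tree_rel (parcs T) (pverts T)"
proof -
  have pg: "pair_graph T" "connected (with_proj T)" using assms by (auto simp: undirected_tree_def)
  interpret pair_graph T by fact
  have "(x, z) \<in> (parcs T)\<^sup>*" if "x \<in> pverts T" "z \<in> pverts T" for x z
    using pg(2) that reachable_mk_symmetric_eq[OF pair_sym_arcs]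
      reachable_rtranclI[of "with_proj T" x z]
    by (auto simp: connected_def strongly_connected_def)
  then show ?thesis
    using tree_side_separates[OF assms] in_arcsD1 in_arcsD2 arcs_symmetric
    by unfold_locales (auto intro: symI)
qed

section \<open>Private neighbours at bounded distance and induced matchings\<close>

text \<open>
  The first arc of the walk that leaves \<open>A\<close> is the crossing.
\<close>
lemma relpow_crossing:
  assumes "(u, v) \<in> E ^^ k" "u \<in> A" "v \<in> C" "E \<subseteq> (A \<union> C) \<times> (A \<union> C)" "A \<inter> C = {}"
  shows "\<exists>i j a b. i + 1 + j = k \<and> (u, a) \<in> E ^^ i \<and> (a, b) \<in> E \<and> a \<in> A \<and> b \<in> C \<and> (b, v) \<in> E ^^ j"
  using assms(1,2)
proof (induction k arbitrary: u)
  case 0 then show ?case using assms by auto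
next
  case (Suc k)
  then obtain w where w: "(u, w) \<in> E" "(w, v) \<in> E ^^ k" by (metis relpow_Suc_D2)
  show ?case
  proof (cases "w \<in> A")
    case True
    from Suc.IH[OF w(2) True] obtain i j a b where
      "i + 1 + j = k" "(w, a) \<in> E ^^ i" "(a, b) \<in> E" "a \<in> A" "b \<in> C" "(b, v) \<in> E ^^ j" by blast
    then show ?thesis using relpow_Suc_I2[OF w(1), of a i]
      by (intro exI[of _ "Suc i"] exI[of _ j] exI[of _ a] exI[of _ b]) simp
  next
    case False
    then have "w \<in> C" using w assms by blast
    then show ?thesis using w Suc.prems by (intro exI[of _ 0] exI[of _ k]) auto
  qed
qed

definition near :: "'a rel \<Rightarrow> nat \<Rightarrow> 'a rel" where
  "near E r = {(u, v). \<exists>k\<le>r. (u, v) \<in> E ^^ k}"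

lemma relpow_converse_iff:
  fixes E :: "'a rel"
  shows "(u, v) \<in> (E\<inverse>) ^^ k \<longleftrightarrow> (v, u) \<in> E ^^ k"
proof (induction k arbitrary: v)
  case (Suc k)
  have "(u, v) \<in> (E\<inverse>) ^^ Suc k \<longleftrightarrow> (\<exists>w. (u, w) \<in> (E\<inverse>) ^^ k \<and> (w, v) \<in> E\<inverse>)" by auto
  also have "\<dots> \<longleftrightarrow> (\<exists>w. (v, w) \<in> E \<and> (w, u) \<in> E ^^ k)" using Suc by auto
  also have "\<dots> \<longleftrightarrow> (v, u) \<in> E ^^ Suc k" by (metis relpow_Suc_D2 relpow_Suc_I2)
  finally show ?case .
qed auto

lemma near_converse: "near (E\<inverse>) r = (near E r)\<inverse>"
  by (auto simp: near_def relpow_converse_iff)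

text \<open>
  For \<open>M \<subseteq> E \<inter> A \<times> C\<close> with disjoint \<open>A\<close> and \<open>C\<close> this says that \<open>M\<close> is an induced matching of the
  bipartite digraph between \<open>A\<close> and \<open>C\<close>; distinct arcs of \<open>M\<close> cannot share an endpoint, since
  otherwise one of them would itself be a cross arc. The condition is invariant
  under reversal of all arcs, which lets one argument serve both directions of a cut.
\<close>
definition cross_free :: "'a rel \<Rightarrow> 'a rel \<Rightarrow> bool" where
  "cross_free E M \<longleftrightarrow> (\<forall>e\<in>M. \<forall>f\<in>M. (fst e, snd f) \<in> E \<longrightarrow> e = f)"

lemma cross_free_converse: "cross_free (E\<inverse>) M \<Longrightarrow> cross_free E (M\<inverse>)"
  unfolding cross_free_def by (metis converseD converseI fst_conv prod.collapse snd_conv)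

text \<open>
  Taking balls of radius \<open>r\<close> multiplies the induced matching number of a cut by at most \<open>r\<close>.
  Every \<open>y \<in> Y\<close> has a short walk to its private target \<open>f y\<close>, and this walk crosses the cut at
  some position below \<open>r\<close>. Among the \<open>y\<close> that cross at the same position, the crossing arcs form
  an induced matching: an arc from the tail of one crossing to the head of another would
  splice two walks into a walk of length at most \<open>r\<close> from \<open>y\<close> to a target private to \<open>y'\<close>.
\<close>
lemma near_private_bound:
  assumes E: "E \<subseteq> (A \<union> C) \<times> (A \<union> C)" and AC: "A \<inter> C = {}"
    and Y: "finite Y" "Y \<subseteq> A"
    and f: "\<And>y. y \<in> Y \<Longrightarrow> f y \<in> C \<and> (y, f y) \<in> near E r"
    and priv: "\<And>y y'. y \<in> Y \<Longrightarrow> y' \<in> Y \<Longrightarrow> (y, f y') \<in> near E r \<Longrightarrow> y = y'"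
    and h: "\<And>M. M \<subseteq> E \<inter> A \<times> C \<Longrightarrow> cross_free E M \<Longrightarrow> card M \<le> h"
  shows "card Y \<le> r * h"
proof -
  have "\<exists>i j a b. i + 1 + j \<le> r \<and> (y, a) \<in> E ^^ i \<and> (a, b) \<in> E \<and> a \<in> A \<and> b \<in> C \<and> (b, f y) \<in> E ^^ j"
    if y: "y \<in> Y" for y
  proof -
    obtain k where k: "k \<le> r" "(y, f y) \<in> E ^^ k" using f[OF y] by (auto simp: near_def)
    show ?thesis using relpow_crossing[OF k(2) _ _ E AC] f[OF y] y Y k(1) by blast
  qed
  then obtain i j a b where P: "\<And>y. y \<in> Y \<Longrightarrow> i y + 1 + j y \<le> r \<and> (y, a y) \<in> E ^^ i y
      \<and> (a y, b y) \<in> E \<and> a y \<in> A \<and> b y \<in> C \<and> (b y, f y) \<in> E ^^ j y"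
    by metis
  define Q where "Q q = {y \<in> Y. i y = q}" for q
  have "card (Q q) \<le> h" for q
  proof -
    let ?M = "(\<lambda>y. (a y, b y)) ` Q q"
    have key: "y = y'" if "y \<in> Q q" "y' \<in> Q q" "(a y, b y') \<in> E" for y y'
    proof -
      have y: "y \<in> Y" "y' \<in> Y" "i y = i y'" using that by (auto simp: Q_def)
      have "(y, a y) \<in> E ^^ i y" "(b y', f y') \<in> E ^^ j y'" using P y by blast+
      then have "(y, f y') \<in> E ^^ i y O E ^^ Suc (j y')"
        using relpow_Suc_I2[OF that(3)] by blast
      then have "(y, f y') \<in> E ^^ (i y + Suc (j y'))" by (simp only: relpow_add)
      moreover have "i y + Suc (j y') \<le> r" using P[OF y(2)] y(3) by linarith
      ultimately have "(y, f y') \<in> near E r" unfolding near_def by blast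
      then show ?thesis using priv y by blast
    qed
    have "cross_free E ?M" unfolding cross_free_def using key by auto
    moreover have "?M \<subseteq> E \<inter> A \<times> C" using P by (auto simp: Q_def)
    ultimately have "card ?M \<le> h" using h by blast
    moreover have "inj_on (\<lambda>y. (a y, b y)) (Q q)"
    proof (rule inj_onI)
      fix y y' assume yy: "y \<in> Q q" "y' \<in> Q q" "(a y, b y) = (a y', b y')"
      then have "(a y, b y') \<in> E" using P[of y] by (auto simp: Q_def)
      then show "y = y'" using key yy by blast
    qed
    ultimately show ?thesis by (simp add: card_image)
  qed
  moreover have "Y = (\<Union>q<r. Q q)"
  proof -
    have "i y < r" if "y \<in> Y" for y using P[OF that] by linarith
    then show ?thesis by (auto simp: Q_def)
  qed
  ultimately have "card Y \<le> (\<Sum>q<r. h)"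
    using card_UN_le[of "{..<r}" Q] sum_mono[of "{..<r}" "\<lambda>q. card (Q q)" "\<lambda>_. h"] by simp
  then show ?thesis by simp
qed

lemma cross_free_le_matching:
  assumes "finite (parcs G)" "A \<inter> C = {}" "M \<subseteq> parcs G \<inter> A \<times> C" "cross_free (parcs G) M"
  shows "card M \<le> max_induced_matching (bip_digraph G A C)"
proof -
  let ?H = "bip_digraph G A C"
  have H: "parcs ?H = parcs G \<inter> A \<times> C" by (simp add: bip_digraph_def)
  have cf: "e = f" if "e \<in> M" "f \<in> M" "(fst e, snd f) \<in> parcs G" for e f
    using assms(4) that by (auto simp: cross_free_def)
  have arc: "e \<in> parcs G \<and> fst e \<in> A \<and> snd e \<in> C" if "e \<in> parcs G \<inter> A \<times> C" for e
    using that by auto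
  have share: "fst e = fst f \<or> snd e = snd f"
    if "meets e f" "e \<in> parcs G \<inter> A \<times> C" "f \<in> parcs G \<inter> A \<times> C" for e f
    using that arc[OF that(2)] arc[OF that(3)] assms(2) by (auto simp: meets_def endpoints_def)
  have eqI: "e = f" if "e \<in> M" "f \<in> M" "fst e = fst f \<or> snd e = snd f" for e f
    using that cf[of e f] cf[of f e] assms(3) by (metis Int_iff prod.collapse subset_iff)
  have "induced_matching ?H M"
    unfolding induced_matching_def H
  proof (intro conjI ballI impI)
    show "M \<subseteq> parcs G \<inter> A \<times> C" by fact
  next
    fix e f assume "e \<in> M" "f \<in> M" "e \<noteq> f"
    then show "\<not> meets e f" using share[of e f] eqI[of e f] assms(3) by blast
  next
    fix h e f assume h: "h \<in> parcs G \<inter> A \<times> C" and ef: "e \<in> M" "f \<in> M" "e \<noteq> f"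
    show "\<not> (meets h e \<and> meets h f)"
    proof
      assume "meets h e \<and> meets h f"
      then have "fst h = fst e \<or> snd h = snd e" "fst h = fst f \<or> snd h = snd f"
        using share[of h e] share[of h f] h ef assms(3) by blast+
      then consider "fst e = fst f \<or> snd e = snd f" | "h = (fst e, snd f)" | "h = (fst f, snd e)"
        by (metis prod.collapse)
      then show False using eqI ef cf[of e f] cf[of f e] h by cases auto
    qed
  qed
  moreover have "{M. induced_matching ?H M} \<subseteq> Pow (parcs G)"
    by (auto simp: induced_matching_def H)
  then have "finite {M. induced_matching ?H M}" using assms(1) finite_subset by blast
  ultimately show ?thesis unfolding max_induced_matching_def
    by (intro Max_ge) auto
qed

lemma max_induced_matching_no_arcs:
  assumes "parcs H = {}" shows "max_induced_matching H = 0"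
proof -
  have "{M. induced_matching H M} = {{}}" using assms by (auto simp: induced_matching_def)
  then show ?thesis by (simp add: max_induced_matching_def)
qed

lemma bimim_empty: "bimim G {} = 0"
  by (simp add: bimim_def bip_digraph_def max_induced_matching_no_arcs)

lemma bimim_complement: "A \<subseteq> pverts G \<Longrightarrow> bimim G (pverts G - A) = bimim G A"
  by (simp add: bimim_def double_diff)

lemma min_add_cong:
  fixes d :: nat
  assumes "min d a = min d a'" "min d b = min d b'"
  shows "min d (a + b) = min d (a' + b')"
  using assms by (auto simp: min_def split: if_splits)

text \<open>
  Take a hitting subset of smallest size: by minimality, each of its elements is the only one in
  some \<open>N v\<close>.
\<close>
lemma hitting_subset:
  fixes N :: "'b \<Rightarrow> 'a set"
  assumes "finite X" and h: "\<And>Y. Y \<subseteq> X \<Longrightarrow> (\<forall>y\<in>Y. \<exists>v\<in>J. N v \<inter> Y = {y}) \<Longrightarrow> card Y \<le> h"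
  shows "\<exists>Y\<subseteq>X. card Y \<le> h \<and> (\<forall>v\<in>J. N v \<inter> X \<noteq> {} \<longrightarrow> N v \<inter> Y \<noteq> {})"
proof -
  let ?P = "\<lambda>Y. Y \<subseteq> X \<and> (\<forall>v\<in>J. N v \<inter> X \<noteq> {} \<longrightarrow> N v \<inter> Y \<noteq> {})"
  have "?P X" by simp
  then obtain Y where Y: "?P Y" and least: "\<And>Z. ?P Z \<Longrightarrow> card Y \<le> card Z"
    using ex_has_least_nat[of ?P X card] by blast
  have "\<exists>v\<in>J. N v \<inter> Y = {y}" if "y \<in> Y" for y
  proof -
    have "finite Y" using Y \<open>finite X\<close> finite_subset by blast
    then have "card (Y - {y}) < card Y" using that by (rule card_Diff1_less)
    then have "\<not> ?P (Y - {y})" using least[of "Y - {y}"] by linarith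
    moreover have "Y - {y} \<subseteq> X" using Y by blast
    ultimately obtain v where v: "v \<in> J" "N v \<inter> X \<noteq> {}" "N v \<inter> (Y - {y}) = {}" by auto
    then have "N v \<inter> Y \<noteq> {}" using Y by blast
    then have "N v \<inter> Y = {y}" using v(3) by blast
    then show ?thesis using v(1) by blast
  qed
  then have "card Y \<le> h" using Y h[of Y] by simp
  then show ?thesis using Y by (intro exI[of _ Y]) simp
qed

text \<open>
  Remove from \<open>X\<close> a small hitting set, \<open>d\<close> times in succession. As long as elements of \<open>N v \<inter> X\<close> remain,
  each round picks one of them, so after \<open>d\<close> rounds the intersection with \<open>N v\<close> is either complete
  or has at least \<open>d\<close> elements.
\<close>
lemma capped_subset:
  fixes N :: "'b \<Rightarrow> 'a set"
  assumes "finite X" and h: "\<And>Y. Y \<subseteq> X \<Longrightarrow> (\<forall>y\<in>Y. \<exists>v\<in>J. N v \<inter> Y = {y}) \<Longrightarrow> card Y \<le> h"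
  shows "\<exists>R\<subseteq>X. card R \<le> d * h \<and> (\<forall>v\<in>J. min d (card (N v \<inter> R)) = min d (card (N v \<inter> X)))"
  using assms
proof (induction d arbitrary: X)
  case 0 then show ?case by (intro exI[of _ "{}"]) auto
next
  case (Suc d)
  from hitting_subset[of X J N h, OF Suc.prems] obtain Y where
    Y: "Y \<subseteq> X" "card Y \<le> h" "\<And>v. v \<in> J \<Longrightarrow> N v \<inter> X \<noteq> {} \<Longrightarrow> N v \<inter> Y \<noteq> {}" by auto
  have "\<exists>R\<subseteq>X - Y. card R \<le> d * h \<and> (\<forall>v\<in>J. min d (card (N v \<inter> R)) = min d (card (N v \<inter> (X - Y))))"
  proof (rule Suc.IH)
    show "finite (X - Y)" using Suc.prems(1) by simp
    show "card Z \<le> h" if "Z \<subseteq> X - Y" "\<forall>y\<in>Z. \<exists>v\<in>J. N v \<inter> Z = {y}" for Z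
      using Suc.prems(2)[of Z] that by auto
  qed
  then obtain R where R: "R \<subseteq> X - Y" "card R \<le> d * h"
    "\<And>v. v \<in> J \<Longrightarrow> min d (card (N v \<inter> R)) = min d (card (N v \<inter> (X - Y)))" by blast
  have "finite (X - Y)" "finite Y" using Suc.prems(1) Y(1) finite_subset by auto
  moreover from this have "finite R" using R(1) finite_subset by auto
  ultimately have fin: "finite Y" "finite R" "finite (X - Y)" by auto
  have "min (Suc d) (card (N v \<inter> (Y \<union> R))) = min (Suc d) (card (N v \<inter> X))" if v: "v \<in> J" for v
  proof (cases "N v \<inter> X = {}")
    case True
    then have "N v \<inter> (Y \<union> R) = {}" using Y R by blast
    then show ?thesis using True by simp
  next
    case False
    have "card (N v \<inter> (Y \<union> R)) = card (N v \<inter> Y) + card (N v \<inter> R)"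
      unfolding Int_Un_distrib by (rule card_Un_disjoint) (use fin R in auto)
    moreover have "card (N v \<inter> X) = card (N v \<inter> Y) + card (N v \<inter> (X - Y))"
    proof -
      have "N v \<inter> X = (N v \<inter> Y) \<union> (N v \<inter> (X - Y))" using Y(1) by blast
      also have "card \<dots> = card (N v \<inter> Y) + card (N v \<inter> (X - Y))"
        by (rule card_Un_disjoint) (use fin in auto)
      finally show ?thesis .
    qed
    moreover have "0 < card (N v \<inter> Y)" using Y(3)[OF v False] fin by (simp add: card_gt_0_iff)
    ultimately show ?thesis using R(3)[OF v] by (auto simp: min_def split: if_splits)
  qed
  moreover have "card (Y \<union> R) \<le> Suc d * h" using card_Un_le[of Y R] Y R by simp
  ultimately show ?case using Y R by (intro exI[of _ "Y \<union> R"]) auto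
qed

text \<open>
  The vertices within distance \<open>r\<close>, along out-arcs or in-arcs according to the flag. Indexing the
  two families by a Boolean avoids stating everything twice.
\<close>
definition ball :: "'a rel \<Rightarrow> nat \<Rightarrow> bool \<Rightarrow> 'a \<Rightarrow> 'a set" where
  "ball E r out v = (if out then near E r `` {v} else (near E r)\<inverse> `` {v})"

lemma near_Suc: "near E (Suc k) `` {v} = near E k `` {v} \<union> (\<Union>u \<in> E `` {v}. near E k `` {u})"
proof (intro equalityI subsetI)
  fix w assume "w \<in> near E (Suc k) `` {v}"
  then obtain i where i: "i \<le> Suc k" "(v, w) \<in> E ^^ i" by (auto simp: near_def)
  show "w \<in> near E k `` {v} \<union> (\<Union>u \<in> E `` {v}. near E k `` {u})"
  proof (cases i)
    case 0
    then show ?thesis using i by (auto simp: near_def intro!: exI[of _ 0])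
  next
    case (Suc j)
    then obtain u where "(v, u) \<in> E" "(u, w) \<in> E ^^ j" using i(2) by (metis relpow_Suc_D2)
    then show ?thesis using i(1) Suc by (auto simp: near_def)
  qed
next
  fix w assume "w \<in> near E k `` {v} \<union> (\<Union>u \<in> E `` {v}. near E k `` {u})"
  then consider "(v, w) \<in> near E k" | u where "(v, u) \<in> E" "(u, w) \<in> near E k" by blast
  then show "w \<in> near E (Suc k) `` {v}"
  proof cases
    case 1
    then show ?thesis by (auto simp: near_def intro: le_SucI)
  next
    case 2
    then obtain j where "j \<le> k" "(u, w) \<in> E ^^ j" by (auto simp: near_def)
    then show ?thesis using relpow_Suc_I2[OF 2(1)] unfolding near_def by blast
  qed
qed

lemma ball_sub:
  assumes "E \<subseteq> V \<times> V" "v \<in> V"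
  shows "ball E r out v \<subseteq> V"
proof -
  have "w = v \<or> w \<in> V \<and> v \<in> V" if vw: "(v, w) \<in> E ^^ i" for i v w
  proof (cases i)
    case 0
    then show ?thesis using vw by simp
  next
    case (Suc j)
    obtain y where "(v, y) \<in> E" using relpow_Suc_D2[OF vw[unfolded Suc]] by blast
    moreover obtain z where "(z, w) \<in> E" using vw[unfolded Suc] by auto
    ultimately show ?thesis using assms(1) by blast
  qed
  then have near: "w = v \<or> w \<in> V \<and> v \<in> V" if "(v, w) \<in> near E r" for v w
    using that unfolding near_def by blast
  show ?thesis
  proof
    fix w assume "w \<in> ball E r out v"
    then have "(v, w) \<in> near E r \<or> (w, v) \<in> near E r" by (auto simp: ball_def split: if_splits)
    then show "w \<in> V" using near[of v w] near[of w v] assms(2) by blast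
  qed
qed

text \<open>
  The key bound of the algorithm: seen from outside \<open>A\<close>, with counts capped at \<open>d\<close>, every subset of
  \<open>A\<close> looks like one of its subsets with at most \<open>d * r * bimim G A\<close> elements. One small subset
  serves the out-balls, another one the in-balls; every set between their union and \<open>X\<close> has
  the same capped counts.
\<close>
lemma capped_balls_subset:
  assumes G: "pair_fin_digraph G" and A: "A \<subseteq> pverts G" and X: "X \<subseteq> A"
  shows "\<exists>R\<subseteq>X. card R \<le> d * (r * bimim G A) \<and>
    (\<forall>v \<in> pverts G - A. \<forall>out. min d (card (ball (parcs G) r out v \<inter> R))
       = min d (card (ball (parcs G) r out v \<inter> X)))"
proof -
  interpret pair_fin_digraph G by fact
  let ?C = "pverts G - A" and ?E = "parcs G"
  let ?h1 = "max_induced_matching (bip_digraph G A ?C)" and ?h2 = "max_induced_matching (bip_digraph G ?C A)"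
  have disj: "A \<inter> ?C = {}" by blast
  have finX: "finite X" using finite_subset[OF _ pair_finite_verts] A X by blast
  have E1: "?E \<subseteq> (A \<union> ?C) \<times> (A \<union> ?C)" by (auto dest: in_arcsD1 in_arcsD2)
  have "\<exists>R\<subseteq>X. card R \<le> d * (r * ?h1) \<and>
      (\<forall>v\<in>?C. min d (card (ball ?E r False v \<inter> R)) = min d (card (ball ?E r False v \<inter> X)))"
  proof (rule capped_subset[OF finX])
    fix Y assume Y: "Y \<subseteq> X" "\<forall>y\<in>Y. \<exists>v\<in>?C. ball ?E r False v \<inter> Y = {y}"
    then obtain f where f: "\<And>y. y \<in> Y \<Longrightarrow> f y \<in> ?C \<and> ball ?E r False (f y) \<inter> Y = {y}" by metis
    have fy: "f y \<in> ?C \<and> (y, f y) \<in> near ?E r" if "y \<in> Y" for y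
      using f[OF that] unfolding ball_def by auto
    have pr: "y = y'" if "y \<in> Y" "y' \<in> Y" "(y, f y') \<in> near ?E r" for y y'
      using f[OF that(2)] that unfolding ball_def by auto
    show "card Y \<le> r * ?h1"
    proof (rule near_private_bound[OF E1 disj finite_subset[OF Y(1) finX] subset_trans[OF Y(1) X] fy pr])
      fix M assume "M \<subseteq> ?E \<inter> A \<times> ?C" "cross_free ?E M"
      then show "card M \<le> ?h1" by (intro cross_free_le_matching pair_finite_arcs) auto
    qed
  qed
  then obtain R1 where R1: "R1 \<subseteq> X" "card R1 \<le> d * (r * ?h1)"
    "\<And>v. v \<in> ?C \<Longrightarrow> min d (card (ball ?E r False v \<inter> R1)) = min d (card (ball ?E r False v \<inter> X))"
    by blast
  have "\<exists>R\<subseteq>X. card R \<le> d * (r * ?h2) \<and>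
      (\<forall>v\<in>?C. min d (card (ball ?E r True v \<inter> R)) = min d (card (ball ?E r True v \<inter> X)))"
  proof (rule capped_subset[OF finX])
    fix Y assume Y: "Y \<subseteq> X" "\<forall>y\<in>Y. \<exists>v\<in>?C. ball ?E r True v \<inter> Y = {y}"
    then obtain f where f: "\<And>y. y \<in> Y \<Longrightarrow> f y \<in> ?C \<and> ball ?E r True (f y) \<inter> Y = {y}" by metis
    have fy: "f y \<in> ?C \<and> (y, f y) \<in> near (?E\<inverse>) r" if "y \<in> Y" for y
      using f[OF that] unfolding ball_def near_converse by auto
    have pr: "y = y'" if "y \<in> Y" "y' \<in> Y" "(y, f y') \<in> near (?E\<inverse>) r" for y y'
      using f[OF that(2)] that unfolding ball_def near_converse by auto
    have E2: "?E\<inverse> \<subseteq> (A \<union> ?C) \<times> (A \<union> ?C)" using E1 by blast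
    show "card Y \<le> r * ?h2"
    proof (rule near_private_bound[OF E2 disj finite_subset[OF Y(1) finX] subset_trans[OF Y(1) X] fy pr])
      fix M assume M: "M \<subseteq> ?E\<inverse> \<inter> A \<times> ?C" "cross_free (?E\<inverse>) M"
      have "card (M\<inverse>) \<le> ?h2"
        by (intro cross_free_le_matching pair_finite_arcs) (use M cross_free_converse in auto)
      then show "card M \<le> ?h2" by simp
    qed
  qed
  then obtain R2 where R2: "R2 \<subseteq> X" "card R2 \<le> d * (r * ?h2)"
    "\<And>v. v \<in> ?C \<Longrightarrow> min d (card (ball ?E r True v \<inter> R2)) = min d (card (ball ?E r True v \<inter> X))"
    by blast
  have between: "min d (card (B \<inter> (R1 \<union> R2))) = min d (card (B \<inter> X))"
    if "min d (card (B \<inter> R)) = min d (card (B \<inter> X))" "R = R1 \<or> R = R2" for B R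
  proof -
    have "card (B \<inter> R) \<le> card (B \<inter> (R1 \<union> R2))" "card (B \<inter> (R1 \<union> R2)) \<le> card (B \<inter> X)"
      using that(2) R1(1) R2(1) finite_subset[OF _ finX]
      by (auto intro!: card_mono)
    then show ?thesis using that(1) by (auto simp: min_def split: if_splits)
  qed
  have "min d (card (ball ?E r out v \<inter> (R1 \<union> R2))) = min d (card (ball ?E r out v \<inter> X))"
    if "v \<in> ?C" for v out
    using between[OF R1(3)[OF that]] between[OF R2(3)[OF that]] by (cases out) auto
  moreover have "card (R1 \<union> R2) \<le> d * (r * bimim G A)"
    using card_Un_le[of R1 R2] R1(2) R2(2) by (simp add: bimim_def algebra_simps)
  ultimately show ?thesis using R1 R2 by (intro exI[of _ "R1 \<union> R2"]) auto
qed

section \<open>Lists of representatives\<close>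

text \<open>
  A list holds at most one element of every class of \<open>eq\<close>. A new element competes with the member of
  its own class, and the better one with respect to \<open>le\<close> stays.
\<close>
fun insert_class :: "('s \<Rightarrow> 's \<Rightarrow> bool) \<Rightarrow> ('s \<Rightarrow> 's \<Rightarrow> bool) \<Rightarrow> 's \<Rightarrow> 's list \<Rightarrow> 's list" where
  "insert_class eq le X [] = [X]"
| "insert_class eq le X (Y # Ys) =
     (if eq X Y then (if le X Y then X else Y) # Ys else Y # insert_class eq le X Ys)"

fun collect :: "('s \<Rightarrow> 's \<Rightarrow> bool) \<Rightarrow> ('s \<Rightarrow> 's \<Rightarrow> bool) \<Rightarrow> ('s \<Rightarrow> bool) \<Rightarrow> 's list \<Rightarrow> 's list \<Rightarrow> 's list" where
  "collect eq le ok [] res = res"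
| "collect eq le ok (U # Us) res =
     collect eq le ok Us (if ok U then insert_class eq le U res else res)"

lemma collect_append:
  "collect eq le ok (Us @ Vs) res = collect eq le ok Vs (collect eq le ok Us res)"
  by (induction Us arbitrary: res) auto

abbreviation "unrelated eq \<equiv> sorted_wrt (\<lambda>X Y. \<not> eq X Y)"

context
  fixes eq le :: "'s \<Rightarrow> 's \<Rightarrow> bool"
  assumes eq: "equivp eq" and le_refl: "\<And>X. le X X"
    and le_trans: "\<And>X Y Z. le X Y \<Longrightarrow> le Y Z \<Longrightarrow> le X Z" and le_total: "\<And>X Y. le X Y \<or> le Y X"
begin

lemma set_insert_class: "set (insert_class eq le X Ys) \<subseteq> insert X (set Ys)"
  by (induction Ys) auto

lemma insert_class_covers:
  "Z \<in> insert X (set Ys) \<Longrightarrow> \<exists>Z'\<in>set (insert_class eq le X Ys). eq Z' Z \<and> le Z' Z"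
proof (induction Ys)
  case Nil then show ?case using eq le_refl equivp_reflp by fastforce
next
  case (Cons Y Ys)
  show ?case
  proof (cases "Z = Y \<or> Z = X")
    case True
    show ?thesis
    proof (cases "eq X Y")
      case e: True
      let ?Z = "if le X Y then X else Y"
      have "eq ?Z Z" using True e eq by (metis equivp_reflp equivp_symp)
      moreover have "le ?Z Z" using True le_refl le_total by auto
      ultimately show ?thesis using e by auto
    next
      case ne: False
      then show ?thesis using True Cons.IH le_refl equivp_reflp[OF eq] by auto
    qed
  next
    case False
    then have "Z \<in> set Ys" using Cons.prems by auto
    then show ?thesis using Cons.IH le_refl[of Z] equivp_reflp[OF eq, of Z] by auto
  qed
qed

lemma insert_class_unrelated: "unrelated eq Ys \<Longrightarrow> unrelated eq (insert_class eq le X Ys)"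
proof (induction Ys)
  case (Cons Y Ys)
  show ?case
  proof (cases "eq X Y")
    case True
    have "\<not> eq X Z" if "Z \<in> set Ys" for Z
      using Cons.prems that True eq by (metis equivp_symp equivp_transp sorted_wrt.simps(2))
    then show ?thesis using Cons.prems True by auto
  next
    case False
    then have "\<not> eq Y X" using eq equivp_symp by metis
    then show ?thesis using Cons set_insert_class[of X Ys] False by auto
  qed
qed simp

lemma set_collect: "set (collect eq le ok Us res) \<subseteq> set res \<union> {U \<in> set Us. ok U}"
proof (induction Us arbitrary: res)
  case (Cons U Us)
  then show ?case using set_insert_class[of U res] by (cases "ok U") (simp, blast)+
qed simp

lemma collect_covers:
  "Z \<in> set res \<or> Z \<in> set Us \<and> ok Z \<Longrightarrow> \<exists>Z'\<in>set (collect eq le ok Us res). eq Z' Z \<and> le Z' Z"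
proof (induction Us arbitrary: res Z)
  case Nil then show ?case using le_refl equivp_reflp[OF eq] by auto
next
  case (Cons U Us)
  let ?res = "if ok U then insert_class eq le U res else res"
  show ?case
  proof (cases "Z \<in> set Us \<and> ok Z")
    case True then show ?thesis using Cons.IH[of Z ?res] by simp
  next
    case False
    then have "\<exists>Z'\<in>set ?res. eq Z' Z \<and> le Z' Z"
      using Cons.prems insert_class_covers[of Z U res] le_refl equivp_reflp[OF eq] by auto
    then obtain Z' where Z': "Z' \<in> set ?res" "eq Z' Z" "le Z' Z" by blast
    then obtain Z'' where "Z'' \<in> set (collect eq le ok Us ?res)" "eq Z'' Z'" "le Z'' Z'"
      using Cons.IH[of Z' ?res] by blast
    then show ?thesis using Z' le_trans equivp_transp[OF eq] by (intro bexI[of _ Z'']) auto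
  qed
qed

lemma collect_unrelated: "unrelated eq res \<Longrightarrow> unrelated eq (collect eq le ok Us res)"
  by (induction Us arbitrary: res) (auto simp: insert_class_unrelated)

end

lemma unrelated_unique:
  assumes "equivp eq" "unrelated eq Xs" "X \<in> set Xs" "Y \<in> set Xs" "eq X Y"
  shows "X = Y"
  using assms(2-) by (induction Xs) (auto dest: equivp_symp[OF assms(1)])

lemma unrelated_distinct: "equivp eq \<Longrightarrow> unrelated eq Xs \<Longrightarrow> distinct Xs"
  by (induction Xs) (auto dest: equivp_reflp)

definition unions :: "'a set list \<Rightarrow> 'a set list \<Rightarrow> 'a set list" where
  "unions F H = concat (map (\<lambda>X. map (\<lambda>Y. X \<union> Y) H) F)"

lemma set_unions: "set (unions F H) = {X \<union> Y | X Y. X \<in> set F \<and> Y \<in> set H}"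
  by (auto simp: unions_def)

definition pref :: "goal \<Rightarrow> 'a set \<Rightarrow> 'a set \<Rightarrow> bool" where
  "pref g X Y \<longleftrightarrow> (case g of Minimum \<Rightarrow> card X \<le> card Y | Maximum \<Rightarrow> card Y \<le> card X)"

lemma pref_refl: "pref g X X"
  and pref_trans: "pref g X Y \<Longrightarrow> pref g Y Z \<Longrightarrow> pref g X Z"
  and pref_total: "pref g X Y \<or> pref g Y X"
  by (auto simp: pref_def split: goal.splits)

lemma pref_disjoint_Un:
  assumes "pref g X' X" "pref g Y' Y" "finite X" "finite Y" "finite X'" "finite Y'"
    "X \<inter> Y = {}" "X' \<inter> Y' = {}"
  shows "pref g (X' \<union> Y') (X \<union> Y)"
  using assms by (auto simp: pref_def card_Un_disjoint split: goal.splits)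

text \<open>
  Such a set is the set of entries of a list of length \<open>k\<close> over \<open>{..n}\<close>, where the value \<open>n\<close> pads the list.
\<close>
lemma card_small_subsets:
  "card {R. R \<subseteq> {..<n :: nat} \<and> card R \<le> k} \<le> (n + 1) ^ k"
proof -
  let ?lists = "{xs. set xs \<subseteq> {..n} \<and> length xs = k}"
  have "{R. R \<subseteq> {..<n} \<and> card R \<le> k} \<subseteq> (\<lambda>xs. set xs \<inter> {..<n}) ` ?lists"
  proof
    fix R assume "R \<in> {R. R \<subseteq> {..<n} \<and> card R \<le> k}"
    then have R: "R \<subseteq> {..<n}" "card R \<le> k" "finite R" using finite_subset by auto
    let ?xs = "sorted_list_of_set R @ replicate (k - card R) n"
    have "?xs \<in> ?lists" using R by (auto simp: set_replicate_conv_if)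
    moreover have "set ?xs \<inter> {..<n} = R" using R by (auto simp: set_replicate_conv_if)
    ultimately show "R \<in> (\<lambda>xs. set xs \<inter> {..<n}) ` ?lists" by blast
  qed
  moreover have fin: "finite ?lists" by (rule finite_lists_length_eq) simp
  ultimately have "card {R. R \<subseteq> {..<n} \<and> card R \<le> k} \<le> card ?lists"
    by (rule surj_card_le[rotated])
  also have "\<dots> = (n + 1) ^ k" using card_lists_length_eq[of "{..n}" k] by simp
  finally show ?thesis .
qed

section \<open>Partial solutions across a cut\<close>

text \<open>
  An abstract form of the problem: vertices \<open>{..<n}\<close>, for each vertex \<open>v\<close> two rows \<open>N out v\<close>, and a
  requirement \<open>C out b k\<close> on the number \<open>k\<close> of solution vertices in the row of \<open>v\<close>, where \<open>b\<close> tells whether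
  \<open>v\<close> belongs to the solution. Requirements see counts only up to \<open>d\<close>.
\<close>
locale capped_rows =
  fixes n d :: nat and N :: "bool \<Rightarrow> nat \<Rightarrow> nat set" and C :: "bool \<Rightarrow> bool \<Rightarrow> nat \<Rightarrow> bool"
    and g :: goal
  assumes capped: "C out b (min d k) \<longleftrightarrow> C out b k"
begin

text \<open>
  Two subsets of \<open>A\<close> that no vertex outside \<open>A\<close> can distinguish.
\<close>
definition eqv :: "nat set \<Rightarrow> nat set \<Rightarrow> nat set \<Rightarrow> bool" where
  "eqv A X Y \<longleftrightarrow> (\<forall>v\<in>{..<n} - A. \<forall>out. min d (card (N out v \<inter> X)) = min d (card (N out v \<inter> Y)))"

text \<open>
  The set \<open>S\<close> may contain vertices outside \<open>A\<close>, whose own requirements are ignored.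
\<close>
definition sat :: "nat set \<Rightarrow> nat set \<Rightarrow> bool" where
  "sat A S \<longleftrightarrow> (\<forall>v\<in>A. \<forall>out. C out (v \<in> S) (card (N out v \<inter> S)))"

text \<open>
  At most \<open>K\<close> classes, in the form in which the bound is used: it limits the length of the lists of
  pairwise inequivalent sets that the program keeps.
\<close>
definition few :: "nat set \<Rightarrow> nat \<Rightarrow> bool" where
  "few A K \<longleftrightarrow> (\<forall>Xs. set Xs \<subseteq> Pow A \<longrightarrow> unrelated (eqv A) Xs \<longrightarrow> length Xs \<le> K)"

lemma equivp_eqv: "equivp (eqv A)"
  unfolding eqv_def by (rule equivpI) (auto simp: reflp_def symp_def transp_def)

lemma collect_cover:
  "Z \<in> set res \<or> Z \<in> set Us \<and> ok Z \<Longrightarrow>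
    \<exists>Z'\<in>set (collect (eqv A) (pref g) ok Us res). eqv A Z' Z \<and> pref g Z' Z"
  by (rule collect_covers[OF equivp_eqv pref_refl _ pref_total]) (auto intro: pref_trans)

lemma collect_sub: "set (collect (eqv A) (pref g) ok Us res) \<subseteq> set res \<union> {U \<in> set Us. ok U}"
  by (rule set_collect[OF equivp_eqv pref_refl _ pref_total]) (auto intro: pref_trans)

lemma collect_unrel: "unrelated (eqv A) res \<Longrightarrow> unrelated (eqv A) (collect (eqv A) (pref g) ok Us res)"
  by (rule collect_unrelated[OF equivp_eqv pref_refl _ pref_total]) (auto intro: pref_trans)

lemma cap_Un:
  assumes "min d (card (B \<inter> X)) = min d (card (B \<inter> X'))" "finite X" "finite X'" "finite Y"
    "X \<inter> Y = {}" "X' \<inter> Y = {}"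
  shows "min d (card (B \<inter> (X \<union> Y))) = min d (card (B \<inter> (X' \<union> Y)))"
proof -
  have "card (B \<inter> (Z \<union> Y)) = card (B \<inter> Z) + card (B \<inter> Y)" if "finite Z" "Z \<inter> Y = {}" for Z
    unfolding Int_Un_distrib by (rule card_Un_disjoint) (use that assms(4) in auto)
  then show ?thesis using min_add_cong[OF assms(1) refl] assms by simp
qed

lemma eqv_Un:
  assumes "eqv A X X'" "X \<subseteq> A" "X' \<subseteq> A" "Y \<inter> A = {}" "A \<subseteq> {..<n}" "finite Y"
  shows "v \<in> {..<n} - A \<Longrightarrow> min d (card (N out v \<inter> (X \<union> Y))) = min d (card (N out v \<inter> (X' \<union> Y)))"
  by (rule cap_Un) (use assms finite_subset[of _ "{..<n}"] in \<open>auto simp: eqv_def\<close>)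

text \<open>
  Vertices outside \<open>A\<close> do not notice when the part of a solution inside \<open>A\<close> is exchanged for
  an equivalent one, whatever the part \<open>Y\<close> outside \<open>A\<close> is.
\<close>
lemma sat_eqv:
  assumes "eqv A X X'" "X \<subseteq> A" "X' \<subseteq> A" "Y \<inter> A = {}" "A \<subseteq> {..<n}" "finite Y"
    and "D \<subseteq> {..<n} - A" "sat D (X \<union> Y)"
  shows "sat D (X' \<union> Y)"
  unfolding sat_def
proof (intro ballI allI)
  fix v out assume v: "v \<in> D"
  then have "v \<in> X \<union> Y \<longleftrightarrow> v \<in> X' \<union> Y" using assms by auto
  moreover have "min d (card (N out v \<inter> (X \<union> Y))) = min d (card (N out v \<inter> (X' \<union> Y)))"
    using eqv_Un[OF assms(1-6)] v assms(7) by blast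
  moreover have "C out (v \<in> X \<union> Y) (card (N out v \<inter> (X \<union> Y)))" using assms(8) v by (auto simp: sat_def)
  ultimately show "C out (v \<in> X' \<union> Y) (card (N out v \<inter> (X' \<union> Y)))"
    using capped[of out "v \<in> X \<union> Y" "card (N out v \<inter> (X \<union> Y))"]
      capped[of out "v \<in> X' \<union> Y" "card (N out v \<inter> (X' \<union> Y))"] by simp
qed

lemma few_length:
  assumes "few A K" "set Xs \<subseteq> Pow A" "unrelated (eqv A) Xs" shows "length Xs \<le> K"
  using assms by (auto simp: few_def)

lemma few_collect:
  assumes "few A K" "set Us \<subseteq> Pow A"
  shows "length (collect (eqv A) (pref g) ok Us []) \<le> K"
  by (rule few_length[OF assms(1)])
     (use collect_sub[of A ok Us "[]"] assms(2) collect_unrel in auto)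

lemma few_mono: "few A a \<Longrightarrow> a \<le> b \<Longrightarrow> few A b"
  unfolding few_def using le_trans by blast

text \<open>
  If every class has a member of size at most \<open>k\<close>, choosing one injects the classes into the sets
  of that size or less.
\<close>
lemma few_of_small:
  assumes "A \<subseteq> {..<n}"
    and small: "\<And>X. X \<subseteq> A \<Longrightarrow> \<exists>R\<subseteq>X. card R \<le> k \<and> eqv A R X"
    and K: "(n + 1) ^ k \<le> K"
  shows "few A K"
  unfolding few_def
proof (intro allI impI)
  fix Xs assume Xs: "set Xs \<subseteq> Pow A" "unrelated (eqv A) Xs"
  have "\<forall>X. \<exists>R. X \<subseteq> A \<longrightarrow> R \<subseteq> X \<and> card R \<le> k \<and> eqv A R X" using small by blast
  then obtain f where f: "\<And>X. X \<subseteq> A \<Longrightarrow> f X \<subseteq> X \<and> card (f X) \<le> k \<and> eqv A (f X) X" by metis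
  have inj: "inj_on f (set Xs)"
  proof (rule inj_onI)
    fix X Y assume XY: "X \<in> set Xs" "Y \<in> set Xs" "f X = f Y"
    then have "X \<subseteq> A" "Y \<subseteq> A" using Xs(1) by blast+
    then have "eqv A (f X) X" "eqv A (f X) Y" using f[of X] f[of Y] XY(3) by simp_all
    then have "eqv A X Y" by (rule equivp_transp[OF equivp_eqv equivp_symp[OF equivp_eqv]])
    then show "X = Y" using unrelated_unique[OF equivp_eqv Xs(2) XY(1,2)] by simp
  qed
  have img: "f ` set Xs \<subseteq> {R. R \<subseteq> {..<n} \<and> card R \<le> k}"
  proof
    fix R assume "R \<in> f ` set Xs"
    then obtain X where "X \<in> set Xs" "R = f X" by blast
    then show "R \<in> {R. R \<subseteq> {..<n} \<and> card R \<le> k}" using f[of X] Xs(1) assms(1) by auto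
  qed
  have "card (set Xs) = card (f ` set Xs)" by (rule card_image[OF inj, symmetric])
  also have "\<dots> \<le> card {R. R \<subseteq> {..<n} \<and> card R \<le> k}" by (rule card_mono[OF _ img]) simp
  finally have "card (set Xs) \<le> card {R. R \<subseteq> {..<n} \<and> card R \<le> k}" .
  then show "length Xs \<le> K" using K
    using card_small_subsets[of n k] distinct_card[OF unrelated_distinct[OF equivp_eqv Xs(2)]] by linarith
qed

text \<open>
  Representatives of all classes of subsets of \<open>B\<close> are found by adding the vertices of \<open>B\<close> one by one and
  pruning after each step. The equivalence refers to \<open>B\<close> from the start, so no intermediate
  list is longer than the number of its classes.
\<close>
definition reps_step :: "nat set \<Rightarrow> nat \<Rightarrow> nat set list \<Rightarrow> nat set list" where
  "reps_step B v R = (if v \<in> B then collect (eqv B) (pref g) (\<lambda>_. True) (unions R [{}, {v}]) [] else R)"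

definition reps :: "nat set \<Rightarrow> nat set list" where
  "reps B = foldl (\<lambda>R v. reps_step B v R) [{}] [0..<n]"

lemma reps_prefix:
  assumes "B \<subseteq> {..<n}" "R = foldl (\<lambda>R v. reps_step B v R) [{}] [0..<i]"
  shows "set R \<subseteq> Pow (B \<inter> {..<i}) \<and> (\<forall>X\<subseteq>B \<inter> {..<i}. \<exists>X'\<in>set R. eqv B X' X) \<and>
    (few B K \<longrightarrow> length R \<le> K)"
  using assms(2)
proof (induction i arbitrary: R)
  case 0
  then show ?case using few_length[of B K "[{}]"] by (auto simp: eqv_def)
next
  case (Suc i)
  define Q where "Q = foldl (\<lambda>R v. reps_step B v R) [{}] [0..<i]"
  have R: "R = reps_step B i Q" using Suc.prems by (simp add: Q_def)
  note IH = Suc.IH[OF Q_def]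
  show ?case
  proof (cases "i \<in> B")
    case False
    then have "B \<inter> {..<Suc i} = B \<inter> {..<i}" by (auto simp: less_Suc_eq)
    then show ?thesis using IH R False by (simp add: reps_step_def)
  next
    case True
    let ?U = "unions Q [{}, {i}]"
    have R': "R = collect (eqv B) (pref g) (\<lambda>_. True) ?U []" using R True by (simp add: reps_step_def)
    have Qs: "set Q \<subseteq> Pow (B \<inter> {..<i})" using IH by blast
    have U: "set ?U \<subseteq> Pow (B \<inter> {..<Suc i})"
    proof
      fix W assume "W \<in> set ?U"
      then obtain X where "X \<in> set Q" "W = X \<or> W = insert i X" by (auto simp: set_unions)
      moreover from this have "X \<subseteq> B \<inter> {..<i}" using Qs by blast
      ultimately show "W \<in> Pow (B \<inter> {..<Suc i})" using True by (auto simp: less_Suc_eq)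
    qed
    have "\<exists>X'\<in>set R. eqv B X' X" if X: "X \<subseteq> B \<inter> {..<Suc i}" for X
    proof -
      have "X - {i} \<subseteq> B \<inter> {..<i}" using X by (auto simp: less_Suc_eq)
      then obtain X0 where X0: "X0 \<in> set Q" "eqv B X0 (X - {i})" using IH by blast
      have X0s: "X0 \<subseteq> B \<inter> {..<i}" using Qs X0(1) by blast
      have "\<exists>Z\<in>set ?U. eqv B Z X"
      proof (cases "i \<in> X")
        case True
        have "eqv B (X0 \<union> {i}) (X - {i} \<union> {i})"
          unfolding eqv_def
        proof (intro ballI allI)
          fix v out assume v: "v \<in> {..<n} - B"
          have "finite X" "finite X0" using X X0s finite_subset[of X "{..<Suc i}"] finite_subset[of X0 "{..<i}"] by auto
          then show "min d (card (N out v \<inter> (X0 \<union> {i}))) = min d (card (N out v \<inter> (X - {i} \<union> {i})))"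
            by (intro cap_Un) (use X0(2) v X0s in \<open>auto simp: eqv_def\<close>)
        qed
        moreover have "X - {i} \<union> {i} = X" using True by blast
        ultimately show ?thesis using X0(1) by (intro bexI[of _ "X0 \<union> {i}"]) (auto simp: set_unions)
      next
        case False
        then show ?thesis using X0 by (intro bexI[of _ "X0"]) (auto simp: set_unions)
      qed
      then obtain Z where Z: "Z \<in> set ?U" "eqv B Z X" by blast
      then obtain Z' where "Z' \<in> set R" "eqv B Z' Z"
        using collect_cover[of Z "[]" ?U "\<lambda>_. True" B] unfolding R' by blast
      then show ?thesis using Z(2) equivp_transp[OF equivp_eqv] by blast
    qed
    moreover have "set R \<subseteq> Pow (B \<inter> {..<Suc i})"
      using collect_sub[of B "\<lambda>_. True" ?U "[]"] U unfolding R' by auto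
    moreover have "few B K \<longrightarrow> length R \<le> K"
      using few_collect[of B K ?U] U unfolding R' by auto
    ultimately show ?thesis by blast
  qed
qed

lemma
  assumes "B \<subseteq> {..<n}"
  shows reps_sub: "set (reps B) \<subseteq> Pow B"
    and reps_cover: "X \<subseteq> B \<Longrightarrow> \<exists>X'\<in>set (reps B). eqv B X' X"
    and reps_few: "few B K \<Longrightarrow> length (reps B) \<le> K"
proof -
  have "B \<inter> {..<n} = B" using assms by blast
  then show "set (reps B) \<subseteq> Pow B"  "X \<subseteq> B \<Longrightarrow> \<exists>X'\<in>set (reps B). eqv B X' X"
    "few B K \<Longrightarrow> length (reps B) \<le> K"
    using reps_prefix[OF assms reps_def, of K] by auto
qed

text \<open>
  The best union of a set of \<open>F\<close> and a set of \<open>H\<close> for every class, among those that satisfy \<open>A\<close> when \<open>Z\<close> is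
  the part of the solution outside.
\<close>
definition candidates :: "nat set \<Rightarrow> nat set \<Rightarrow> nat set list \<Rightarrow> nat set list \<Rightarrow> nat set list" where
  "candidates A Z F H = collect (eqv A) (pref g) (\<lambda>S. sat A (S \<union> Z)) (unions F H) []"

definition combine :: "nat set \<Rightarrow> nat set list \<Rightarrow> nat set list \<Rightarrow> nat set list" where
  "combine A F H = concat (map (\<lambda>Z. candidates A Z F H) (reps ({..<n} - A)))"

text \<open>
  The invariant of the dynamic program: for every way \<open>Z\<close> to continue outside \<open>A\<close>, each partial
  solution \<open>S\<close> that works with \<open>Z\<close> can be replaced by a member of \<open>F\<close> that also works with \<open>Z\<close>, is
  indistinguishable from \<open>S\<close> outside, and is at least as good.
\<close>
definition represents :: "nat set list \<Rightarrow> nat set \<Rightarrow> bool" where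
  "represents F A \<longleftrightarrow> set F \<subseteq> Pow A \<and>
     (\<forall>S Z. S \<subseteq> A \<longrightarrow> Z \<subseteq> {..<n} - A \<longrightarrow> sat A (S \<union> Z) \<longrightarrow>
       (\<exists>S'\<in>set F. eqv A S' S \<and> sat A (S' \<union> Z) \<and> pref g S' S))"

text \<open>
  A set with at most one element has only two subsets.
\<close>
lemma represents_single:
  assumes "card A \<le> 1" "A \<subseteq> {..<n}"
  shows "represents [{}, A] A"
proof -
  have fin: "finite A" using assms(2) finite_subset by blast
  have *: "S = {} \<or> S = A" if "S \<subseteq> A" for S
  proof (cases "card S = 0")
    case True
    then show ?thesis using finite_subset[OF that fin] by simp
  next
    case False
    then have "card A \<le> card S" using assms(1) by linarith
    then show ?thesis using card_seteq[OF fin that] by simp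
  qed
  show ?thesis unfolding represents_def
  proof (intro conjI allI impI)
    fix S Z assume "S \<subseteq> A" "sat A (S \<union> Z)"
    then have "S \<in> set [{}, A] \<and> eqv A S S \<and> sat A (S \<union> Z) \<and> pref g S S"
      using *[of S] pref_refl equivp_reflp[OF equivp_eqv] by auto
    then show "\<exists>S'\<in>set [{}, A]. eqv A S' S \<and> sat A (S' \<union> Z) \<and> pref g S' S" by blast
  qed simp
qed

lemma represents_sub: "represents F A \<Longrightarrow> set F \<subseteq> Pow A"
  by (simp add: represents_def)

text \<open>
  Exchange the part in \<open>A\<close> first, regarding the part in \<open>B\<close> as part of the outside, then the part in \<open>B\<close>.
  The first exchange keeps \<open>B\<close> satisfied because it cannot be noticed outside \<open>A\<close>, and the second
  one keeps \<open>A\<close> satisfied for the same reason.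
\<close>
lemma unions_represent:
  assumes F: "represents F A" and H: "represents H B" and AB: "A \<inter> B = {}" "A \<union> B \<subseteq> {..<n}"
    and S: "S \<subseteq> A \<union> B" and Z: "Z \<subseteq> {..<n} - (A \<union> B)" and sat: "sat (A \<union> B) (S \<union> Z)"
  shows "\<exists>S'\<in>set (unions F H). eqv (A \<union> B) S' S \<and> sat (A \<union> B) (S' \<union> Z) \<and> pref g S' S"
proof -
  define X Y where "X = S \<inter> A" and "Y = S \<inter> B"
  have S': "S = X \<union> Y" "X \<subseteq> A" "Y \<subseteq> B" using S by (auto simp: X_def Y_def)
  have fin: "finite T" if "T \<subseteq> {..<n}" for T using that finite_subset by blast
  have satA: "sat A (X \<union> (Y \<union> Z))" and satB: "sat B (X \<union> (Y \<union> Z))"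
    using sat S'(1) by (auto simp: sat_def Un_assoc)
  have YZA: "Y \<union> Z \<subseteq> {..<n} - A" using S'(3) Z AB by auto
  obtain X' where X': "X' \<in> set F" "eqv A X' X" "sat A (X' \<union> (Y \<union> Z))" "pref g X' X"
    using F satA S'(2) YZA unfolding represents_def by metis
  have X'A: "X' \<subseteq> A" using F X'(1) by (auto simp: represents_def)
  have eX: "eqv A X X'" using X'(2) equivp_symp[OF equivp_eqv] by blast
  have A: "A \<subseteq> {..<n}" "B \<subseteq> {..<n}" using AB by auto
  have "finite (Y \<union> Z)" by (rule fin) (use YZA in auto)
  then have YZ: "(Y \<union> Z) \<inter> A = {}" "finite (Y \<union> Z)" "B \<subseteq> {..<n} - A"
    using S' Z AB A by auto
  have satB': "sat B (Y \<union> (X' \<union> Z))"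
    using sat_eqv[OF eX S'(2) X'A YZ(1) A(1) YZ(2,3) satB] by (simp add: Un_ac)
  have "finite (X' \<union> Z)" by (rule fin) (use X'A Z A in auto)
  then have XZ: "X' \<union> Z \<subseteq> {..<n} - B" "finite (X' \<union> Z)" "(X' \<union> Z) \<inter> B = {}" "A \<subseteq> {..<n} - B"
    using X'A Z AB A by auto
  obtain Y' where Y': "Y' \<in> set H" "eqv B Y' Y" "sat B (Y' \<union> (X' \<union> Z))" "pref g Y' Y"
    using H satB' S' XZ unfolding represents_def by metis
  have Y'B: "Y' \<subseteq> B" using H Y'(1) by (auto simp: represents_def)
  have eY: "eqv B Y Y'" using Y'(2) equivp_symp[OF equivp_eqv] by blast
  have "sat A (Y \<union> (X' \<union> Z))" using X'(3) by (simp add: Un_ac)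
  then have satA': "sat A (Y' \<union> (X' \<union> Z))"
    using sat_eqv[OF eY S'(3) Y'B XZ(3) A(2) XZ(2) XZ(4)] by blast
  have fin': "finite X" "finite Y" "finite X'" "finite Y'"
    using subset_trans[OF S'(2) A(1)] subset_trans[OF S'(3) A(2)] subset_trans[OF X'A A(1)]
      subset_trans[OF Y'B A(2)] by (simp_all add: fin)
  have "X' \<union> Y' \<union> Z = Y' \<union> (X' \<union> Z)" by blast
  then have "sat (A \<union> B) (X' \<union> Y' \<union> Z)"
    using satA' Y'(3) unfolding sat_def by auto
  moreover have "eqv (A \<union> B) (X' \<union> Y') S"
    unfolding eqv_def
  proof (intro ballI allI)
    fix v out assume v: "v \<in> {..<n} - (A \<union> B)"
    have "min d (card (N out v \<inter> (X' \<union> Y'))) = min d (card (N out v \<inter> (X \<union> Y')))"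
      by (rule eqv_Un[OF X'(2) X'A S'(2) _ A(1)]) (use Y'B AB(1) v fin' in auto)
    also have "\<dots> = min d (card (N out v \<inter> (X \<union> Y)))"
      unfolding Un_commute[of X]
      by (rule eqv_Un[OF Y'(2) Y'B S'(3) _ A(2)]) (use S'(2) AB(1) v fin' in auto)
    finally show "min d (card (N out v \<inter> (X' \<union> Y'))) = min d (card (N out v \<inter> S))"
      using S'(1) by simp
  qed
  moreover have "pref g (X' \<union> Y') S"
    unfolding S'(1) by (rule pref_disjoint_Un) (use X'(4) Y'(4) fin' X'A Y'B S' AB(1) in auto)
  moreover have "X' \<union> Y' \<in> set (unions F H)" using X'(1) Y'(1) by (auto simp: set_unions)
  ultimately show ?thesis by blast
qed

text \<open>
  It suffices to prune for one representative \<open>Z'\<close> of every class of continuations: the vertices of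
  \<open>A \<union> B\<close> do not distinguish \<open>Z\<close> from \<open>Z'\<close>, so a set works with one of them exactly if it works
  with the other.
\<close>
lemma represents_combine:
  assumes F: "represents F A" and H: "represents H B" and AB: "A \<inter> B = {}" "A \<union> B \<subseteq> {..<n}"
  shows "represents (combine (A \<union> B) F H) (A \<union> B)"
  unfolding represents_def
proof (intro conjI allI impI)
  let ?U = "A \<union> B"
  have "set (unions F H) \<subseteq> Pow ?U" using F H by (fastforce simp: represents_def set_unions)
  then show "set (combine ?U F H) \<subseteq> Pow ?U"
    unfolding combine_def candidates_def using collect_sub[of ?U _ "unions F H" "[]"] by fastforce
  fix S Z assume S: "S \<subseteq> ?U" and Z: "Z \<subseteq> {..<n} - ?U" and sat: "sat ?U (S \<union> Z)"
  from unions_represent[OF assms S Z sat] obtain S' where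
    S': "S' \<in> set (unions F H)" "eqv ?U S' S" "sat ?U (S' \<union> Z)" "pref g S' S" by blast
  let ?V = "{..<n} - ?U"
  obtain Z' where Z': "Z' \<in> set (reps ?V)" "eqv ?V Z' Z" using reps_cover[OF Diff_subset Z] by blast
  have Z'V: "Z' \<subseteq> ?V" using reps_sub[OF Diff_subset] Z'(1) by blast
  have eZ: "eqv ?V Z Z'" using Z'(2) equivp_symp[OF equivp_eqv] by blast
  have V: "?V \<subseteq> {..<n}" "?U \<subseteq> {..<n} - ?V" using AB by auto
  have ex: "sat ?U (T \<union> Y')" if "sat ?U (T \<union> Y)" "eqv ?V Y Y'" "T \<subseteq> ?U" "Y \<subseteq> ?V" "Y' \<subseteq> ?V" for T Y Y'
  proof -
    have "T \<inter> ?V = {}" "finite T" using that(3) AB finite_subset[of T "{..<n}"] by auto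
    then show ?thesis using sat_eqv[OF that(2,4,5) _ V(1) _ V(2)] that(1) by (simp add: Un_commute)
  qed
  have S'U: "S' \<subseteq> ?U" using S'(1) \<open>set (unions F H) \<subseteq> Pow ?U\<close> by blast
  have "sat ?U (S' \<union> Z')" using ex S'(3) eZ S'U Z Z'V by blast
  then obtain S'' where S'': "S'' \<in> set (candidates ?U Z' F H)" "eqv ?U S'' S'" "pref g S'' S'"
    using collect_cover[of S' "[]" "unions F H" "\<lambda>S. sat ?U (S \<union> Z')" ?U] S'(1) unfolding candidates_def by blast
  then have "S'' \<in> set (unions F H)" "sat ?U (S'' \<union> Z')"
    using collect_sub[of ?U "\<lambda>S. sat ?U (S \<union> Z')" "unions F H" "[]"] by (auto simp: candidates_def)
  then have "S'' \<subseteq> ?U" "sat ?U (S'' \<union> Z)"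
    using ex[OF _ Z'(2)] Z Z'V \<open>set (unions F H) \<subseteq> Pow ?U\<close> by blast+
  moreover have "S'' \<in> set (combine ?U F H)" using S''(1) Z'(1) by (auto simp: combine_def)
  moreover have "eqv ?U S'' S" using S''(2) S'(2) equivp_transp[OF equivp_eqv] by blast
  moreover have "pref g S'' S" using S''(3) S'(4) pref_trans by blast
  ultimately show "\<exists>S'\<in>set (combine ?U F H). eqv ?U S' S \<and> sat ?U (S' \<union> Z) \<and> pref g S' S" by blast
qed

lemma length_combine:
  assumes "few A K" "few ({..<n} - A) K" "set (unions F H) \<subseteq> Pow A"
  shows "length (combine A F H) \<le> K * K"
proof -
  have "length (combine A F H) = (\<Sum>Z\<leftarrow>reps ({..<n} - A). length (candidates A Z F H))"
    by (simp add: combine_def length_concat comp_def)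
  also have "\<dots> \<le> (\<Sum>Z\<leftarrow>reps ({..<n} - A). K)"
    by (rule sum_list_mono) (use few_collect[OF assms(1,3)] in \<open>simp add: candidates_def\<close>)
  also have "\<dots> \<le> K * K" using reps_few[OF Diff_subset assms(2)] by (simp add: sum_list_triv)
  finally show ?thesis .
qed

text \<open>With nothing outside, all sets are equivalent, so the pruned list holds at most one best set.\<close>
lemma final_candidates:
  assumes "represents F {..<n}"
  defines "R \<equiv> candidates {..<n} {} F [{}]"
  shows "R = [] \<Longrightarrow> S \<subseteq> {..<n} \<Longrightarrow> \<not> sat {..<n} S"
    and "R = X # Xs \<Longrightarrow> X \<subseteq> {..<n} \<and> sat {..<n} X \<and> (S \<subseteq> {..<n} \<longrightarrow> sat {..<n} S \<longrightarrow> pref g X S)"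
proof -
  have un: "unions F [{}] = F" by (simp add: unions_def)
  have eqv: "eqv {..<n} X Y" for X Y by (simp add: eqv_def)
  have R: "R = collect (eqv {..<n}) (pref g) (sat {..<n}) F []"
    by (simp add: R_def candidates_def un)
  have cov: "\<exists>X\<in>set R. pref g X S" if S: "S \<subseteq> {..<n}" "sat {..<n} S" for S
  proof -
    obtain S' where "S' \<in> set F" "sat {..<n} S'" "pref g S' S"
      using assms(1) S unfolding represents_def by (metis Un_empty_right empty_subsetI)
    then show ?thesis using collect_cover[of S' "[]" F "sat {..<n}" "{..<n}"] pref_trans unfolding R by blast
  qed
  then show "R = [] \<Longrightarrow> S \<subseteq> {..<n} \<Longrightarrow> \<not> sat {..<n} S" by fastforce
  assume RX: "R = X # Xs"
  have "unrelated (eqv {..<n}) R" unfolding R by (rule collect_unrel) simp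
  then have "Xs = []" using RX eqv by (cases Xs) auto
  moreover have "set R \<subseteq> set F \<inter> {S. sat {..<n} S}"
    using collect_sub[of "{..<n}" "sat {..<n}" F "[]"] unfolding R by auto
  ultimately show "X \<subseteq> {..<n} \<and> sat {..<n} X \<and> (S \<subseteq> {..<n} \<longrightarrow> sat {..<n} S \<longrightarrow> pref g X S)"
    using RX cov[of S] assms(1) by (auto simp: represents_def)
qed

end

section \<open>Evaluation within a time bound\<close>

text \<open>
  The exact number of steps is never of interest. With an upper bound in its place the
  evaluation rules compose, and the bound of a compound expression is the sum of the bounds of
  its parts.
\<close>
definition ev :: "expr list \<Rightarrow> sexp list \<Rightarrow> expr \<Rightarrow> sexp \<Rightarrow> nat \<Rightarrow> bool" where
  "ev D \<rho> e x T \<longleftrightarrow> (\<exists>t\<le>T. eval D \<rho> e x t)"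

definition evs :: "expr list \<Rightarrow> sexp list \<Rightarrow> expr list \<Rightarrow> sexp list \<Rightarrow> nat \<Rightarrow> bool" where
  "evs D \<rho> es xs T \<longleftrightarrow> (\<exists>t\<le>T. evals D \<rho> es xs t)"

text \<open>
  A conditional whose test has been evaluated to \<open>x\<close>. Keeping it as a separate judgement lets the
  value of the test select the branch before the branch is entered.
\<close>
definition branch :: "expr list \<Rightarrow> sexp list \<Rightarrow> sexp \<Rightarrow> expr \<Rightarrow> expr \<Rightarrow> sexp \<Rightarrow> nat \<Rightarrow> bool" where
  "branch D \<rho> x a b y T \<longleftrightarrow> ev D \<rho> (if x = Atom then b else a) y T"

definition call :: "expr list \<Rightarrow> nat \<Rightarrow> sexp list \<Rightarrow> sexp \<Rightarrow> nat \<Rightarrow> bool" where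
  "call D k xs y T \<longleftrightarrow> k < length D \<and> ev D xs (D ! k) y T"

lemma evI: "eval D \<rho> e x t \<Longrightarrow> t \<le> T \<Longrightarrow> ev D \<rho> e x T"
  and evsI: "evals D \<rho> es xs t \<Longrightarrow> t \<le> T \<Longrightarrow> evs D \<rho> es xs T"
  by (auto simp: ev_def evs_def)

lemma evE: "ev D \<rho> e x T \<Longrightarrow> (\<And>t. eval D \<rho> e x t \<Longrightarrow> t \<le> T \<Longrightarrow> P) \<Longrightarrow> P"
  and evsE: "evs D \<rho> es xs T \<Longrightarrow> (\<And>t. evals D \<rho> es xs t \<Longrightarrow> t \<le> T \<Longrightarrow> P) \<Longrightarrow> P"
  by (auto simp: ev_def evs_def)

lemma ev_mono: "ev D \<rho> e x T \<Longrightarrow> T \<le> T' \<Longrightarrow> ev D \<rho> e x T'"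
  unfolding ev_def using le_trans by blast

lemma ev_Var: "i < length \<rho> \<Longrightarrow> \<rho> ! i = x \<Longrightarrow> ev D \<rho> (EVar i) x 1"
  by (rule evI[OF _ order_refl]) (auto intro: eval_Var[simplified])

lemma ev_Atom: "ev D \<rho> EAtom Atom 1"
  by (rule evI[OF eval_Atom order_refl])

lemma ev_Dot: "ev D \<rho> a x s \<Longrightarrow> ev D \<rho> b y t \<Longrightarrow> ev D \<rho> (EDot a b) (Dot x y) (s + t + 1)"
  by (elim evE, rule evI, erule (1) eval_Dot, simp)

lemma ev_Car: "ev D \<rho> a x t \<Longrightarrow> car x = y \<Longrightarrow> ev D \<rho> (ECar a) y (t + 1)"
  by (elim evE, hypsubst, rule evI, erule eval_Car, simp)

lemma ev_Cdr: "ev D \<rho> a x t \<Longrightarrow> cdr x = y \<Longrightarrow> ev D \<rho> (ECdr a) y (t + 1)"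
  by (elim evE, hypsubst, rule evI, erule eval_Cdr, simp)

lemma ev_If:
  assumes "ev D \<rho> c x s" "branch D \<rho> x a b y t"
  shows "ev D \<rho> (EIf c a b) y (s + t + 1)"
proof -
  obtain s' where s': "eval D \<rho> c x s'" "s' \<le> s" using assms(1) by (rule evE)
  obtain t' where t': "eval D \<rho> (if x = Atom then b else a) y t'" "t' \<le> t"
    using assms(2) unfolding branch_def by (rule evE)
  have "eval D \<rho> (EIf c a b) y (s' + t' + 1)"
  proof (cases "x = Atom")
    case True
    then show ?thesis using s' t' by (intro eval_If_false) simp_all
  next
    case False
    then show ?thesis using s' t' by (intro eval_If_true[OF s'(1)]) simp_all
  qed
  then show ?thesis by (rule evI) (use s' t' in simp)
qed

lemma ev_Call: "evs D \<rho> as xs s \<Longrightarrow> call D k xs y t \<Longrightarrow> ev D \<rho> (ECall k as) y (s + t + 1)"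
  unfolding call_def by (elim conjE evE evsE, rule evI, erule (2) eval_Call, simp)

lemma evs_Nil: "evs D \<rho> [] [] 0"
  by (rule evsI[OF evals_Nil order_refl])

lemma evs_Cons: "ev D \<rho> a x s \<Longrightarrow> evs D \<rho> as xs t \<Longrightarrow> evs D \<rho> (a # as) (x # xs) (s + t)"
  by (elim evE evsE, rule evsI, erule (1) evals_Cons, simp)

lemmas ev_rules = ev_Var ev_Atom ev_Dot ev_Car ev_Cdr ev_If ev_Call evs_Nil evs_Cons

lemma branch_true: "x \<noteq> Atom \<Longrightarrow> ev D \<rho> a y t \<Longrightarrow> branch D \<rho> x a b y t"
  and branch_false: "x = Atom \<Longrightarrow> ev D \<rho> b y t \<Longrightarrow> branch D \<rho> x a b y t"
  by (simp_all add: branch_def)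

text \<open>
  Correctness of a function is proved by symbolic execution of its body: the rules \<open>ev_rules\<close>, together
  with the specifications of the called functions, compute a value \<open>y'\<close> and a bound \<open>T'\<close>, which are
  compared with the claimed ones at the end. Facts about the instance are first turned into premises
  of the goal, by \<open>-\<close>, where the simplifier finds them.
\<close>
lemma callI: "D ! k = e \<Longrightarrow> k < length D \<Longrightarrow> ev D xs e y' T' \<Longrightarrow> y' = y \<Longrightarrow> T' \<le> T \<Longrightarrow> call D k xs y T"
  unfolding call_def ev_def using le_trans by blast

lemma call_mono: "call D k xs y T \<Longrightarrow> T \<le> T' \<Longrightarrow> call D k xs y T'"
  unfolding call_def ev_def using le_trans by blast

fun len :: "sexp \<Rightarrow> nat" where
  "len Atom = 0" | "len (Dot x y) = Suc (len y)"

text \<open>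
  The tail of a list indexed by \<open>{..<n}\<close>, from position \<open>i\<close> on. A function that walks down an encoded list
  sees exactly such tails, so its specification is stated for all \<open>i\<close> and proved by \<open>seg_induct\<close>.
  Matrices are segments of segments.
\<close>
definition gseg :: "nat \<Rightarrow> nat \<Rightarrow> (nat \<Rightarrow> sexp) \<Rightarrow> sexp" where
  "gseg i n f = enc_list (map f [i..<n])"

lemma gseg_simps [simp]:
  "i < n \<Longrightarrow> car (gseg i n f) = f i"
  "i < n \<Longrightarrow> cdr (gseg i n f) = gseg (Suc i) n f"
  "gseg i n f = Atom \<longleftrightarrow> n \<le> i"
  "Atom = gseg i n f \<longleftrightarrow> n \<le> i"
  "len (gseg i n f) = n - i"
proof -
  have *: "len (enc_list xs) = length xs" for xs by (induction xs) (auto simp: enc_list_def)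
  show "len (gseg i n f) = n - i" by (simp add: gseg_def *)
qed (cases "i < n"; force simp: gseg_def enc_list_def upt_conv_Cons)+

lemma gseg_Cons: "i < n \<Longrightarrow> gseg i n f = Dot (f i) (gseg (Suc i) n f)"
  by (simp add: gseg_def enc_list_def upt_conv_Cons)

lemma gseg_Nil: "n \<le> i \<Longrightarrow> gseg i n f = Atom"
  by simp

lemma seg_induct [case_names stop step]:
  assumes stop: "\<And>i. n \<le> i \<Longrightarrow> P i" and step: "\<And>i. i < n \<Longrightarrow> P (Suc i) \<Longrightarrow> P i"
  shows "P (i :: nat)"
proof (induction "n - i" arbitrary: i)
  case 0
  then show ?case using stop by simp
next
  case (Suc k)
  then have "k = n - Suc i" "i < n" by linarith+
  then show ?case using step Suc.hyps(1) by blast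
qed

abbreviation vseg :: "nat \<Rightarrow> nat \<Rightarrow> nat set \<Rightarrow> sexp" where
  "vseg i n S \<equiv> gseg i n (\<lambda>v. enc_bool (v \<in> S))"

lemma enc_simps [simp]:
  "enc_list [] = Atom" "enc_list (x # xs) = Dot x (enc_list xs)"
  "enc_nat 0 = Atom" "enc_nat (Suc k) = Dot Atom (enc_nat k)"
  "enc_bool b = Atom \<longleftrightarrow> \<not> b" "enc_bool True = Dot Atom Atom" "enc_bool False = Atom"
  "len (enc_nat k) = k" "len (enc_list xs) = length xs"
proof -
  show *: "len (enc_list xs) = length xs" for xs by (induction xs) (auto simp: enc_list_def)
  show "len (enc_nat k) = k" unfolding enc_nat_def * by simp
qed (auto simp: enc_list_def enc_nat_def enc_bool_def)

section \<open>The program\<close>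

text \<open>
  The program is a list of function bodies that call each other by position; the following
  are the positions.
\<close>
abbreviation (input) "LEQ \<equiv> 0 :: nat"
abbreviation (input) "SAME \<equiv> 1 :: nat"
abbreviation (input) "UNION \<equiv> 2 :: nat"
abbreviation (input) "COUNT \<equiv> 3 :: nat"
abbreviation (input) "NEG \<equiv> 4 :: nat"
abbreviation (input) "VERTS \<equiv> 5 :: nat"
abbreviation (input) "IDENT \<equiv> 6 :: nat"
abbreviation (input) "UNITE \<equiv> 7 :: nat"
abbreviation (input) "STEP \<equiv> 8 :: nat"
abbreviation (input) "BALLS \<equiv> 9 :: nat"
abbreviation (input) "CONSROW \<equiv> 10 :: nat"
abbreviation (input) "TRANSPOSE \<equiv> 11 :: nat"
abbreviation (input) "EQUIV \<equiv> 12 :: nat"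
abbreviation (input) "SAT \<equiv> 13 :: nat"
abbreviation (input) "INSERT \<equiv> 14 :: nat"
abbreviation (input) "OFFER \<equiv> 15 :: nat"
abbreviation (input) "MERGEY \<equiv> 16 :: nat"
abbreviation (input) "MERGE \<equiv> 17 :: nat"
abbreviation (input) "REPS \<equiv> 18 :: nat"
abbreviation (input) "APPEND \<equiv> 19 :: nat"
abbreviation (input) "ZLOOP \<equiv> 20 :: nat"
abbreviation (input) "COMB \<equiv> 21 :: nat"
abbreviation (input) "JOIN \<equiv> 22 :: nat"
abbreviation (input) "START \<equiv> 23 :: nat"
abbreviation (input) "NTH \<equiv> 24 :: nat"
abbreviation (input) "LOOP \<equiv> 25 :: nat"
abbreviation (input) "SOLVE1 \<equiv> 26 :: nat"
abbreviation (input) "SOLVE2 \<equiv> 27 :: nat"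
abbreviation (input) "SOLVE3 \<equiv> 28 :: nat"
abbreviation (input) "SOLVE4 \<equiv> 29 :: nat"
abbreviation (input) "SOLVE5 \<equiv> 30 :: nat"

abbreviation "v0 \<equiv> EVar 0"
abbreviation "v1 \<equiv> EVar 1"
abbreviation "v2 \<equiv> EVar 2"
abbreviation "v3 \<equiv> EVar 3"
abbreviation "v4 \<equiv> EVar 4"
abbreviation "v5 \<equiv> EVar 5"
abbreviation "v6 \<equiv> EVar 6"
abbreviation "v7 \<equiv> EVar 7"
abbreviation "ETrue \<equiv> EDot EAtom EAtom"
abbreviation "EAnd a b \<equiv> EIf a b EAtom"
abbreviation "ECadr e \<equiv> ECar (ECdr e)"
abbreviation "ECddr e \<equiv> ECdr (ECdr e)"

primrec const :: "sexp \<Rightarrow> expr" where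
  "const Atom = EAtom" | "const (Dot x y) = EDot (const x) (const y)"

primrec esize :: "sexp \<Rightarrow> nat" where
  "esize Atom = 1" | "esize (Dot x y) = esize x + esize y + 1"

lemma ev_const: "ev D \<rho> (const x) x (esize x)"
  by (induction x) (auto intro: ev_rules[simplified])

text \<open>
  The membership table of one pair of requirements, for counts from 0 to \<open>d\<close>. A suffix of the table serves
  as a counter: counting drops entries and stops at the last one, which caps the count at \<open>d\<close>, and the
  head of the suffix is the answer for the capped count.
\<close>
definition table :: "nat \<Rightarrow> (bool \<Rightarrow> nat \<Rightarrow> bool) \<Rightarrow> sexp" where
  "table d c = enc_list (map (\<lambda>k. Dot (enc_bool (c True k)) (enc_bool (c False k))) [0..<Suc d])"

text \<open>
  Most functions receive a context, which consists of the matrix of out-balls, its transpose (the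
  in-balls), the empty set and the list of all singletons.
\<close>
abbreviation "ctx_M e \<equiv> ECar e"
abbreviation "ctx_Mt e \<equiv> ECadr e"
abbreviation "ctx_zero e \<equiv> ECar (ECddr e)"
abbreviation "ESize e \<equiv> ECall COUNT [EDot EAtom (ctx_M v0), e, e]"
abbreviation "ctx_units e \<equiv> ECdr (ECddr e)"

definition leq_body :: "expr" where
  "leq_body = EIf v0 (EAnd v1 (ECall LEQ [ECdr v0, ECdr v1])) ETrue"

definition same_body :: "expr" where
  "same_body = EAnd (ECall LEQ [v0, v1]) (ECall LEQ [v1, v0])"

definition union_body :: "expr" where
  "union_body = EIf v0 (EDot (EIf (ECar v0) ETrue (ECar v1)) (ECall UNION [ECdr v0, ECdr v1])) EAtom"

definition count_body :: "expr" where
  "count_body = EIf v1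
     (ECall COUNT [EIf (EAnd (EAnd (ECar v1) (ECar v2)) (ECdr v0)) (ECdr v0) v0, ECdr v1, ECdr v2])
     v0"

definition neg_body :: "expr" where
  "neg_body = EIf v0 (EDot (EIf (ECar v0) EAtom ETrue) (ECall NEG [ECdr v0])) EAtom"

definition verts_body :: "expr" where
  "verts_body = EIf v0 (EDot (ECall SAME [ECar v0, v1]) (ECall VERTS [ECdr v0, v1])) EAtom"

text \<open>
  Vertex \<open>v\<close> is recognised by its leaf, which no other vertex has, so the list of leaves yields all
  singletons without arithmetic on indices.
\<close>
definition ident_body :: "expr" where
  "ident_body = EIf v1 (EDot (ECall VERTS [v0, ECar v1]) (ECall IDENT [v0, ECdr v1])) EAtom"

definition unite_body :: "expr" where
  "unite_body = EIf v0
     (ECall UNITE [ECdr v0, ECdr v1, EIf (ECar v0) (ECall UNION [v2, ECar v1]) v2])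
     v2"

definition step_body :: "expr" where
  "step_body = EIf v0
     (EDot (ECall UNITE [ECar v0, v2, ECar v1]) (ECall STEP [ECdr v0, ECdr v1, v2]))
     EAtom"

definition balls_body :: "expr" where
  "balls_body = EIf v0 (ECall BALLS [ECdr v0, v1, ECall STEP [v1, v2, v2]]) v2"

definition consrow_body :: "expr" where
  "consrow_body = EIf v0 (EDot (EDot (ECar v0) (ECar v1)) (ECall CONSROW [ECdr v0, ECdr v1])) EAtom"

text \<open>
  Adding a row in front of an already transposed matrix. The transpose of no rows is the
  atom, which \<open>CONSROW\<close> can read as a list of empty rows of any length, since the atom is its own head
  and tail.
\<close>
definition transpose_body :: "expr" where
  "transpose_body = EIf v0 (ECall CONSROW [ECar v0, ECall TRANSPOSE [ECdr v0]]) EAtom"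

text \<open>
  Whether the capped counts of two sets agree in all rows of \<open>v0\<close> that belong to vertices
  outside \<open>v1\<close>. Only the length of the counter matters here, so any list of length \<open>d + 1\<close> will do as table.
\<close>
definition equiv_body :: "nat \<Rightarrow> expr" where
  "equiv_body d = EIf v0
     (EIf (EIf (ECar v1) ETrue
             (ECall SAME [ECall COUNT [const (enc_nat (Suc d)), ECar v0, v2],
                          ECall COUNT [const (enc_nat (Suc d)), ECar v0, v3]]))
        (ECall EQUIV [ECdr v0, ECdr v1, v2, v3])
        EAtom)
     ETrue"

definition sat_body :: "expr" where
  "sat_body = EIf v1
     (EIf (EIf (ECar v2)
             (EIf (ECar v3) (ECar (ECar (ECall COUNT [v0, ECar v1, v4])))
                            (ECdr (ECar (ECall COUNT [v0, ECar v1, v4]))))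
             ETrue)
        (ECall SAT [v0, ECdr v1, ECdr v2, ECdr v3, v4])
        EAtom)
     ETrue"

text \<open>
  \<open>ESize\<close> counts with a table of length \<open>n + 1\<close>, which is never exhausted. The counter that
  is left over is the longer the smaller the set is, which reverses the comparison of sizes.
\<close>
definition insert_body :: "goal \<Rightarrow> expr" where
  "insert_body g = EIf v3
       (EIf (EAnd (ECall EQUIV [ctx_M v0, v1, v2, ECar v3]) (ECall EQUIV [ctx_Mt v0, v1, v2, ECar v3]))
          (EDot (EIf (case g of Minimum \<Rightarrow> ECall LEQ [ESize (ECar v3), ESize v2]
                              | Maximum \<Rightarrow> ECall LEQ [ESize v2, ESize (ECar v3)])
                   v2 (ECar v3))
                (ECdr v3))
          (EDot (ECar v3) (ECall INSERT [v0, v1, v2, ECdr v3])))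
       (EDot v2 EAtom)"

definition offer_body :: "nat \<Rightarrow> (bool \<Rightarrow> bool \<Rightarrow> nat \<Rightarrow> bool) \<Rightarrow> expr" where
  "offer_body d C = EIf (EAnd (ECall SAT [const (table d (C True)), ctx_M v0, v2, v3, v3])
               (ECall SAT [const (table d (C False)), ctx_Mt v0, v2, v3, v3]))
     (ECall INSERT [v0, v1, v4, v5])
     v5"

definition mergey_body :: "expr" where
  "mergey_body = EIf v5
     (ECall MERGEY [v0, v1, v2, v3, v4, ECdr v5,
        ECall OFFER [v0, v1, v2, ECall UNION [ECall UNION [v4, ECar v5], v3],
                     ECall UNION [v4, ECar v5], v6]])
     v6"

definition merge_body :: "expr" where
  "merge_body = EIf v4
     (ECall MERGE [v0, v1, v2, v3, ECdr v4, v5, ECall MERGEY [v0, v1, v2, v3, ECar v4, v5, v6]])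
     v6"

text \<open>
  With an empty set of vertices to be satisfied, \<open>MERGE\<close> discards nothing and only prunes by
  equivalence.
\<close>
definition reps_body :: "expr" where
  "reps_body = EIf v2
     (ECall REPS [v0, v1, ECdr v2, ECdr v3,
        EIf (ECar v2)
          (ECall MERGE [v0, v1, ctx_zero v0, ctx_zero v0, v4,
                        EDot (ctx_zero v0) (EDot (ECar v3) EAtom), EAtom])
          v4])
     v4"

definition append_body :: "expr" where
  "append_body = EIf v0 (EDot (ECar v0) (ECall APPEND [ECdr v0, v1])) v1"

definition zloop_body :: "expr" where
  "zloop_body = EIf v1
     (ECall APPEND [ECall MERGE [v0, v2, v2, ECar v1, v3, v4, EAtom],
                    ECall ZLOOP [v0, ECdr v1, v2, v3, v4]])
     EAtom"

definition comb_body :: "expr" where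
  "comb_body = EDot v1
     (ECall ZLOOP [v0,
        ECall REPS [v0, ECall NEG [v1], ECall NEG [v1], ctx_units v0, EDot (ctx_zero v0) EAtom],
        v1, v2, v3])"

definition join_body :: "expr" where
  "join_body = ECall COMB [v0, ECall UNION [ECar v1, ECar v2], ECdr v1, ECdr v2]"

definition start_body :: "expr" where
  "start_body = EDot (ECall VERTS [v1, v2])
     (EDot (ctx_zero v0) (EDot (ECall VERTS [v1, v2]) EAtom))"

definition nth_body :: "expr" where
  "nth_body = EIf v1 (ECall NTH [ECdr v0, ECdr v1]) (ECar v0)"

text \<open>
  Arguments: context, tree, leaves of the vertices, rest of the row of the current node, index of its first
  entry, current node, its parent, and the result for the part of the subtree seen so far. A
  result is a vertex set together with a list that represents it. The recursive call for a child
  starts a new row. At the root the parent is the node itself, which is not its own neighbour.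
\<close>
definition loop_body :: "expr" where
  "loop_body = EIf v3
     (ECall LOOP [v0, v1, v2, ECdr v3, EDot EAtom v4, v5, v6,
        EIf (EAnd (ECar v3) (EIf (ECall SAME [v4, v6]) EAtom ETrue))
          (ECall JOIN [v0, v7,
             ECall LOOP [v0, v1, v2, ECall NTH [v1, v4], EAtom, v4, v5,
                         ECall START [v0, v2, v4]]])
          v7])
     v7"

text \<open>
  The chain of calls binds intermediate results to argument positions.
\<close>
definition solve1_body :: "nat \<Rightarrow> expr" where
  "solve1_body r = ECall SOLVE2 [v0, v1, ECall BALLS [const (enc_nat r), ECar v0, v1]]"

definition solve2_body :: "expr" where
  "solve2_body = ECall SOLVE3 [v0,
     EDot v2 (EDot (ECall TRANSPOSE [v2])
       (EDot (ECall NEG [ECall UNION [ECar v2, ECall NEG [ECar v2]]]) v1))]"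

definition solve3_body :: "expr" where
  "solve3_body = ECall SOLVE4 [v1,
     ECall LOOP [v1, ECadr v0, ECar (ECddr v0), ECar (ECadr v0), EAtom, EAtom, EAtom,
                 ECall START [v1, ECar (ECddr v0), EAtom]]]"

definition solve4_body :: "expr" where
  "solve4_body = ECall SOLVE5 [ECall MERGE [v0, ECar v1, ECar v1, ctx_zero v0, ECdr v1,
                  EDot (ctx_zero v0) EAtom, EAtom]]"

definition solve5_body :: "expr" where
  "solve5_body = EIf v0 (EDot EAtom (ECar v0)) EAtom"

definition bodies :: "nat \<Rightarrow> nat \<Rightarrow> (bool \<Rightarrow> bool \<Rightarrow> nat \<Rightarrow> bool) \<Rightarrow> goal \<Rightarrow> expr list" where
  "bodies r d C g = [
     leq_body, same_body, union_body, count_body, neg_body, verts_body, ident_body,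
     unite_body, step_body, balls_body, consrow_body, transpose_body, equiv_body d, sat_body,
     insert_body g, offer_body d C, mergey_body, merge_body, reps_body, append_body,
     zloop_body, comb_body, join_body, start_body, nth_body, loop_body, solve1_body r,
     solve2_body, solve3_body, solve4_body, solve5_body]"

definition main :: expr where
  "main = ECall SOLVE1 [v0, ECall IDENT [ECar (ECddr v0), ECar (ECddr v0)]]"

lemma bodies_nth:
  "bodies r d C g ! LEQ = leq_body"
  "bodies r d C g ! SAME = same_body"
  "bodies r d C g ! UNION = union_body"
  "bodies r d C g ! COUNT = count_body"
  "bodies r d C g ! NEG = neg_body"
  "bodies r d C g ! VERTS = verts_body"
  "bodies r d C g ! IDENT = ident_body"
  "bodies r d C g ! UNITE = unite_body"
  "bodies r d C g ! STEP = step_body"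
  "bodies r d C g ! BALLS = balls_body"
  "bodies r d C g ! CONSROW = consrow_body"
  "bodies r d C g ! TRANSPOSE = transpose_body"
  "bodies r d C g ! EQUIV = equiv_body d"
  "bodies r d C g ! SAT = sat_body"
  "bodies r d C g ! INSERT = insert_body g"
  "bodies r d C g ! OFFER = offer_body d C"
  "bodies r d C g ! MERGEY = mergey_body"
  "bodies r d C g ! MERGE = merge_body"
  "bodies r d C g ! REPS = reps_body"
  "bodies r d C g ! APPEND = append_body"
  "bodies r d C g ! ZLOOP = zloop_body"
  "bodies r d C g ! COMB = comb_body"
  "bodies r d C g ! JOIN = join_body"
  "bodies r d C g ! START = start_body"
  "bodies r d C g ! NTH = nth_body"
  "bodies r d C g ! LOOP = loop_body"
  "bodies r d C g ! SOLVE1 = solve1_body r"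
  "bodies r d C g ! SOLVE2 = solve2_body"
  "bodies r d C g ! SOLVE3 = solve3_body"
  "bodies r d C g ! SOLVE4 = solve4_body"
  "bodies r d C g ! SOLVE5 = solve5_body"
  by (simp_all add: bodies_def)

lemma length_bodies [simp]: "length (bodies r d C g) = 31"
  by (simp add: bodies_def)

section \<open>Correctness and running time of the graph routines\<close>

context
  fixes r d :: nat and C :: "bool \<Rightarrow> bool \<Rightarrow> nat \<Rightarrow> bool" and g :: goal
begin

abbreviation "D \<equiv> bodies r d C g"

lemma leq: "call D LEQ [p, q] (enc_bool (len p \<le> len q)) (20 * (len p + 1))"
proof (induction p arbitrary: q)
  case Atom
  show ?case by (rule callI, rule bodies_nth, simp, unfold leq_body_def,
      (rule ev_rules | rule branch_true, (simp; fail)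
       | rule branch_false, (simp; fail) | (simp; fail))+)
next
  case (Dot a p)
  show ?case by (cases q; hypsubst, (rule callI, rule bodies_nth, simp, unfold leq_body_def,
      (rule ev_rules Dot.IH | rule branch_true, (simp; fail)
       | rule branch_false, (simp; fail) | (simp; fail))+))
qed

lemma same: "call D SAME [p, q] (enc_bool (len p = len q)) (20 * (len p + len q + 3))"
  by (cases "len p \<le> len q"; cases "len q \<le> len p";
      (rule callI, rule bodies_nth, simp, unfold same_body_def,
      (rule ev_rules leq | rule branch_true, (simp; fail)
       | rule branch_false, (simp; fail) | (simp; fail))+))

lemma union: "call D UNION [vseg i n A, vseg i n B] (vseg i n (A \<union> B)) (30 * (n - i + 1))"
proof (induction i rule: seg_induct[of n])
  case (stop i)
  then show ?case by - (rule callI, rule bodies_nth, simp, unfold union_body_def,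
      (rule ev_rules | rule branch_true, (simp; fail)
       | rule branch_false, (simp; fail) | (simp; fail))+)
next
  case (step i)
  from step.hyps show ?case
    by - (cases "i \<in> A";
      (rule callI, rule bodies_nth, simp, unfold union_body_def,
      (rule ev_rules step.IH | rule branch_true, (simp; fail)
       | rule branch_false, (simp; fail) | (simp add: gseg_Cons[of i]; fail))+))
qed

lemma neg: "call D NEG [vseg i n A] (vseg i n ({..<n} - A)) (30 * (n - i + 1))"
proof (induction i rule: seg_induct[of n])
  case (stop i)
  then show ?case by - (rule callI, rule bodies_nth, simp, unfold neg_body_def,
      (rule ev_rules | rule branch_true, (simp; fail)
       | rule branch_false, (simp; fail) | (simp; fail))+)
next
  case (step i)
  from step.hyps show ?case
    by - (cases "i \<in> A";
      (rule callI, rule bodies_nth, simp, unfold neg_body_def,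
      (rule ev_rules step.IH | rule branch_true, (simp; fail)
       | rule branch_false, (simp; fail) | (simp add: gseg_Cons[of i]; fail))+))
qed

text \<open>
  One step of a counter.
\<close>
definition adv :: "sexp \<Rightarrow> sexp" where "adv t = (if cdr t = Atom then t else cdr t)"

lemma adv_simps: "cdr t = Atom \<Longrightarrow> adv t = t" "cdr t \<noteq> Atom \<Longrightarrow> adv t = cdr t"
  by (simp_all add: adv_def)

lemma card_seg_step:
  "i < n \<Longrightarrow> card ({i..<n} \<inter> A)
     = (if i \<in> A then Suc (card ({Suc i..<n} \<inter> A)) else card ({Suc i..<n} \<inter> A))"
proof -
  assume "i < n"
  then have "{i..<n} = insert i {Suc i..<n}" by auto
  then show ?thesis by (simp add: Int_insert_left)
qed

lemma count:
  "call D COUNT [tb, vseg i n R, vseg i n S]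
    ((adv ^^ card ({i..<n} \<inter> (R \<inter> S))) tb) (40 * (n - i + 1))"
proof (induction i arbitrary: tb rule: seg_induct[of n])
  case (stop i)
  then show ?case by - (rule callI, rule bodies_nth, simp, unfold count_body_def,
      (rule ev_rules | rule branch_true, (simp; fail)
       | rule branch_false, (simp; fail) | (simp; fail))+)
next
  case (step i)
  from step.hyps show ?case
    by - (cases "i \<in> R"; cases "i \<in> S"; cases "cdr tb = Atom";
     (rule callI, rule bodies_nth, simp, unfold count_body_def,
      (rule ev_rules step.IH | rule branch_true, (simp; fail)
       | rule branch_false, (simp; fail) | (simp add: card_seg_step funpow_swap1 adv_simps; fail))+))
qed

lemma len_adv: "len ((adv ^^ k) t) = len t - min (len t - 1) k"
proof (induction k arbitrary: t)
  case (Suc k)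
  have "len (adv t) = (if len t \<le> 1 then len t else len t - 1)"
    by (cases t; cases "cdr t") (auto simp: adv_def)
  then show ?case using Suc[of "adv t"] by (auto simp: funpow_swap1 min_def)
qed simp

lemma car_adv: "xs \<noteq> [] \<Longrightarrow> car ((adv ^^ k) (enc_list xs)) = xs ! min (length xs - 1) k"
proof (induction k arbitrary: xs)
  case 0
  then show ?case by (cases xs) auto
next
  case (Suc k)
  show ?case
  proof (cases "tl xs = []")
    case True
    then obtain x where "xs = [x]" using Suc.prems by (cases xs) auto
    moreover from this have "adv (enc_list xs) = enc_list xs" by (simp add: adv_def)
    ultimately show ?thesis using Suc.IH[of xs] by (simp add: funpow_swap1)
  next
    case False
    then obtain x y ys where xs: "xs = x # y # ys" by (cases xs; cases "tl xs") auto
    then have "adv (enc_list xs) = enc_list (tl xs)" by (simp add: adv_def)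
    then show ?thesis using Suc.IH[of "tl xs"] xs by (simp add: funpow_swap1 min_def)
  qed
qed

lemma unroll: "c * (n - i) = c + c * (n - Suc i)" if "i < n" for c :: nat
proof -
  have "n - i = Suc (n - Suc i)" using that by linarith
  then show ?thesis by (simp only: mult_Suc_right)
qed

lemma nth_row: "i + j < n \<Longrightarrow> call D NTH [gseg j n f, enc_nat i] (f (i + j)) (20 * (i + 1))"
proof (induction i arbitrary: j)
  case 0
  then show ?case by - (rule callI, rule bodies_nth, simp, unfold nth_body_def,
      (rule ev_rules | rule branch_true, (simp; fail)
       | rule branch_false, (simp; fail) | (simp; fail))+)
next
  case (Suc i)
  then have "i + Suc j < n" by simp
  from Suc.IH[OF this] Suc.prems show ?case by - (rule callI, rule bodies_nth, simp, unfold nth_body_def,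
      (rule ev_rules Suc.IH | rule branch_true, (simp; fail)
       | rule branch_false, (simp; fail) | (simp; fail))+)
qed

lemma append: "call D APPEND [enc_list xs, ys] (foldr Dot xs ys) (20 * (length xs + 1))"
proof (induction xs)
  case Nil show ?case by (rule callI, rule bodies_nth, simp, unfold append_body_def,
      (rule ev_rules | rule branch_true, (simp; fail)
       | rule branch_false, (simp; fail) | (simp; fail))+)
next
  case (Cons x xs) show ?case by (rule callI, rule bodies_nth, simp, unfold append_body_def,
      (rule ev_rules Cons.IH | rule branch_true, (simp; fail)
       | rule branch_false, (simp; fail) | (simp; fail))+)
qed

lemma consrow:
  "call D CONSROW [gseg i n f, gseg i n h] (gseg i n (\<lambda>v. Dot (f v) (h v))) (30 * (n - i + 1))"
proof (induction i rule: seg_induct[of n])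
  case (stop i)
  then show ?case by - (rule callI, rule bodies_nth, simp, unfold consrow_body_def,
      (rule ev_rules | rule branch_true, (simp; fail)
       | rule branch_false, (simp; fail) | (simp; fail))+)
next
  case (step i)
  from step.hyps show ?case by - (rule callI, rule bodies_nth, simp, unfold consrow_body_def,
      (rule ev_rules step.IH | rule branch_true, (simp; fail)
       | rule branch_false, (simp; fail) | (simp add: gseg_Cons[of i]; fail))+)
qed

lemma consrow_Atom:
  "call D CONSROW [gseg i n f, Atom] (gseg i n (\<lambda>v. Dot (f v) Atom)) (30 * (n - i + 1))"
proof (induction i rule: seg_induct[of n])
  case (stop i)
  then show ?case by - (rule callI, rule bodies_nth, simp, unfold consrow_body_def,
      (rule ev_rules | rule branch_true, (simp; fail)
       | rule branch_false, (simp; fail) | (simp; fail))+)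
next
  case (step i)
  from step.hyps show ?case by - (rule callI, rule bodies_nth, simp, unfold consrow_body_def,
      (rule ev_rules step.IH | rule branch_true, (simp; fail)
       | rule branch_false, (simp; fail) | (simp add: gseg_Cons[of i]; fail))+)
qed

lemma transpose:
  "call D TRANSPOSE [gseg i n (\<lambda>v. gseg 0 n (f v))]
     (if i < n then gseg 0 n (\<lambda>u. gseg i n (\<lambda>v. f v u)) else Atom) ((30 * (n + 1) + 30) * (n - i + 1))"
proof (induction i rule: seg_induct[of n])
  case (stop i)
  then show ?case by - (rule callI, rule bodies_nth, simp, unfold transpose_body_def,
      (rule ev_rules | rule branch_true, (simp; fail)
       | rule branch_false, (simp; fail) | (simp; fail))+)
next
  case (step i)
  show ?case
  proof (cases "Suc i < n")
    case True
    from step.hyps True step.IH[simplified if_P[OF True]] show ?thesis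
      by - (rule callI, rule bodies_nth, simp, unfold transpose_body_def,
      (rule ev_rules step.IH[simplified if_P[OF True]] consrow | rule branch_true, (simp; fail)
       | rule branch_false, (simp; fail) | (simp add: gseg_Cons[of i] unroll[of i]; fail))+)
  next
    case False
    have ih: "call D TRANSPOSE [Atom] Atom 9" by (rule callI, rule bodies_nth, simp, unfold transpose_body_def,
      (rule ev_rules | rule branch_true, (simp; fail)
       | rule branch_false, (simp; fail) | (simp; fail))+)
    from step.hyps False show ?thesis
      by - (rule callI, rule bodies_nth, simp, unfold transpose_body_def,
      (rule ev_rules ih consrow_Atom | rule branch_true, (simp; fail)
       | rule branch_false, (simp; fail) | (simp add: gseg_Cons[of i] gseg_Nil[of _ "Suc i"] unroll[of i]; fail))+)
  qed
qed


lemma verts: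
  assumes L: "\<And>v. v < n \<Longrightarrow> L v \<le> B" and x: "len x \<le> B"
  shows "call D VERTS [gseg i n (\<lambda>v. enc_nat (L v)), x] (vseg i n {v. L v = len x})
    ((40 * B + 90) * (n - i + 1))"
proof (induction i rule: seg_induct[of n])
  case (stop i)
  then show ?case by - (rule callI, rule bodies_nth, simp, unfold verts_body_def,
      (rule ev_rules | rule branch_true, (simp; fail)
       | rule branch_false, (simp; fail) | (simp; fail))+)
next
  case (step i)
  from step.hyps L[OF step.hyps] x show ?case
    by - (rule callI, rule bodies_nth, simp, unfold verts_body_def,
      (rule ev_rules step.IH same | rule branch_true, (simp; fail)
       | rule branch_false, (simp; fail) | (simp add: gseg_Cons[of i] unroll[of i]; fail))+)
qed

lemma ident:
  assumes L: "\<And>v. v < n \<Longrightarrow> L v \<le> B" and inj: "inj_on L {..<n}"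
  shows "call D IDENT [gseg 0 n (\<lambda>v. enc_nat (L v)), gseg i n (\<lambda>v. enc_nat (L v))]
    (gseg i n (\<lambda>v. vseg 0 n {v})) (((40 * B + 90) * (n + 1) + 30) * (n - i + 1))"
proof (induction i rule: seg_induct[of n])
  case (stop i)
  then show ?case by - (rule callI, rule bodies_nth, simp, unfold ident_body_def,
      (rule ev_rules | rule branch_true, (simp; fail)
       | rule branch_false, (simp; fail) | (simp; fail))+)
next
  case (step i)
  have "vseg 0 n {v. L v = L i} = vseg 0 n {i}"
    unfolding gseg_def using inj step.hyps
    by (intro arg_cong[where f = enc_list] map_cong refl) (auto simp: inj_on_eq_iff[OF inj])
  then have row: "call D VERTS [gseg 0 n (\<lambda>v. enc_nat (L v)), enc_nat (L i)] (vseg 0 n {i}) ((40 * B + 90) * (n + 1))"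
    using verts[of n L B "enc_nat (L i)" 0] L step.hyps by simp
  from step.hyps show ?case
    by - (rule callI, rule bodies_nth, simp, unfold ident_body_def,
      (rule ev_rules step.IH row | rule branch_true, (simp; fail)
       | rule branch_false, (simp; fail) | (simp add: gseg_Cons[of i] unroll[of i]; fail))+)
qed

lemma unite:
  "call D UNITE [vseg i n A, gseg i n (\<lambda>v. vseg 0 n (R v)), vseg 0 n Q]
    (vseg 0 n (Q \<union> (\<Union>u \<in> A \<inter> {i..<n}. R u))) ((30 * (n + 1) + 60) * (n - i + 1))"
proof (induction i arbitrary: Q rule: seg_induct[of n])
  case (stop i)
  then show ?case by - (rule callI, rule bodies_nth, simp, unfold unite_body_def,
      (rule ev_rules | rule branch_true, (simp; fail)
       | rule branch_false, (simp; fail) | (simp; fail))+)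
next
  case (step i)
  have seg: "{i..<n} = insert i {Suc i..<n}" using step.hyps by auto
  from step.hyps show ?case
    by - (cases "i \<in> A";
      (rule callI, rule bodies_nth, simp, unfold unite_body_def,
      (rule ev_rules step.IH union | rule branch_true, (simp; fail)
       | rule branch_false, (simp; fail) | (simp add: seg unroll[of i] Un_assoc; fail))+))
qed

text \<open>
  One more step along the arcs \<open>E\<close> for balls \<open>R\<close>.
\<close>
definition grow :: "nat \<Rightarrow> (nat \<Rightarrow> nat set) \<Rightarrow> (nat \<Rightarrow> nat set) \<Rightarrow> nat \<Rightarrow> nat set" where
  "grow n E R v = R v \<union> (\<Union>u \<in> E v \<inter> {0..<n}. R u)"

abbreviation "cStep n \<equiv> (30 * (n + 1) + 60) * (n + 1) + 60"

lemma step: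
  "call D STEP [gseg i n (\<lambda>v. vseg 0 n (E v)), gseg i n (\<lambda>v. vseg 0 n (R v)), gseg 0 n (\<lambda>v. vseg 0 n (R v))]
    (gseg i n (\<lambda>v. vseg 0 n (grow n E R v))) (cStep n * (n - i + 1))"
proof (induction i rule: seg_induct[of n])
  case (stop i)
  then show ?case by - (rule callI, rule bodies_nth, simp, unfold step_body_def,
      (rule ev_rules | rule branch_true, (simp; fail)
       | rule branch_false, (simp; fail) | (simp; fail))+)
next
  case (step i)
  from step.hyps show ?case
    by - (rule callI, rule bodies_nth, simp, unfold step_body_def,
      (rule ev_rules step.IH unite | rule branch_true, (simp; fail)
       | rule branch_false, (simp; fail) | (simp add: gseg_Cons[of i] unroll[of i] grow_def[symmetric]; fail))+)
qed

lemma balls: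
  "call D BALLS [enc_nat k, gseg 0 n (\<lambda>v. vseg 0 n (E v)), gseg 0 n (\<lambda>v. vseg 0 n (R v))]
    (gseg 0 n (\<lambda>v. vseg 0 n ((grow n E ^^ k) R v))) ((cStep n * (n + 1) + 60) * (k + 1))"
proof (induction k arbitrary: R)
  case 0
  then show ?case by - (rule callI, rule bodies_nth, simp, unfold balls_body_def,
      (rule ev_rules | rule branch_true, (simp; fail)
       | rule branch_false, (simp; fail) | (simp; fail))+)
next
  case (Suc k)
  show ?case by (rule callI, rule bodies_nth, simp, unfold balls_body_def,
      (rule ev_rules Suc.IH step | rule branch_true, (simp; fail)
       | rule branch_false, (simp; fail) | (simp add: funpow_swap1; fail))+)
qed

lemma equiv:
  assumes R: "\<And>v. v < n \<Longrightarrow> R v \<subseteq> {..<n}"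
  shows "call D EQUIV [gseg i n (\<lambda>v. vseg 0 n (R v)), vseg i n A, vseg 0 n X, vseg 0 n Y]
    (enc_bool (\<forall>v\<in>{i..<n} - A. min d (card (R v \<inter> X)) = min d (card (R v \<inter> Y))))
    ((80 * (n + 1) + 40 * Suc d + 2 * esize (enc_nat (Suc d)) + 200) * (n - i + 1))"
    (is "call D _ _ _ (?c * _)")
proof (induction i rule: seg_induct[of n])
  case (stop i)
  then show ?case by - (rule callI, rule bodies_nth, simp, unfold equiv_body_def,
      (rule ev_rules | rule branch_true, (simp; fail)
       | rule branch_false, (simp; fail) | (simp; fail))+)
next
  case (step i)
  have seg: "{i..<n} - A = (if i \<in> A then {Suc i..<n} - A else insert i ({Suc i..<n} - A))"
    using step.hyps by (auto simp: Suc_le_eq le_less)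
  have RX: "{0..<n} \<inter> (R i \<inter> Z) = R i \<inter> Z" for Z using R[OF step.hyps] by auto
  let ?cnt = "\<lambda>Z. (adv ^^ card (R i \<inter> Z)) (enc_nat (Suc d))"
  have cnt: "call D COUNT [enc_nat (Suc d), vseg 0 n (R i), vseg 0 n Z] (?cnt Z) (40 * (n + 1))" for Z
    using count[of "enc_nat (Suc d)" 0 n "R i" Z] by (simp only: RX diff_zero)
  have len_cnt: "len (?cnt Z) = Suc d - min d (card (R i \<inter> Z))" for Z
    unfolding len_adv by simp
  have same_cnt: "call D SAME [?cnt X, ?cnt Y]
      (enc_bool (min d (card (R i \<inter> X)) = min d (card (R i \<inter> Y)))) (40 * Suc d + 60)"
  proof (rule call_mono)
    have "(Suc d - min d a = Suc d - min d b) = (min d a = min d b)" for a b :: nat by linarith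
    then show "call D SAME [?cnt X, ?cnt Y]
      (enc_bool (min d (card (R i \<inter> X)) = min d (card (R i \<inter> Y)))) (20 * (len (?cnt X) + len (?cnt Y) + 3))"
      using same[of "?cnt X" "?cnt Y"] by (simp only: len_cnt)
    show "20 * (len (?cnt X) + len (?cnt Y) + 3) \<le> 40 * Suc d + 60"
      unfolding len_cnt by simp
  qed
  from step.hyps show ?case
    by - (cases "i \<in> A"; cases "min d (card (R i \<inter> X)) = min d (card (R i \<inter> Y))";
      (rule callI, rule bodies_nth, simp, unfold equiv_body_def,
      (rule ev_rules step.IH ev_const cnt same_cnt | rule branch_true, (simp; fail)
       | rule branch_false, (simp; fail) | (simp add: seg unroll[of i]; fail))+))
qed


lemma sat_rows:
  assumes R: "\<And>v. v < n \<Longrightarrow> R v \<subseteq> {..<n}" and cap: "\<And>b k. c b (min d k) = c b k"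
  shows "call D SAT [table d c, gseg i n (\<lambda>v. vseg 0 n (R v)), vseg i n A, vseg i n S, vseg 0 n S]
    (enc_bool (\<forall>v\<in>{i..<n} \<inter> A. c (v \<in> S) (card (R v \<inter> S)))) ((40 * (n + 1) + 150) * (n - i + 1))"
proof (induction i rule: seg_induct[of n])
  case (stop i)
  then show ?case by - (rule callI, rule bodies_nth, simp, unfold sat_body_def,
      (rule ev_rules | rule branch_true, (simp; fail)
       | rule branch_false, (simp; fail) | (simp; fail))+)
next
  case (step i)
  have seg: "{i..<n} \<inter> A = (if i \<in> A then insert i ({Suc i..<n} \<inter> A) else {Suc i..<n} \<inter> A)"
    using step.hyps by (auto simp: Suc_le_eq le_less)
  have RS: "{0..<n} \<inter> (R i \<inter> S) = R i \<inter> S" using R[OF step.hyps] by auto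
  define k where "k = card (R i \<inter> S)"
  define t where "t = (adv ^^ k) (table d c)"
  have cnt: "call D COUNT [table d c, vseg 0 n (R i), vseg 0 n S] t (40 * (n + 1))"
    using count[of "table d c" 0 n "R i" S] by (simp only: RS diff_zero t_def k_def)
  have "car t = Dot (enc_bool (c True (min d k))) (enc_bool (c False (min d k)))"
  proof -
    have "min d k < length [0..<Suc d]" "[0..<Suc d] ! min d k = min d k"
      by (simp, subst nth_upt, simp_all del: upt_Suc)
    then show ?thesis unfolding t_def table_def by (subst car_adv) (simp_all del: upt_Suc nth_upt)
  qed
  then have car_t: "car t = Dot (enc_bool (c True k)) (enc_bool (c False k))" by (simp only: cap)
  from step.hyps show ?case
    by - (cases "i \<in> A"; cases "i \<in> S"; cases "c (i \<in> S) k";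
      (rule callI, rule bodies_nth, simp, unfold sat_body_def,
      (rule ev_rules step.IH cnt | rule branch_true, (simp; fail)
       | rule branch_false, (simp; fail) | (simp add: seg unroll[of i] car_t k_def[symmetric]; fail))+))
qed

end

section \<open>Correctness and running time of the table operations\<close>

text \<open>
  All constants of a bound that depend on the problem and not on the instance.
\<close>
definition kappa :: "nat \<Rightarrow> nat \<Rightarrow> (bool \<Rightarrow> bool \<Rightarrow> nat \<Rightarrow> bool) \<Rightarrow> nat" where
  "kappa r d C = esize (enc_nat (Suc d)) + esize (table d (C True)) + esize (table d (C False))
     + esize (enc_nat r) + r + d + 1"

text \<open>
  Step counts as functions of a single number \<open>B\<close> that bounds the number of vertices, the size of the tree and
  the lengths of all lists of representatives. They are generous, as only polynomial growth in \<open>B\<close>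
  matters.
\<close>
definition "cEquiv k B = (80 * (B + 1) + 42 * k + 200) * (B + 1)"
definition "cSat B = (40 * (B + 1) + 150) * (B + 1)"
definition "cInsert k B = 2 * cEquiv k B + 100 * (B + 1) + 200"
definition "cOffer k B = 2 * cSat B + k + cInsert k B * (B + 1) + 60"
definition "cMergeY k B = cOffer k B + 90 * (B + 1) + 60"
definition "cMerge k B = cMergeY k B * (B + 1) + 60"
definition "cReps k B = cMerge k B * (B + 1) + 90"
definition "cZloop k B = cMerge k B * (B + 1) + 20 * (B + 1) + 60"
definition "cJoin k B = cZloop k B * (B + 1) + cReps k B * (B + 1) + 90 * (B + 1) + 90"

locale dp_program = capped_rows n d N C g
  for n d :: nat and N C g +
  fixes r B :: nat
  assumes N_sub: "v < n \<Longrightarrow> N out v \<subseteq> {..<n}" and n_le: "n \<le> B"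
begin

abbreviation "DD \<equiv> bodies r d C g"
abbreviation "K \<equiv> kappa r d C"
text \<open>
  A constant, so that symbolic execution treats sets as opaque values.
\<close>
definition vec :: "nat set \<Rightarrow> sexp" where
  "vec S = vseg 0 n S"

abbreviation "sets F \<equiv> enc_list (map vec F)"
abbreviation "units i \<equiv> gseg i n (\<lambda>v. vec {v})"

definition mat :: "bool \<Rightarrow> sexp" where
  "mat out = gseg 0 n (\<lambda>v. vseg 0 n (N out v))"

definition ctx :: sexp where
  "ctx = Dot (mat True) (Dot (mat False) (Dot (vec {}) (units 0)))"

lemma ctx_simps [simp]:
  "car ctx = mat True" "car (cdr ctx) = mat False" "car (cdr (cdr ctx)) = vec {}" "cdr (cdr (cdr ctx)) = units 0"
  by (simp_all add: ctx_def)

lemma len_mat [simp]: "len (mat out) = n"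
  by (simp add: mat_def)

lemma union_B: "call DD UNION [vec X, vec Y] (vec (X \<union> Y)) (30 * (B + 1))"
  unfolding vec_def by (rule call_mono[OF union]) (use n_le in simp)

text \<open>
  The part of \<open>eqv\<close> that one call of \<open>EQUIV\<close> decides.
\<close>
definition rows_eqv :: "bool \<Rightarrow> nat set \<Rightarrow> nat set \<Rightarrow> nat set \<Rightarrow> bool" where
  "rows_eqv out A X Y \<longleftrightarrow> (\<forall>v\<in>{0..<n} - A. min d (card (N out v \<inter> X)) = min d (card (N out v \<inter> Y)))"

lemma eqv_iff: "eqv A X Y \<longleftrightarrow> rows_eqv True A X Y \<and> rows_eqv False A X Y"
  unfolding eqv_def rows_eqv_def by (auto simp: all_bool_eq atLeast0LessThan)

lemma equiv_B: "call DD EQUIV [mat out, vec A, vec X, vec Y] (enc_bool (rows_eqv out A X Y)) (cEquiv K B)"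
proof (rule call_mono)
  show "call DD EQUIV [mat out, vec A, vec X, vec Y] (enc_bool (rows_eqv out A X Y))
     ((80 * (n + 1) + 40 * Suc d + 2 * esize (enc_nat (Suc d)) + 200) * (n - 0 + 1))"
    unfolding rows_eqv_def vec_def mat_def by (rule equiv) (rule N_sub)
  show "(80 * (n + 1) + 40 * Suc d + 2 * esize (enc_nat (Suc d)) + 200) * (n - 0 + 1) \<le> cEquiv K B"
    unfolding cEquiv_def by (rule mult_le_mono) (use n_le in \<open>simp_all add: kappa_def\<close>)
qed

text \<open>
  The part of \<open>sat\<close> that one call of \<open>SAT\<close> decides.
\<close>
definition rows_sat :: "bool \<Rightarrow> nat set \<Rightarrow> nat set \<Rightarrow> bool" where
  "rows_sat out A S \<longleftrightarrow> (\<forall>v\<in>{0..<n} \<inter> A. C out (v \<in> S) (card (N out v \<inter> S)))"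

lemma sat_iff: "A \<subseteq> {..<n} \<Longrightarrow> sat A S \<longleftrightarrow> rows_sat True A S \<and> rows_sat False A S"
  unfolding sat_def rows_sat_def by (auto simp: all_bool_eq subset_iff)

lemma sat_B:
  "call DD SAT [table d (C out), mat out, vec A, vec S, vec S] (enc_bool (rows_sat out A S)) (cSat B)"
proof (rule call_mono)
  show "call DD SAT [table d (C out), mat out, vec A, vec S, vec S] (enc_bool (rows_sat out A S))
      ((40 * (n + 1) + 150) * (n - 0 + 1))"
    unfolding rows_sat_def vec_def mat_def by (rule sat_rows) (rule N_sub, assumption, rule capped)
  show "(40 * (n + 1) + 150) * (n - 0 + 1) \<le> cSat B"
    unfolding cSat_def by (rule mult_le_mono) (use n_le in simp_all)
qed

text \<open>
  What is left of the counter after the elements of \<open>X\<close> have been counted.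
\<close>
definition remaining :: "nat set \<Rightarrow> sexp" where
  "remaining X = (adv ^^ card X) (Dot Atom (mat True))"

lemma remaining:
  assumes "X \<subseteq> {..<n}"
  shows "call DD COUNT [Dot Atom (mat True), vec X, vec X] (remaining X) (40 * (B + 1))"
proof (rule call_mono)
  have "{0..<n} \<inter> (X \<inter> X) = X" using assms by auto
  then show "call DD COUNT [Dot Atom (mat True), vec X, vec X] (remaining X) (40 * (n - 0 + 1))"
    using count[of r d C g "Dot Atom (mat True)" 0 n X X] by (simp only: remaining_def vec_def)
qed (use n_le in simp)

lemma fewer:
  assumes "X \<subseteq> {..<n}" "Y \<subseteq> {..<n}"
  shows "call DD LEQ [remaining X, remaining Y] (enc_bool (card Y \<le> card X)) (20 * (B + 2))"
proof (rule call_mono)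
  have "len (remaining Z) = Suc n - card Z" if "Z \<subseteq> {..<n}" for Z
    using card_mono[OF finite_lessThan that] by (simp add: remaining_def len_adv)
  then have len: "len (remaining X) = Suc n - card X" "len (remaining Y) = Suc n - card Y"
    using assms by auto
  have "Suc n - card X \<le> Suc n - card Y \<longleftrightarrow> card Y \<le> card X"
    using card_mono[OF finite_lessThan assms(1)] card_mono[OF finite_lessThan assms(2)] by auto
  then show "call DD LEQ [remaining X, remaining Y] (enc_bool (card Y \<le> card X)) (20 * (len (remaining X) + 1))"
    using leq[of r d C g "remaining X" "remaining Y"] by (simp only: len)
  show "20 * (len (remaining X) + 1) \<le> 20 * (B + 2)" unfolding len using n_le by simp
qed

lemma insert:
  assumes "X \<subseteq> {..<n}" "set F \<subseteq> Pow {..<n}"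
  shows "call DD INSERT [ctx, vec A, vec X, sets F] (sets (insert_class (eqv A) (pref g) X F))
    (cInsert K B * (length F + 1))"
  using assms(2)
proof (induction F)
  case Nil
  show ?case by (rule callI, rule bodies_nth, simp, unfold insert_body_def,
      (rule ev_rules | rule branch_true, (simp; fail)
       | rule branch_false, (simp; fail) | (simp add: cInsert_def; fail))+)
next
  case (Cons Y F)
  then have IH: "call DD INSERT [ctx, vec A, vec X, sets F] (sets (insert_class (eqv A) (pref g) X F))
    (cInsert K B * (length F + 1))" and Y: "Y \<subseteq> {..<n}" by auto
  note fs = equiv_B remaining[OF assms(1)] remaining[OF Y] fewer[OF assms(1) Y] fewer[OF Y assms(1)] IH
  have c: "2 * cEquiv K B + 100 * (B + 1) + 200 \<le> cInsert K B" by (simp add: cInsert_def)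
  show ?case
  proof (cases g)
    case Minimum
    from c Minimum show ?thesis
      by - (cases "rows_eqv True A X Y"; cases "rows_eqv False A X Y"; cases "card X \<le> card Y";
        (rule callI, rule bodies_nth, simp, unfold insert_body_def Minimum goal.case,
        (rule ev_rules fs[unfolded Minimum] | rule branch_true, (simp; fail)
         | rule branch_false, (simp; fail) | (simp add: eqv_iff[of A X Y] pref_def[of _ X Y]; fail))+))
  next
    case Maximum
    from c Maximum show ?thesis
      by - (cases "rows_eqv True A X Y"; cases "rows_eqv False A X Y"; cases "card Y \<le> card X";
        (rule callI, rule bodies_nth, simp, unfold insert_body_def Maximum goal.case,
        (rule ev_rules fs[unfolded Maximum] | rule branch_true, (simp; fail)
         | rule branch_false, (simp; fail) | (simp add: eqv_iff[of A X Y] pref_def[of _ X Y]; fail))+))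
  qed
qed

lemma offer:
  assumes "U \<subseteq> {..<n}" "set F \<subseteq> Pow {..<n}" "As \<subseteq> {..<n}" "length F \<le> B"
  shows "call DD OFFER [ctx, vec A, vec As, vec W, vec U, sets F]
    (sets (if sat As W then insert_class (eqv A) (pref g) U F else F)) (cOffer K B)"
proof -
  have ins: "call DD INSERT [ctx, vec A, vec U, sets F] (sets (insert_class (eqv A) (pref g) U F))
      (cInsert K B * (B + 1))"
    by (rule call_mono[OF insert[OF assms(1,2)]]) (use assms(4) in simp)
  have "esize (table d (C True)) + esize (table d (C False)) \<le> K" by (simp add: kappa_def)
  then show ?thesis
    by - (cases "rows_sat True As W"; cases "rows_sat False As W";
      (rule callI, rule bodies_nth, simp, unfold offer_body_def,
      (rule ev_rules ev_const sat_B ins | rule branch_true, (simp; fail)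
       | rule branch_false, (simp; fail) | (simp add: cOffer_def sat_iff[OF assms(3)]; fail))+))
qed


text \<open>
  The bound \<open>few A B\<close> on the number of classes limits the length of the accumulator throughout, and
  with it the cost of every insertion.
\<close>
lemma mergey:
  assumes "few A B" "A \<subseteq> {..<n}" "As \<subseteq> {..<n}" "X \<subseteq> A" "set H \<subseteq> Pow A"
    "set F \<subseteq> Pow A" "unrelated (eqv A) F"
  shows "call DD MERGEY [ctx, vec A, vec As, vec Z, vec X, sets H, sets F]
    (sets (collect (eqv A) (pref g) (\<lambda>U. sat As (U \<union> Z)) (map (\<lambda>Y. X \<union> Y) H) F))
    (cMergeY K B * (length H + 1))"
  using assms(5-7)
proof (induction H arbitrary: F)
  case Nil
  show ?case by (rule callI, rule bodies_nth, simp, unfold mergey_body_def,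
      (rule ev_rules | rule branch_true, (simp; fail)
       | rule branch_false, (simp; fail) | (simp add: cMergeY_def; fail))+)
next
  case (Cons Y H)
  define F' where "F' = (if sat As (X \<union> Y \<union> Z) then insert_class (eqv A) (pref g) (X \<union> Y) F else F)"
  have len: "length F \<le> B" using few_length[OF assms(1) Cons.prems(2,3)] .
  have XY: "X \<union> Y \<subseteq> A" using assms(4) Cons.prems(1) by auto
  have sub: "X \<union> Y \<subseteq> {..<n}" "set F \<subseteq> Pow {..<n}" using XY assms(2) Cons.prems(2) by auto
  have off: "call DD OFFER [ctx, vec A, vec As, vec (X \<union> Y \<union> Z), vec (X \<union> Y), sets F] (sets F') (cOffer K B)"
    unfolding F'_def by (rule offer[OF sub assms(3) len])
  have F': "F' = collect (eqv A) (pref g) (\<lambda>U. sat As (U \<union> Z)) [X \<union> Y] F" by (simp add: F'_def)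
  have IH: "call DD MERGEY [ctx, vec A, vec As, vec Z, vec X, sets H, sets F']
    (sets (collect (eqv A) (pref g) (\<lambda>U. sat As (U \<union> Z)) (map (\<lambda>Y. X \<union> Y) H) F'))
    (cMergeY K B * (length H + 1))"
  proof (rule Cons.IH)
    show "set H \<subseteq> Pow A" using Cons.prems(1) by simp
    show "set F' \<subseteq> Pow A"
      using collect_sub[of A "\<lambda>U. sat As (U \<union> Z)" "[X \<union> Y]" F] XY Cons.prems(2) unfolding F' by fastforce
    show "unrelated (eqv A) F'" unfolding F' by (rule collect_unrel[OF Cons.prems(3)])
  qed
  have c: "cOffer K B + 90 * (B + 1) + 60 \<le> cMergeY K B" by (simp add: cMergeY_def)
  then show ?case by - (rule callI, rule bodies_nth, simp, unfold mergey_body_def,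
      (rule ev_rules IH off union_B | rule branch_true, (simp; fail)
       | rule branch_false, (simp; fail) | (simp add: F'_def[symmetric]; fail))+)
qed

lemma merge:
  assumes "few A B" "A \<subseteq> {..<n}" "As \<subseteq> {..<n}" "set (unions Fs H) \<subseteq> Pow A" "set Fs \<subseteq> Pow A"
    "set H \<subseteq> Pow A" "length H \<le> B" "set F \<subseteq> Pow A" "unrelated (eqv A) F"
  shows "call DD MERGE [ctx, vec A, vec As, vec Z, sets Fs, sets H, sets F]
    (sets (collect (eqv A) (pref g) (\<lambda>U. sat As (U \<union> Z)) (unions Fs H) F))
    (cMerge K B * (length Fs + 1))"
  using assms(5,8,9)
proof (induction Fs arbitrary: F)
  case Nil
  show ?case by (rule callI, rule bodies_nth, simp, unfold merge_body_def,
      (rule ev_rules | rule branch_true, (simp; fail)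
       | rule branch_false, (simp; fail) | (simp add: cMerge_def unions_def; fail))+)
next
  case (Cons X Fs)
  define F' where "F' = collect (eqv A) (pref g) (\<lambda>U. sat As (U \<union> Z)) (map (\<lambda>Y. X \<union> Y) H) F"
  have X: "X \<subseteq> A" using Cons.prems(1) by simp
  have my: "call DD MERGEY [ctx, vec A, vec As, vec Z, vec X, sets H, sets F] (sets F') (cMergeY K B * (B + 1))"
    unfolding F'_def
    by (rule call_mono[OF mergey[OF assms(1-3) X assms(6) Cons.prems(2,3)]]) (use assms(7) in simp)
  have IH: "call DD MERGE [ctx, vec A, vec As, vec Z, sets Fs, sets H, sets F']
    (sets (collect (eqv A) (pref g) (\<lambda>U. sat As (U \<union> Z)) (unions Fs H) F'))
    (cMerge K B * (length Fs + 1))"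
  proof (rule Cons.IH)
    show "set Fs \<subseteq> Pow A" using Cons.prems(1) by simp
    show "set F' \<subseteq> Pow A"
      using collect_sub[of A "\<lambda>U. sat As (U \<union> Z)" "map (\<lambda>Y. X \<union> Y) H" F] X assms(6) Cons.prems(2)
      unfolding F'_def by fastforce
    show "unrelated (eqv A) F'" unfolding F'_def by (rule collect_unrel[OF Cons.prems(3)])
  qed
  have un: "unions (X # Fs) H = map (\<lambda>Y. X \<union> Y) H @ unions Fs H" by (simp add: unions_def)
  have c: "cMergeY K B * (B + 1) + 60 \<le> cMerge K B" by (simp add: cMerge_def)
  then show ?case by - (rule callI, rule bodies_nth, simp, unfold merge_body_def,
      (rule ev_rules IH my | rule branch_true, (simp; fail)
       | rule branch_false, (simp; fail) | (simp add: un collect_append F'_def[symmetric]; fail))+)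
qed

text \<open>
  The argument \<open>R\<close> is the list after the first \<open>i\<close> vertices, which is where its length bound comes
  from.
\<close>
lemma reps_call:
  assumes "few A B" "A \<subseteq> {..<n}" "2 \<le> B" "R = foldl (\<lambda>R v. reps_step A v R) [{}] [0..<i]"
  shows "call DD REPS [ctx, vec A, vseg i n A, units i, sets R]
    (sets (foldl (\<lambda>R v. reps_step A v R) R [i..<n])) (cReps K B * (n - i + 1))"
  using assms(4)
proof (induction i arbitrary: R rule: seg_induct[of n])
  case (stop i)
  then show ?case by - (rule callI, rule bodies_nth, simp, unfold reps_body_def,
      (rule ev_rules | rule branch_true, (simp; fail)
       | rule branch_false, (simp; fail) | (simp add: cReps_def; fail))+)
next
  case (step i)
  have fold: "foldl (\<lambda>R v. reps_step A v R) R [i..<n]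
      = foldl (\<lambda>R v. reps_step A v R) (reps_step A i R) [Suc i..<n]"
    using step.hyps by (simp add: upt_conv_Cons)
  have nxt: "reps_step A i R = foldl (\<lambda>R v. reps_step A v R) [{}] [0..<Suc i]"
    using step.prems by simp
  have R: "set R \<subseteq> Pow (A \<inter> {..<i})" "length R \<le> B"
    using reps_prefix[OF assms(2) step.prems, of B] assms(1) by auto
  have c: "cMerge K B * (B + 1) + 90 \<le> cReps K B" by (simp add: cReps_def)
  show ?case
  proof (cases "i \<in> A")
    case False
    then have same: "reps_step A i R = R" by (simp add: reps_step_def)
    from step.hyps False c show ?thesis
      by - (rule callI, rule bodies_nth, simp, unfold reps_body_def,
      (rule ev_rules step.IH[OF nxt, unfolded same] | rule branch_true, (simp; fail)
       | rule branch_false, (simp; fail) | (simp add: fold same unroll[of i]; fail))+)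
  next
    case True
    have "call DD MERGE [ctx, vec A, vec {}, vec {}, sets R, sets [{}, {i}], sets []]
      (sets (reps_step A i R)) (cMerge K B * (length R + 1))"
    proof -
      have "collect (eqv A) (pref g) (\<lambda>U. sat {} (U \<union> {})) (unions R [{}, {i}]) [] = reps_step A i R"
        using True by (simp add: reps_step_def sat_def)
      moreover have "set (unions R [{}, {i}]) \<subseteq> Pow A" "set R \<subseteq> Pow A"
        using R True by (fastforce simp: set_unions)+
      ultimately show ?thesis
        using merge[OF assms(1,2), of "{}" R "[{}, {i}]" "[]" "{}"] True assms(3) by simp
    qed
    then have mg: "call DD MERGE [ctx, vec A, vec {}, vec {}, sets R, Dot (vec {}) (Dot (vec {i}) Atom), Atom]
      (sets (reps_step A i R)) (cMerge K B * (B + 1))"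
      by - (rule call_mono, simp, use R(2) in simp)
    from step.hyps True c show ?thesis
      by - (rule callI, rule bodies_nth, simp, unfold reps_body_def,
      (rule ev_rules step.IH[OF nxt] mg | rule branch_true, (simp; fail)
       | rule branch_false, (simp; fail) | (simp add: fold unroll[of i]; fail))+)
  qed
qed

lemma reps_B:
  assumes "few A B" "A \<subseteq> {..<n}" "2 \<le> B"
  shows "call DD REPS [ctx, vec A, vec A, units 0, Dot (vec {}) Atom] (sets (reps A)) (cReps K B * (B + 1))"
proof (rule call_mono)
  show "call DD REPS [ctx, vec A, vec A, units 0, Dot (vec {}) Atom] (sets (reps A)) (cReps K B * (n - 0 + 1))"
    using reps_call[OF assms, of "[{}]" 0] by (simp add: reps_def vec_def)
qed (use n_le in simp)

lemma zloop:
  assumes "few A B" "A \<subseteq> {..<n}" "set (unions F H) \<subseteq> Pow A" "set F \<subseteq> Pow A" "set H \<subseteq> Pow A"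
    "length F \<le> B" "length H \<le> B"
  shows "call DD ZLOOP [ctx, sets Zs, vec A, sets F, sets H]
    (sets (concat (map (\<lambda>Z. candidates A Z F H) Zs))) (cZloop K B * (length Zs + 1))"
proof (induction Zs)
  case Nil
  show ?case by (rule callI, rule bodies_nth, simp, unfold zloop_body_def,
      (rule ev_rules | rule branch_true, (simp; fail)
       | rule branch_false, (simp; fail) | (simp add: cZloop_def; fail))+)
next
  case (Cons Z Zs)
  have "call DD MERGE [ctx, vec A, vec A, vec Z, sets F, sets H, sets []] (sets (candidates A Z F H))
      (cMerge K B * (length F + 1))"
    unfolding candidates_def by (rule merge) (use assms in simp_all)
  then have mg: "call DD MERGE [ctx, vec A, vec A, vec Z, sets F, sets H, Atom] (sets (candidates A Z F H))
      (cMerge K B * (B + 1))"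
    by - (rule call_mono, simp, use assms(6) in simp)
  have len: "length (candidates A Z F H) \<le> B"
    unfolding candidates_def by (rule few_collect[OF assms(1,3)])
  have "foldr Dot (map vec xs) (sets ys) = sets (xs @ ys)" for xs ys by (induction xs) auto
  then have "call DD APPEND [sets (candidates A Z F H), sets ys] (sets (candidates A Z F H @ ys))
      (20 * (length (candidates A Z F H) + 1))" for ys
    using append[of r d C g "map vec (candidates A Z F H)" "sets ys"] by simp
  then have app: "call DD APPEND [sets (candidates A Z F H), sets ys] (sets (candidates A Z F H @ ys)) (20 * (B + 1))" for ys
    by - (rule call_mono, assumption, use len in simp)
  have c: "cMerge K B * (B + 1) + 20 * (B + 1) + 60 \<le> cZloop K B" by (simp add: cZloop_def)
  then show ?case by - (rule callI, rule bodies_nth, simp, unfold zloop_body_def,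
      (rule ev_rules Cons.IH mg app | rule branch_true, (simp; fail)
       | rule branch_false, (simp; fail) | (simp; fail))+)
qed

lemma join:
  assumes "few (A \<union> A') B" "few ({..<n} - (A \<union> A')) B" "A \<union> A' \<subseteq> {..<n}" "set F \<subseteq> Pow A" "set H \<subseteq> Pow A'"
    "length F \<le> B" "length H \<le> B" "2 \<le> B"
  shows "call DD JOIN [ctx, Dot (vec A) (sets F), Dot (vec A') (sets H)]
    (Dot (vec (A \<union> A')) (sets (combine (A \<union> A') F H))) (cJoin K B)"
proof -
  let ?A = "A \<union> A'"
  have FH: "set (unions F H) \<subseteq> Pow ?A" "set F \<subseteq> Pow ?A" "set H \<subseteq> Pow ?A"
    using assms(4,5) by (auto simp: set_unions)
  have neg_B: "call DD NEG [vec ?A] (vec ({..<n} - ?A)) (30 * (B + 1))"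
    unfolding vec_def by (rule call_mono[OF neg]) (use n_le in simp)
  note rp = reps_B[OF assms(2) Diff_subset assms(8)]
  have zl: "call DD ZLOOP [ctx, sets (reps ({..<n} - ?A)), vec ?A, sets F, sets H]
    (sets (combine ?A F H)) (cZloop K B * (B + 1))"
    unfolding combine_def
    by (rule call_mono[OF zloop[OF assms(1,3) FH assms(6,7)]])
       (use reps_few[OF Diff_subset assms(2)] in simp)
  have comb: "call DD COMB [ctx, vec ?A, sets F, sets H] (Dot (vec ?A) (sets (combine ?A F H)))
      (cZloop K B * (B + 1) + cReps K B * (B + 1) + 60 * (B + 1) + 60)"
    by (rule callI, rule bodies_nth, simp, unfold comb_body_def,
      (rule ev_rules zl rp neg_B | rule branch_true, (simp; fail)
       | rule branch_false, (simp; fail) | (simp; fail))+)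
  show ?thesis by (rule callI, rule bodies_nth, simp, unfold join_body_def,
      (rule ev_rules comb union_B | rule branch_true, (simp; fail)
       | rule branch_false, (simp; fail) | (simp add: cJoin_def; fail))+)
qed

end

section \<open>The traversal of the decomposition tree\<close>

definition "cStart B = 2 * ((40 * B + 90) * (B + 1)) + 90"
definition "cRow k B = cJoin k B + cStart B + 20 * (B + 1) + 20 * (2 * B + 3) + 120"
definition "cNode k B = cRow k B * (B + 1) + 60"

text \<open>
  The number \<open>q\<close> bounds the number of classes of every vertex set that occurs in the traversal, and of its
  complement. Such a set consists of the vertices placed at a node together with the
  vertices beyond some of its neighbours.
\<close>
locale tree_dp = dp_program n d N C g r B + tree_rel E "{..<m}"
  for n d N C g r B and E :: "nat rel" and m :: nat +
  fixes L :: "nat \<Rightarrow> nat" and q :: nat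
  assumes L_less: "v < n \<Longrightarrow> L v < m" and L_inj: "inj_on L {..<n}" and m_le: "m \<le> B"
    and B2: "2 \<le> B" and q_le: "q * q \<le> B" and q_pos: "1 \<le> q"
    and few_pieces: "x < m \<Longrightarrow> Z \<subseteq> nbrs x \<Longrightarrow>
      few ({v \<in> {..<n}. L v = x} \<union> (\<Union>z\<in>Z. {v \<in> {..<n}. L v \<in> side E z x})) q \<and>
      few ({..<n} - ({v \<in> {..<n}. L v = x} \<union> (\<Union>z\<in>Z. {v \<in> {..<n}. L v \<in> side E z x}))) q"
begin

definition at_node :: "nat \<Rightarrow> nat set" where "at_node x = {v \<in> {..<n}. L v = x}"
definition beyond :: "nat \<Rightarrow> nat \<Rightarrow> nat set" where "beyond x p = {v \<in> {..<n}. L v \<in> side E x p}"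
definition union_of :: "nat \<Rightarrow> nat set \<Rightarrow> nat set" where "union_of x Z = at_node x \<union> (\<Union>z\<in>Z. beyond z x)"

abbreviation "trow x i \<equiv> gseg i m (\<lambda>y. enc_bool ((x, y) \<in> E))"
abbreviation "Tmat \<equiv> gseg 0 m (\<lambda>x. trow x 0)"
abbreviation "Lseq \<equiv> gseg 0 n (\<lambda>v. enc_nat (L v))"

lemma q_B: "q \<le> B"
  using q_le q_pos by (metis le_square le_trans)

lemma few_union_of:
  assumes "x < m" "Z \<subseteq> nbrs x"
  shows "few (union_of x Z) q" "few ({..<n} - union_of x Z) q"
  using few_pieces[OF assms] by (simp_all add: union_of_def at_node_def beyond_def)

lemma union_of_sub: "union_of x Z \<subseteq> {..<n}"
  by (auto simp: union_of_def at_node_def beyond_def)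

lemma at_single: "card (at_node x) \<le> 1"
proof -
  have "at_node x = {} \<or> (\<exists>v. at_node x = {v})"
    unfolding at_node_def using inj_onD[OF L_inj] by blast
  then show ?thesis by auto
qed

lemma beyond_unfold: "beyond x p = union_of x (nbrs x - {p})"
  unfolding beyond_def union_of_def at_node_def side_unfold[of x p] by auto

lemma union_of_root:
  assumes "x < m" shows "union_of x (nbrs x) = {..<n}"
proof -
  have "L v = x \<or> (\<exists>y\<in>nbrs x. L v \<in> side E y x)" if "v < n" for v
    using all_unfold[of x] assms L_less[OF that] by blast
  then show ?thesis by (auto simp: union_of_def at_node_def beyond_def)
qed

lemma beyond_disjoint_union_of:
  assumes "Z \<subseteq> nbrs x" "y \<in> nbrs x" "y \<notin> Z"
  shows "union_of x Z \<inter> beyond y x = {}"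
proof -
  have "x \<notin> side E y x" using side_not_parent assms(2) by blast
  moreover have "side E z x \<inter> side E y x = {}" if "z \<in> Z" for z
    using sides_disjoint[of x z y] that assms by blast
  ultimately show ?thesis by (auto simp: union_of_def at_node_def beyond_def)
qed

lemma start_call:
  assumes "x < m"
  shows "call DD START [ctx, Lseq, enc_nat x] (Dot (vec (at_node x)) (sets [{}, at_node x])) (cStart B)"
proof -
  have "vseg 0 n {v. L v = x} = vec (at_node x)"
    unfolding vec_def gseg_def at_node_def
    by (intro arg_cong[where f = enc_list] map_cong refl) auto
  then have vs: "call DD VERTS [Lseq, enc_nat x] (vec (at_node x)) ((40 * B + 90) * (B + 1))"
    using call_mono[OF verts[of n L B "enc_nat x" r d C g 0], of "(40 * B + 90) * (B + 1)"]
      L_less m_le assms n_le by fastforce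
  show ?thesis by (rule callI, rule bodies_nth, simp, unfold start_body_def,
      (rule ev_rules vs | rule branch_true, (simp; fail)
       | rule branch_false, (simp; fail) | (simp add: cStart_def; fail))+)
qed

text \<open>
  The list \<open>F\<close> is universally quantified, so that an induction hypothesis applies to whatever list the
  previous neighbours have produced.
\<close>
definition solved :: "nat \<Rightarrow> nat \<Rightarrow> sexp \<Rightarrow> nat set \<Rightarrow> sexp \<Rightarrow> nat set \<Rightarrow> nat \<Rightarrow> bool" where
  "solved x p row A y U T \<longleftrightarrow> (\<forall>F. represents F A \<and> length F \<le> B \<longrightarrow>
     (\<exists>F'. call DD LOOP [ctx, Tmat, Lseq, row, y, enc_nat x, enc_nat p, Dot (vec A) (sets F)]
         (Dot (vec U) (sets F')) T \<and> represents F' U \<and> length F' \<le> B))"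

text \<open>
  Induction along the row of \<open>x\<close>. The processed neighbours contribute \<open>union_of x\<close>; the cost of a child is
  proportional to the size of its subtree, so the total is linear in the size of the tree.
\<close>
lemma loop_row:
  assumes x: "x < m" and p: "p < m"
    and child: "\<And>y. (x, y) \<in> E \<Longrightarrow> y \<noteq> p \<Longrightarrow>
      solved y x (trow y 0) (at_node y) Atom (beyond y x) (cNode K B * card (side E y x))"
  shows "solved x p (trow x i) (union_of x (nbrs x \<inter> {..<i} - {p})) (enc_nat i)
    (union_of x (nbrs x - {p}))
    (cRow K B * (m - i + 1) + cNode K B * (\<Sum>y\<in>nbrs x \<inter> {i..} - {p}. card (side E y x)))"
proof (induction i rule: seg_induct[of m])
  case (stop i)
  have sub: "nbrs x \<subseteq> {..<m}" using tree_rel_axioms by (auto simp: tree_rel_def)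
  then have "nbrs x \<inter> {..<i} = nbrs x" using stop by auto
  then show ?case unfolding solved_def
  proof (intro allI impI)
    fix F assume F: "represents F (union_of x (nbrs x \<inter> {..<i} - {p})) \<and> length F \<le> B"
    have "call DD LOOP [ctx, Tmat, Lseq, trow x i, enc_nat i, enc_nat x, enc_nat p,
        Dot (vec (union_of x (nbrs x - {p}))) (sets F)]
      (Dot (vec (union_of x (nbrs x - {p}))) (sets F)) (cRow K B)"
      using stop by - (rule callI, rule bodies_nth, simp, unfold loop_body_def,
      (rule ev_rules | rule branch_true, (simp; fail)
       | rule branch_false, (simp; fail) | (simp add: cRow_def; fail))+)
    from call_mono[OF this] show "\<exists>F'. call DD LOOP [ctx, Tmat, Lseq, trow x i, enc_nat i, enc_nat x, enc_nat p,
        Dot (vec (union_of x (nbrs x \<inter> {..<i} - {p}))) (sets F)]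
      (Dot (vec (union_of x (nbrs x - {p}))) (sets F'))
        (cRow K B * (m - i + 1) + cNode K B * (\<Sum>y\<in>nbrs x \<inter> {i..} - {p}. card (side E y x))) \<and>
        represents F' (union_of x (nbrs x - {p})) \<and> length F' \<le> B"
      using F \<open>nbrs x \<inter> {..<i} = nbrs x\<close> by (intro exI[of _ F]) simp
  qed
next
  case (step i)
  let ?Z = "\<lambda>i. nbrs x \<inter> {..<i} - {p}" and ?R = "\<lambda>i. nbrs x \<inter> {i..} - {p}"
  let ?sum = "\<lambda>i. \<Sum>y\<in>?R i. card (side E y x)"
  have same_ip: "call DD SAME [enc_nat i, enc_nat p] (enc_bool (i = p)) (20 * (2 * B + 3))"
    using call_mono[OF same[of r d C g "enc_nat i" "enc_nat p"], of "20 * (2 * B + 3)"]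
      step.hyps p m_le by simp
  have c: "cJoin K B + cStart B + 20 * (B + 1) + 20 * (2 * B + 3) + 120 \<le> cRow K B" by (simp add: cRow_def)
  show ?case unfolding solved_def
  proof (intro allI impI)
    fix F assume F: "represents F (union_of x (?Z i)) \<and> length F \<le> B"
    show "\<exists>F'. call DD LOOP [ctx, Tmat, Lseq, trow x i, enc_nat i, enc_nat x, enc_nat p,
        Dot (vec (union_of x (?Z i))) (sets F)]
      (Dot (vec (union_of x (nbrs x - {p}))) (sets F')) (cRow K B * (m - i + 1) + cNode K B * ?sum i) \<and>
        represents F' (union_of x (nbrs x - {p})) \<and> length F' \<le> B"
    proof (cases "(x, i) \<in> E \<and> i \<noteq> p")
      case False
      then have Z: "?Z (Suc i) = ?Z i" and R: "?R i = ?R (Suc i)"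
        by (auto simp: less_Suc_eq Suc_le_eq le_less)
      obtain F' where F': "call DD LOOP [ctx, Tmat, Lseq, trow x (Suc i), Dot Atom (enc_nat i), enc_nat x, enc_nat p,
          Dot (vec (union_of x (?Z i))) (sets F)]
        (Dot (vec (union_of x (nbrs x - {p}))) (sets F')) (cRow K B * (m - Suc i + 1) + cNode K B * ?sum (Suc i))"
        "represents F' (union_of x (nbrs x - {p}))" "length F' \<le> B"
        using step.IH F unfolding solved_def Z by auto
      define A where "A = union_of x (?Z i)"
      define s where "s = ?sum (Suc i)"
      note F1 = F'(1)[folded A_def s_def]
      have "call DD LOOP [ctx, Tmat, Lseq, trow x i, enc_nat i, enc_nat x, enc_nat p, Dot (vec A) (sets F)]
        (Dot (vec (union_of x (nbrs x - {p}))) (sets F')) (cRow K B * (m - i + 1) + cNode K B * s)"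
      proof (cases "(x, i) \<in> E")
        case xi: False
        show ?thesis using step.hyps c xi by - (rule callI, rule bodies_nth, simp, unfold loop_body_def,
      (rule ev_rules F1 | rule branch_true, (simp; fail)
       | rule branch_false, (simp; fail) | (simp add: unroll[of i]; fail))+)
      next
        case xi: True
        then have ip: "i = p" using False by simp
        show ?thesis unfolding ip
          using step.hyps[unfolded ip] c xi[unfolded ip]
          by - (rule callI, rule bodies_nth, simp, unfold loop_body_def,
      (rule ev_rules F1[unfolded ip] same_ip[unfolded ip] | rule branch_true, (simp; fail)
       | rule branch_false, (simp; fail) | (simp add: unroll[of p]; fail))+)
      qed
      then show ?thesis using F' unfolding R A_def s_def by blast
    next
      case True
      then have xi: "(x, i) \<in> E" "i \<noteq> p" "i \<in> nbrs x" by auto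
      have Z: "?Z (Suc i) = insert i (?Z i)" and R: "?R i = insert i (?R (Suc i))" and iR: "i \<notin> ?R (Suc i)"
        using xi by (auto simp: less_Suc_eq Suc_le_eq le_less)
      have U: "union_of x (?Z (Suc i)) = union_of x (?Z i) \<union> beyond i x"
        unfolding Z union_of_def by auto
      have sum: "?sum i = card (side E i x) + ?sum (Suc i)"
        unfolding R using iR finite_nbrs[of x] by simp
      have at_node: "represents [{}, at_node i] (at_node i)" "length [{}, at_node i] \<le> B"
        using represents_single[OF at_single] B2 by (auto simp: at_node_def)
      obtain H where H: "call DD LOOP [ctx, Tmat, Lseq, trow i 0, Atom, enc_nat i, enc_nat x,
          Dot (vec (at_node i)) (sets [{}, at_node i])]
        (Dot (vec (beyond i x)) (sets H)) (cNode K B * card (side E i x))"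
        "represents H (beyond i x)" "length H \<le> B"
        using child[OF xi(1,2)] at_node unfolding solved_def by blast
      have Zs: "?Z (Suc i) \<subseteq> nbrs x" "?Z i \<subseteq> nbrs x" by auto
      note few = few_union_of[OF x Zs(1), unfolded U]
      have sub: "union_of x (?Z i) \<union> beyond i x \<subseteq> {..<n}" using union_of_sub[of x "?Z (Suc i)"] unfolding U .
      define F2 where "F2 = combine (union_of x (?Z i) \<union> beyond i x) F H"
      have jn: "call DD JOIN [ctx, Dot (vec (union_of x (?Z i))) (sets F), Dot (vec (beyond i x)) (sets H)]
          (Dot (vec (union_of x (?Z i) \<union> beyond i x)) (sets F2)) (cJoin K B)"
        unfolding F2_def
        by (rule join[OF few_mono[OF few(1) q_B] few_mono[OF few(2) q_B] sub
              represents_sub[OF conjunct1[OF F]] represents_sub[OF H(2)] conjunct2[OF F] H(3) B2])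
      have F2: "represents F2 (union_of x (?Z (Suc i)))" unfolding F2_def U
        by (rule represents_combine[OF conjunct1[OF F] H(2) beyond_disjoint_union_of[OF Zs(2) xi(3)] sub]) auto
      have "set (unions F H) \<subseteq> Pow (union_of x (?Z i) \<union> beyond i x)"
        using represents_sub[OF conjunct1[OF F]] represents_sub[OF H(2)] by (fastforce simp: set_unions)
      then have "length F2 \<le> B" unfolding F2_def using length_combine[OF few] q_le le_trans by blast
      then obtain F' where F': "call DD LOOP [ctx, Tmat, Lseq, trow x (Suc i), Dot Atom (enc_nat i), enc_nat x, enc_nat p,
          Dot (vec (union_of x (?Z i) \<union> beyond i x)) (sets F2)]
        (Dot (vec (union_of x (nbrs x - {p}))) (sets F')) (cRow K B * (m - Suc i + 1) + cNode K B * ?sum (Suc i))"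
        "represents F' (union_of x (nbrs x - {p}))" "length F' \<le> B"
        using step.IH F2 unfolding solved_def U by auto
      have row: "call DD NTH [Tmat, enc_nat i] (trow i 0) (20 * (B + 1))"
        using call_mono[OF nth_row[of i 0 m r d C g "\<lambda>x. trow x 0"], of "20 * (B + 1)"] step.hyps m_le by simp
      note st = start_call[OF step.hyps]
      have "call DD LOOP [ctx, Tmat, Lseq, trow x i, enc_nat i, enc_nat x, enc_nat p,
          Dot (vec (union_of x (?Z i))) (sets F)]
        (Dot (vec (union_of x (nbrs x - {p}))) (sets F'))
        (cRow K B * (m - i + 1) + (cNode K B * card (side E i x) + cNode K B * ?sum (Suc i)))"
        using step.hyps c xi
        by - (rule callI, rule bodies_nth, simp, unfold loop_body_def,
      (rule ev_rules F'(1) same_ip jn row st H(1) | rule branch_true, (simp; fail)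
       | rule branch_false, (simp; fail) | (simp add: unroll[of i]; fail))+)
      then show ?thesis using F' unfolding sum distrib_left by blast
    qed
  qed
qed

text \<open>
  The cost of walking along the row of \<open>x\<close> is charged to \<open>x\<close> itself, since the side of \<open>x\<close> has one more element than
  the sides of its children together.
\<close>
lemma loop_node:
  assumes "(x, p) \<in> E"
  shows "solved x p (trow x 0) (at_node x) Atom (beyond x p) (cNode K B * card (side E x p))"
  using assms
proof (induction rule: side_induct)
  case (step x p)
  have xp: "x < m" "p < m" using step.hyps sub by auto
  have U: "union_of x (nbrs x \<inter> {..<0} - {p}) = at_node x" by (simp add: union_of_def)
  have le: "cRow K B * (m - 0 + 1) + cNode K B * (\<Sum>y\<in>nbrs x \<inter> {0..} - {p}. card (side E y x))
      \<le> cNode K B * card (side E x p)"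
  proof -
    have "cRow K B * (m - 0 + 1) \<le> cNode K B"
      unfolding cNode_def using m_le by (simp add: trans_le_add1)
    moreover have "nbrs x \<inter> {0..} = nbrs x" by auto
    ultimately show ?thesis using card_side[of x p] xp by simp
  qed
  show ?case
    using loop_row[OF xp step.IH, of 0] call_mono[OF _ le]
    unfolding solved_def U beyond_unfold[of x p] by fastforce
qed

lemma loop_root:
  assumes x: "0 < m"
  shows "\<exists>F. call DD LOOP [ctx, Tmat, Lseq, trow 0 0, Atom, Atom, Atom, Dot (vec (at_node 0)) (sets [{}, at_node 0])]
      (Dot (vec {..<n}) (sets F)) (cNode K B * (B + 1)) \<and> represents F {..<n} \<and> length F \<le> B"
proof -
  have child: "solved y 0 (trow y 0) (at_node y) Atom (beyond y 0) (cNode K B * card (side E y 0))"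
    if "(0, y) \<in> E" for y
    using loop_node[of y 0] that symE[of 0 y] by simp
  have nb: "nbrs 0 - {0} = nbrs 0" using irrefl by auto
  have at_node: "represents [{}, at_node 0] (at_node 0)" "length [{}, at_node 0] \<le> B"
    using represents_single[OF at_single] B2 by (auto simp: at_node_def)
  have U: "union_of 0 (nbrs 0 \<inter> {..<0} - {0}) = at_node 0" by (simp add: union_of_def)
  have le: "cRow K B * (m - 0 + 1) + cNode K B * (\<Sum>y\<in>nbrs 0 \<inter> {0..} - {0}. card (side E y 0))
      \<le> cNode K B * (B + 1)"
  proof -
    have 1: "cRow K B * (m - 0 + 1) \<le> cNode K B"
      unfolding cNode_def using m_le by (simp add: trans_le_add1)
    have nb': "nbrs 0 \<inter> {0..} - {0} = nbrs 0" using nb by auto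
    have "(\<Sum>y\<in>nbrs 0. card (side E y 0)) = card (UNIV \<inter> (\<Union>y\<in>nbrs 0. side E y 0))"
      using card_children[of "nbrs 0" 0 UNIV] x by simp
    also have "\<dots> \<le> card {..<m}"
    proof (rule card_mono)
      have "(\<Union>y\<in>nbrs 0. side E y 0) \<subseteq> {..<m}" using all_unfold[of 0] x by blast
      then show "UNIV \<inter> (\<Union>y\<in>nbrs 0. side E y 0) \<subseteq> {..<m}" by simp
    qed simp
    finally have "(\<Sum>y\<in>nbrs 0. card (side E y 0)) \<le> B" using m_le by simp
    then have "cNode K B * (\<Sum>y\<in>nbrs 0. card (side E y 0)) \<le> cNode K B * B" by (rule mult_le_mono2)
    from add_mono[OF 1 this] show ?thesis unfolding nb' by (simp only: distrib_left mult_1_right add.commute)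
  qed
  have "solved 0 0 (trow 0 0) (at_node 0) (enc_nat 0) (union_of 0 (nbrs 0 - {0}))
      (cRow K B * (m - 0 + 1) + cNode K B * (\<Sum>y\<in>nbrs 0 \<inter> {0..} - {0}. card (side E y 0)))"
    using loop_row[OF x x, of 0, unfolded U] child by blast
  then obtain F where F: "call DD LOOP [ctx, Tmat, Lseq, trow 0 0, enc_nat 0, enc_nat 0, enc_nat 0,
        Dot (vec (at_node 0)) (sets [{}, at_node 0])]
      (Dot (vec (union_of 0 (nbrs 0 - {0}))) (sets F))
      (cRow K B * (m - 0 + 1) + cNode K B * (\<Sum>y\<in>nbrs 0 \<inter> {0..} - {0}. card (side E y 0)))"
    "represents F (union_of 0 (nbrs 0 - {0}))" "length F \<le> B"
    unfolding solved_def using at_node by blast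
  have U: "union_of 0 (nbrs 0 - {0}) = {..<n}" unfolding nb by (rule union_of_root[OF x])
  have "call DD LOOP [ctx, Tmat, Lseq, trow 0 0, Atom, Atom, Atom, Dot (vec (at_node 0)) (sets [{}, at_node 0])]
      (Dot (vec {..<n}) (sets F)) (cNode K B * (B + 1))"
    using call_mono[OF F(1) le] by (simp only: U enc_simps)
  then show ?thesis using F(2,3) unfolding U by blast
qed

end

section \<open>The complete program\<close>

lemma grow_near:
  assumes "E \<subseteq> {..<n} \<times> {..<n}"
  shows "(grow n (\<lambda>v. {u. (v, u) \<in> E}) ^^ k) (\<lambda>v. {v}) = (\<lambda>v. near E k `` {v})"
proof (induction k)
  case 0 show ?case by (auto simp: near_def)
next
  case (Suc k)
  have "E `` {v} = {u. (v, u) \<in> E} \<inter> {0..<n}" for v using assms by auto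
  then have "grow n (\<lambda>v. {u. (v, u) \<in> E}) (\<lambda>v. near E k `` {v}) v = near E (Suc k) `` {v}" for v
    by (simp only: grow_def near_Suc)
  then show ?case by (simp add: Suc.IH fun_eq_iff)
qed

definition "cSolve k B = ((40 * B + 90) * (B + 1) + 30) * (B + 1) + (cStep B * (B + 1) + 60) * (k + 1)
  + (30 * (B + 1) + 30) * (B + 1) + 90 * (B + 1) + k + cStart B + cNode k B * (B + 1)
  + cMerge k B * (B + 1) + 300"

context tree_dp
begin

lemma solve:
  fixes EG :: "nat rel"
  assumes EG: "EG \<subseteq> {..<n} \<times> {..<n}" and N: "\<And>out v. v < n \<Longrightarrow> N out v = ball EG r out v"
    and pos: "0 < n" "0 < m"
  shows "\<exists>F. represents F {..<n} \<and>
    ev DD [Dot (gseg 0 n (\<lambda>v. gseg 0 n (\<lambda>u. enc_bool ((v, u) \<in> EG)))) (Dot Tmat (Dot Lseq Atom))] main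
      (case candidates {..<n} {} F [{}] of [] \<Rightarrow> Atom | X # _ \<Rightarrow> Dot Atom (vec X)) (cSolve K B)"
proof -
  let ?G = "gseg 0 n (\<lambda>v. gseg 0 n (\<lambda>u. enc_bool ((v, u) \<in> EG)))"
  define inp where "inp = Dot ?G (Dot Tmat (Dot Lseq Atom))"
  have inp: "car inp = ?G" "car (cdr inp) = Tmat" "car (cdr (cdr inp)) = Lseq"
    by (simp_all add: inp_def)
  have idn: "call DD IDENT [Lseq, Lseq] (units 0) (((40 * B + 90) * (B + 1) + 30) * (B + 1))"
  proof (rule call_mono)
    show "call DD IDENT [Lseq, Lseq] (units 0) (((40 * B + 90) * (n + 1) + 30) * (n - 0 + 1))"
      unfolding vec_def by (rule ident) (use L_less m_le L_inj in \<open>auto intro: less_imp_le order.trans\<close>)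
    show "((40 * B + 90) * (n + 1) + 30) * (n - 0 + 1) \<le> ((40 * B + 90) * (B + 1) + 30) * (B + 1)"
      by (rule mult_le_mono) (use n_le in simp_all)
  qed
  have M: "mat True = gseg 0 n (\<lambda>v. vseg 0 n (near EG r `` {v}))"
    unfolding mat_def gseg_def
    by (intro arg_cong[where f = enc_list] map_cong refl) (simp add: N ball_def)
  have bl: "call DD BALLS [enc_nat r, ?G, units 0] (mat True) ((cStep B * (B + 1) + 60) * (K + 1))"
  proof (rule call_mono)
    show "call DD BALLS [enc_nat r, ?G, units 0] (mat True) ((cStep n * (n + 1) + 60) * (r + 1))"
      using balls[of r d C g r n "\<lambda>v. {u. (v, u) \<in> EG}" "\<lambda>v. {v}"] unfolding M vec_def grow_near[OF EG] mem_Collect_eq .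
    have "cStep n \<le> cStep B" by (intro add_mono mult_le_mono) (use n_le in simp_all)
    then show "(cStep n * (n + 1) + 60) * (r + 1) \<le> (cStep B * (B + 1) + 60) * (K + 1)"
      by (intro mult_le_mono add_mono) (use n_le in \<open>simp_all add: kappa_def\<close>)
  qed
  have tr: "call DD TRANSPOSE [mat True] (mat False) ((30 * (B + 1) + 30) * (B + 1))"
  proof (rule call_mono)
    have "gseg 0 n (\<lambda>u. gseg 0 n (\<lambda>v. enc_bool (u \<in> near EG r `` {v}))) = mat False"
      unfolding mat_def gseg_def
      by (intro arg_cong[where f = enc_list] map_cong refl) (simp add: N ball_def)
    then show "call DD TRANSPOSE [mat True] (mat False) ((30 * (n + 1) + 30) * (n - 0 + 1))"
      using transpose[of r d C g 0 n "\<lambda>v u. enc_bool (u \<in> near EG r `` {v})"] pos(1) unfolding M by simp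
    show "(30 * (n + 1) + 30) * (n - 0 + 1) \<le> (30 * (B + 1) + 30) * (B + 1)"
      by (rule mult_le_mono) (use n_le in simp_all)
  qed
  have M0: "car (mat True) = vec (N True 0)" using pos(1) by (simp add: mat_def vec_def)
  have ng: "call DD NEG [vec X] (vec ({..<n} - X)) (30 * (B + 1))" for X
    unfolding vec_def by (rule call_mono[OF neg]) (use n_le in simp)
  have empty: "{..<n} - (X \<union> ({..<n} - X)) = {}" for X by auto
  note ng0 = ng[of "X \<union> ({..<n} - X)" for X, unfolded empty]
  obtain F where F: "call DD LOOP [ctx, Tmat, Lseq, trow 0 0, Atom, Atom, Atom,
        Dot (vec (at_node 0)) (Dot (vec {}) (Dot (vec (at_node 0)) Atom))]
      (Dot (vec {..<n}) (sets F)) (cNode K B * (B + 1))" "represents F {..<n}" "length F \<le> B"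
    using loop_root[OF pos(2)] by auto
  have st: "call DD START [ctx, Lseq, Atom] (Dot (vec (at_node 0)) (Dot (vec {}) (Dot (vec (at_node 0)) Atom))) (cStart B)"
    using start_call[OF pos(2)] by simp
  define R where "R = candidates {..<n} {} F [{}]"
  have fewV: "few {..<n} B"
    using few_mono[OF few_union_of(1)[OF pos(2) order_refl] q_B] unfolding union_of_root[OF pos(2)] .
  have "call DD MERGE [ctx, vec {..<n}, vec {..<n}, vec {}, sets F, sets [{}], sets []] (sets R)
      (cMerge K B * (length F + 1))"
    unfolding R_def candidates_def
    by (rule merge) (use fewV represents_sub[OF F(2)] B2 in \<open>auto simp: unions_def\<close>)
  then have mg: "call DD MERGE [ctx, vec {..<n}, vec {..<n}, vec {}, sets F, Dot (vec {}) Atom, Atom] (sets R)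
      (cMerge K B * (B + 1))"
    by - (rule call_mono, simp, use F(3) in simp)
  have ctx_Dot: "Dot (mat True) (Dot (mat False) (Dot (vec {}) (units 0))) = ctx"
    by (simp add: ctx_def)
  have T0: "car Tmat = trow 0 0" using pos(2) by simp
  let ?out = "case R of [] \<Rightarrow> Atom | X # _ \<Rightarrow> Dot Atom (vec X)"
  have s5: "call DD SOLVE5 [sets R] ?out 20"
    by (cases R; hypsubst, (rule callI, rule bodies_nth, simp, unfold solve5_body_def,
      (rule ev_rules | rule branch_true, (simp; fail)
       | rule branch_false, (simp; fail) | (simp; fail))+))
  have s4: "call DD SOLVE4 [ctx, Dot (vec {..<n}) (sets F)] ?out (cMerge K B * (B + 1) + 60)"
    by (rule callI, rule bodies_nth, simp, unfold solve4_body_def,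
      (rule ev_rules mg s5 | rule branch_true, (simp; fail)
       | rule branch_false, (simp; fail) | (simp; fail))+)
  have s3: "call DD SOLVE3 [inp, ctx] ?out (cMerge K B * (B + 1) + cNode K B * (B + 1) + cStart B + 120)"
    by (rule callI, rule bodies_nth, simp, unfold solve3_body_def,
      (rule ev_rules F(1) st s4 | rule branch_true, (simp; fail)
       | rule branch_false, (simp; fail) | (simp add: inp T0; fail))+)
  have s2: "call DD SOLVE2 [inp, units 0, mat True] ?out ((30 * (B + 1) + 30) * (B + 1) + 90 * (B + 1) +
      cMerge K B * (B + 1) + cNode K B * (B + 1) + cStart B + 200)"
    by (rule callI, rule bodies_nth, simp, unfold solve2_body_def,
      (rule ev_rules tr ng0 ng union_B s3[folded ctx_Dot] | rule branch_true, (simp; fail)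
       | rule branch_false, (simp; fail) | (simp add: M0; fail))+)
  have er: "esize (enc_nat r) \<le> K" by (simp add: kappa_def)
  have s1: "call DD SOLVE1 [inp, units 0] ?out ((cStep B * (B + 1) + 60) * (K + 1) + K +
      (30 * (B + 1) + 30) * (B + 1) + 90 * (B + 1) +
      cMerge K B * (B + 1) + cNode K B * (B + 1) + cStart B + 250)"
    using er by - (rule callI, rule bodies_nth, simp, unfold solve1_body_def,
      (rule ev_rules ev_const bl s2 | rule branch_true, (simp; fail)
       | rule branch_false, (simp; fail) | (simp add: inp; fail))+)
  have "ev DD [inp] main ?out (cSolve K B)"
    unfolding main_def
    by (rule ev_mono, (rule ev_rules idn s1 | (simp add: inp; fail))+, simp add: cSolve_def)
  then show ?thesis using F(2) unfolding inp_def R_def by blast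
qed

end

section \<open>Polynomial bounds\<close>

definition poly_bounded :: "(nat \<Rightarrow> nat) \<Rightarrow> bool" where
  "poly_bounded f \<longleftrightarrow> (\<exists>c k. \<forall>B. f B \<le> c * (B + 1) ^ k)"

lemma poly_bounded_const: "poly_bounded (\<lambda>_. a)"
  unfolding poly_bounded_def by (intro exI[of _ a] exI[of _ 0]) simp

lemma poly_bounded_id: "poly_bounded (\<lambda>B. B)"
  unfolding poly_bounded_def by (intro exI[of _ 1]) simp

lemma poly_bounded_add:
  assumes "poly_bounded f" "poly_bounded h"
  shows "poly_bounded (\<lambda>B. f B + h B)"
proof -
  obtain c k c' k' where f: "\<And>B. f B \<le> c * (B + 1) ^ k" and h: "\<And>B. h B \<le> c' * (B + 1) ^ k'"
    using assms unfolding poly_bounded_def by blast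
  have "f B + h B \<le> (c + c') * (B + 1) ^ (k + k')" for B
  proof -
    have "c * (B + 1) ^ k \<le> c * (B + 1) ^ (k + k')" "c' * (B + 1) ^ k' \<le> c' * (B + 1) ^ (k + k')"
      by (intro mult_le_mono2 power_increasing; simp)+
    then show ?thesis using f[of B] h[of B] by (simp only: distrib_right)
  qed
  then show ?thesis unfolding poly_bounded_def by blast
qed

lemma poly_bounded_mult:
  assumes "poly_bounded f" "poly_bounded h"
  shows "poly_bounded (\<lambda>B. f B * h B)"
proof -
  obtain c k c' k' where f: "\<And>B. f B \<le> c * (B + 1) ^ k" and h: "\<And>B. h B \<le> c' * (B + 1) ^ k'"
    using assms unfolding poly_bounded_def by blast
  have "f B * h B \<le> (c * c') * (B + 1) ^ (k + k')" for B
  proof -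
    have "c * (B + 1) ^ k * (c' * (B + 1) ^ k') = (c * c') * (B + 1) ^ (k + k')"
      unfolding power_add by (simp only: mult.commute mult.left_commute)
    then show ?thesis using mult_le_mono[OF f[of B] h[of B]] by (simp only:)
  qed
  then show ?thesis unfolding poly_bounded_def by blast
qed

lemmas poly_bounded_intros = poly_bounded_add poly_bounded_mult poly_bounded_const poly_bounded_id

lemma poly_bounded_cSolve: "poly_bounded (cSolve k)"
proof -
  have "poly_bounded (\<lambda>B. cSolve k B)"
    unfolding cSolve_def cNode_def cRow_def cStart_def cJoin_def cZloop_def cReps_def cMerge_def
      cMergeY_def cOffer_def cInsert_def cSat_def cEquiv_def
    by (intro poly_bounded_intros)
  then show ?thesis .
qed

text \<open>
  Membership in a finite or cofinite set is constant from some point on.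
\<close>
lemma finite_or_cofinite_capped:
  fixes \<sigma> :: "nat set"
  assumes "finite \<sigma> \<or> finite (- \<sigma>)"
  shows "\<exists>d0. \<forall>d\<ge>d0. \<forall>k. min d k \<in> \<sigma> \<longleftrightarrow> k \<in> \<sigma>"
proof -
  obtain d0 b where d0: "\<And>k. d0 \<le> k \<Longrightarrow> (k \<in> \<sigma>) = b"
  proof -
    from assms obtain \<tau> b where "finite \<tau>" and \<tau>: "\<And>k. (k \<in> \<sigma>) = ((k \<in> \<tau>) \<noteq> b)"
      by (metis Compl_iff)
    then obtain d0 where "\<forall>k\<in>\<tau>. k < d0" using finite_nat_set_iff_bounded by blast
    then have "(k \<in> \<sigma>) = b" if "d0 \<le> k" for k using \<tau>[of k] that leD by blast
    then show ?thesis by (rule that)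
  qed
  have "min d k \<in> \<sigma> \<longleftrightarrow> k \<in> \<sigma>" if "d0 \<le> d" for d k
  proof (cases "k \<le> d")
    case True
    then show ?thesis by (simp add: min_absorb2)
  next
    case False
    then have "min d k = d" "d0 \<le> k" using that by simp_all
    then show ?thesis using d0[OF that] d0[of k] by simp
  qed
  then show ?thesis by blast
qed

section \<open>Branch decompositions of digraphs\<close>

lemma out_degree_nbrs: "out_degree (with_proj T) x = card {y. (x, y) \<in> parcs T}"
proof -
  have "out_arcs (with_proj T) x = {e \<in> parcs T. fst e = x}"
    by (simp add: out_arcs_def)
  also have "\<dots> = Pair x ` {y. (x, y) \<in> parcs T}"
  proof (intro equalityI subsetI)
    fix e assume "e \<in> {e \<in> parcs T. fst e = x}"
    then have "e = Pair x (snd e)" "snd e \<in> {y. (x, y) \<in> parcs T}" by auto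
    then show "e \<in> Pair x ` {y. (x, y) \<in> parcs T}" by (rule image_eqI)
  qed auto
  also have "card \<dots> = card {y. (x, y) \<in> parcs T}" by (rule card_image) (rule inj_onI, simp)
  finally show ?thesis unfolding out_degree_def .
qed

text \<open>
  Every set that occurs in the traversal is empty, everything, a side of the cut of a tree edge, or
  the complement of such a side, and \<open>bimim\<close> does not distinguish a set from its complement. The reason
  is that a node carries at most three pieces: a leaf has its vertex and one
  neighbour, an inner node has three neighbours and no vertex. So at least two pieces cannot be
  absent together with at least two being present.
\<close>
lemma bimim_pieces:
  assumes G: "pair_fin_digraph G" and dec: "branch_decomposition G T L"
    and x: "x \<in> pverts T" and Z: "Z \<subseteq> {y. (x, y) \<in> parcs T}"
  shows "bimim G ({v \<in> pverts G. L v = x} \<union>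
      (\<Union>z\<in>Z. {v \<in> pverts G. L v \<in> side (parcs T) z x})) \<le> bimim_width G T L"
    (is "bimim G ?U \<le> ?w")
proof -
  have T: "undirected_tree T" and deg: "\<And>y. y \<in> pverts T - leaves T \<Longrightarrow> out_degree (with_proj T) y = 3"
    and bij: "bij_betw L (pverts G) (leaves T)"
    using dec by (auto simp: branch_decomposition_def subcubic_tree_def)
  interpret tree_rel "parcs T" "pverts T" by (rule tree_rel_of_tree[OF T])
  have wfT: "pair_wf_digraph T" and finT: "finite (parcs T)"
    using T by (auto simp: undirected_tree_def pair_graph_def pair_digraph_def pair_fin_digraph_def
        pair_fin_digraph_axioms_def)
  define P where "P = {v \<in> pverts G. L v = x}"
  define S where "S z = {v \<in> pverts G. L v \<in> side (parcs T) z x}" for z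
  have U: "?U = P \<union> (\<Union>z\<in>Z. S z)" by (simp add: P_def S_def)
  have LT: "L v \<in> pverts T" if "v \<in> pverts G" for v
    using bij that by (auto simp: bij_betw_def leaves_def)
  have V: "pverts G = P \<union> (\<Union>z\<in>nbrs x. S z)"
  proof -
    have "L v = x \<or> (\<exists>y\<in>nbrs x. L v \<in> side (parcs T) y x)" if "v \<in> pverts G" for v
      using all_unfold[OF x] LT[OF that] by blast
    then show ?thesis by (auto simp: P_def S_def)
  qed
  have S: "bimim G (S z) \<le> ?w" if "z \<in> nbrs x" for z
  proof -
    have zx: "(z, x) \<in> parcs T" using that symE by blast
    then have "z \<in> pverts T" using sub by auto
    then have "S z = cut_side G T L (z, x)" using cut_side_eq_side[OF wfT, of z G L x] by (simp add: S_def)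
    then show ?thesis unfolding bimim_width_def using zx finT by (intro Max_ge) auto
  qed
  have SV: "S z \<subseteq> pverts G" for z by (auto simp: S_def)
  have dP: "P \<inter> S z = {}" if "z \<in> nbrs x" for z
    using side_not_parent that by (auto simp: P_def S_def)
  have dS: "S z \<inter> S y = {}" if "z \<in> nbrs x" "y \<in> nbrs x" "z \<noteq> y" for z y
    using sides_disjoint[of x z y] that by (auto simp: S_def)
  show ?thesis
  proof (cases "Z = nbrs x")
    case True
    then have "?U = pverts G" using U V by simp
    then show ?thesis using bimim_complement[of "{}" G] bimim_empty[of G] by simp
  next
    case False
    then obtain c where c: "c \<in> nbrs x" "c \<notin> Z" using Z by blast
    show ?thesis
    proof (cases "nbrs x = insert c Z")
      case True
      have "S c \<inter> (P \<union> (\<Union>z\<in>Z. S z)) = {}" using dP[OF c(1)] dS[OF _ c(1)] c(2) Z by blast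
      moreover have "pverts G = S c \<union> (P \<union> (\<Union>z\<in>Z. S z))" using V unfolding True by blast
      ultimately have "?U = pverts G - S c" unfolding U by blast
      then show ?thesis using bimim_complement[OF SV, of c] S[OF c(1)] by simp
    next
      case no: False
      have sub2: "insert c Z \<subset> nbrs x" using no c Z by blast
      then have lt: "card (insert c Z) < card (nbrs x)" using finite_nbrs psubset_card_mono by blast
      have finZ: "finite Z" using Z finite_nbrs finite_subset by blast
      have "card (nbrs x) = 3 \<and> x \<notin> leaves T"
      proof (cases "x \<in> leaves T")
        case True
        then have "card (nbrs x) = 1" by (simp add: leaves_def out_degree_nbrs)
        then show ?thesis using lt c(2) finZ by simp
      next
        case False
        then show ?thesis using deg[of x] x by (simp add: out_degree_nbrs)
      qed
      then have "card Z \<le> 1" "P = {}" using lt c(2) finZ bij by (auto simp: P_def bij_betw_def)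
      then consider "Z = {}" | z where "Z = {z}"
        using finZ by (metis One_nat_def card_0_eq card_1_singletonE le_Suc_eq le_zero_eq)
      then show ?thesis
      proof cases
        case 1
        then show ?thesis unfolding U using \<open>P = {}\<close> by (simp add: bimim_empty)
      next
        case 2
        then show ?thesis unfolding U using \<open>P = {}\<close> S[of z] Z by simp
      qed
    qed
  qed
qed

text \<open>
  The four sets of the problem, selected by direction and by membership in the solution.
\<close>
definition requirement :: "nat set \<Rightarrow> nat set \<Rightarrow> nat set \<Rightarrow> nat set \<Rightarrow> bool \<Rightarrow> bool \<Rightarrow> nat \<Rightarrow> bool" where
  "requirement \<sigma>p \<sigma>m \<rho>p \<rho>m out b k \<longleftrightarrow>
     k \<in> (if out then (if b then \<sigma>p else \<rho>p) else (if b then \<sigma>m else \<rho>m))"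

lemma dist_feasible_iff_sat:
  assumes G: "pair_wf_digraph G" "pverts G = {..<n}"
    and cr: "capped_rows d (requirement \<sigma>p \<sigma>m \<rho>p \<rho>m)"
  shows "dist_feasible r \<sigma>p \<sigma>m \<rho>p \<rho>m G S \<longleftrightarrow> S \<subseteq> {..<n} \<and>
    capped_rows.sat (ball (parcs G) r) (requirement \<sigma>p \<sigma>m \<rho>p \<rho>m) {..<n} S"
proof (cases "S \<subseteq> {..<n}")
  case True
  interpret capped_rows n d "ball (parcs G) r" "requirement \<sigma>p \<sigma>m \<rho>p \<rho>m" g for g by (rule cr)
  have "out_ball G r v \<inter> S = ball (parcs G) r True v \<inter> S"
    "in_ball G r v \<inter> S = ball (parcs G) r False v \<inter> S" if "v < n" for v
    using digraph_dist_le_iff[OF G(1)] that True G(2)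
    by (auto simp: out_ball_def in_ball_def ball_def near_def)
  then show ?thesis using True G(2)
    by (auto simp: dist_feasible_def sat_def requirement_def all_bool_eq)
next
  case False
  then show ?thesis using G(2) by (simp add: dist_feasible_def)
qed

theorem theorem2:
  fixes r :: nat and \<sigma>p \<sigma>m \<rho>p \<rho>m :: "nat set" and g :: goal
  assumes "finite \<sigma>p \<or> finite (- \<sigma>p)"
    and "finite \<sigma>m \<or> finite (- \<sigma>m)"
    and "finite \<rho>p \<or> finite (- \<rho>p)"
    and "finite \<rho>m \<or> finite (- \<rho>m)"
  shows "\<exists>(f :: nat \<Rightarrow> nat) (P :: prog) (c :: nat).
    \<forall>(G :: nat pair_pre_digraph) (T :: nat pair_pre_digraph) (L :: nat \<Rightarrow> nat) (n :: nat) (w :: nat).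
      pair_fin_digraph G \<and> standard_verts G \<and> card (pverts G) = n \<and>
      standard_verts T \<and> branch_decomposition G T L \<and> bimim_width G T L = w \<longrightarrow>
      (\<exists>ans t. runs P (enc_instance G T L) (enc_answer n ans) t \<and>
               correct_answer g (dist_feasible r \<sigma>p \<sigma>m \<rho>p \<rho>m G) ans \<and>
               t \<le> c * n ^ f w)"
proof -
  define C where "C = requirement \<sigma>p \<sigma>m \<rho>p \<rho>m"
  obtain d1 d2 d3 d4 where d:
    "\<forall>d\<ge>d1. \<forall>k. min d k \<in> \<sigma>p \<longleftrightarrow> k \<in> \<sigma>p" "\<forall>d\<ge>d2. \<forall>k. min d k \<in> \<sigma>m \<longleftrightarrow> k \<in> \<sigma>m"
    "\<forall>d\<ge>d3. \<forall>k. min d k \<in> \<rho>p \<longleftrightarrow> k \<in> \<rho>p" "\<forall>d\<ge>d4. \<forall>k. min d k \<in> \<rho>m \<longleftrightarrow> k \<in> \<rho>m"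
    using assms[THEN finite_or_cofinite_capped] by blast
  define d where "d = d1 + d2 + d3 + d4"
  have ge: "d1 \<le> d" "d2 \<le> d" "d3 \<le> d" "d4 \<le> d" by (simp_all add: d_def)
  have cap: "C out b (min d k) \<longleftrightarrow> C out b k" for out b k
    using d(1)[rule_format, OF ge(1), of k] d(2)[rule_format, OF ge(2), of k]
      d(3)[rule_format, OF ge(3), of k] d(4)[rule_format, OF ge(4), of k]
    unfolding C_def requirement_def by (cases out; cases b) simp_all
  have cr: "capped_rows d C" by unfold_locales (rule cap)
  obtain c e where ce: "\<And>B. cSolve (kappa r d C) B \<le> c * (B + 1) ^ e"
    using poly_bounded_cSolve[of "kappa r d C"] unfolding poly_bounded_def by blast
  \<comment> \<open>For \<open>n \<ge> 2\<close> we have \<open>n + 1 \<le> n\<^sup>2\<close>, hence \<open>B + 1 \<le> n ^ (4 * (d * (r * w)) + 4)\<close> for the \<open>B\<close> below.\<close>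
  define f where "f w = (4 * (d * (r * w)) + 4) * e" for w
  define P where "P = (bodies r d C g, main)"
  have "\<exists>ans t. runs P (enc_instance G T L) (enc_answer n ans) t \<and>
      correct_answer g (dist_feasible r \<sigma>p \<sigma>m \<rho>p \<rho>m G) ans \<and> t \<le> c * n ^ f w"
    if inst: "pair_fin_digraph G" "standard_verts G" "card (pverts G) = n" "standard_verts T"
      "branch_decomposition G T L" "bimim_width G T L = w" for G T L n w
  proof -
    interpret G: pair_fin_digraph G by (rule inst(1))
    define m where "m = card (pverts T)"
    have VG: "pverts G = {..<n}" and VT: "pverts T = {..<m}"
      using inst(2-4) by (simp_all add: standard_verts_def m_def)
    have T: "undirected_tree T" "2 \<le> m" and bij: "bij_betw L {..<n} (leaves T)"
      and deg3: "\<And>x. x \<in> pverts T - leaves T \<Longrightarrow> out_degree (with_proj T) x = 3"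
      using inst(5) VG by (auto simp: branch_decomposition_def subcubic_tree_def m_def)
    interpret T: tree_rel "parcs T" "{..<m}" using tree_rel_of_tree[OF T(1)] unfolding VT .
    have leaves: "leaves T = {x \<in> {..<m}. card (T.nbrs x) = 1}"
      by (simp add: leaves_def out_degree_nbrs VT)
    have deg: "card (T.nbrs x) = 1 \<or> card (T.nbrs x) = 3" if "x \<in> {..<m}" for x
      using deg3[of x] that unfolding leaves VT out_degree_nbrs by blast
    have "(0, 1) \<in> (parcs T)\<^sup>*" by (rule T.conn) (use T(2) in simp_all)
    then have "(0, 1) \<in> (parcs T)\<^sup>+" using rtranclD zero_neq_one by metis
    then obtain p where p: "(0, p) \<in> parcs T" using tranclD by metis
    have card_leaves: "card {x \<in> {..<m}. card (T.nbrs x) = 1} = n"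
      using bij_betw_same_card[OF bij] unfolding leaves card_lessThan by (rule sym)
    have m_n: "m \<le> 2 * n" and n2: "2 \<le> n"
      using T.card_le_leaves[OF deg p] unfolding card_leaves card_lessThan by blast+
    define q where "q = (n + 1) ^ (d * (r * w))"
    \<comment> \<open>\<open>q * q\<close> bounds a table, one set for each pair of classes on both sides; \<open>2 * n\<close> bounds the tree.\<close>
    define B where "B = q * q + 2 * n + 2"
    interpret capped_rows n d "ball (parcs G) r" C g by (rule cr)
    have EG: "parcs G \<subseteq> {..<n} \<times> {..<n}"
      using G.in_arcsD1 G.in_arcsD2 unfolding VG by auto
    have few: "few A q" if A: "A \<subseteq> {..<n}" "bimim G A \<le> w" for A
    proof (rule few_of_small[OF A(1)])
      show "\<exists>R\<subseteq>X. card R \<le> d * (r * bimim G A) \<and> eqv A R X" if "X \<subseteq> A" for X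
        using capped_balls_subset[OF inst(1) A(1)[folded VG] that, of d r]
        unfolding eqv_def VG by blast
      have "d * (r * bimim G A) \<le> d * (r * w)" using A(2) by simp
      then show "(n + 1) ^ (d * (r * bimim G A)) \<le> q" unfolding q_def by (rule power_increasing) simp
    qed
    have "tree_dp n d (ball (parcs G) r) C B (parcs T) m L q"
    proof (unfold_locales)
      show "ball (parcs G) r out v \<subseteq> {..<n}" if "v < n" for v out
        by (rule ball_sub[OF EG]) (use that in simp)
      show "n \<le> B" "2 \<le> B" "m \<le> B" "q * q \<le> B" using m_n by (simp_all add: B_def)
      show "1 \<le> q" by (simp add: q_def)
      show "L v < m" if "v < n" for v using bij_betwE[OF bij] that by (auto simp: leaves)
      show "inj_on L {..<n}" using bij by (simp add: bij_betw_def)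
      fix x Z assume xZ: "x < m" "Z \<subseteq> T.nbrs x"
      let ?U = "{v \<in> {..<n}. L v = x} \<union> (\<Union>z\<in>Z. {v \<in> {..<n}. L v \<in> side (parcs T) z x})"
      have U: "bimim G ?U \<le> w"
        using bimim_pieces[OF inst(1,5), of x Z] xZ inst(6) by (simp only: VG VT lessThan_iff)
      have sub: "?U \<subseteq> {..<n}" by auto
      show "few ?U q \<and> few ({..<n} - ?U) q"
        using few[OF sub U] few[OF Diff_subset, of ?U] bimim_complement[of ?U G] sub U
        by (simp only: VG)
    qed
    then interpret tree_dp n d "ball (parcs G) r" C g r B "parcs T" m L q .
    obtain F where F: "represents F {..<n}"
      and run: "ev DD [Dot (gseg 0 n (\<lambda>v. gseg 0 n (\<lambda>u. enc_bool ((v, u) \<in> parcs G))))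
        (Dot Tmat (Dot Lseq Atom))] main
        (case candidates {..<n} {} F [{}] of [] \<Rightarrow> Atom | X # _ \<Rightarrow> Dot Atom (vec X)) (cSolve K B)"
      using solve[OF EG refl] n2 T(2) by auto
    define R where "R = candidates {..<n} {} F [{}]"
    define ans where "ans = (case R of [] \<Rightarrow> None | X # _ \<Rightarrow> Some X)"
    have inp: "Dot (gseg 0 n (\<lambda>v. gseg 0 n (\<lambda>u. enc_bool ((v, u) \<in> parcs G)))) (Dot Tmat (Dot Lseq Atom))
        = enc_instance G T L"
      by (simp add: enc_instance_def enc_digraph_def gseg_def inst(3) m_def Let_def)
    have out: "(case R of [] \<Rightarrow> Atom | X # _ \<Rightarrow> Dot Atom (vec X)) = enc_answer n ans"
      by (simp add: ans_def enc_answer_def vec_def gseg_def split: list.split)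
    obtain t where t: "runs P (enc_instance G T L) (enc_answer n ans) t" "t \<le> cSolve K B"
      using run unfolding inp R_def[symmetric] out ev_def runs_def P_def by auto
    have feas: "dist_feasible r \<sigma>p \<sigma>m \<rho>p \<rho>m G S \<longleftrightarrow> S \<subseteq> {..<n} \<and> sat {..<n} S" for S
      using dist_feasible_iff_sat[OF G.pair_wf_digraph_axioms VG cr[unfolded C_def]] unfolding C_def .
    have "correct_answer g (dist_feasible r \<sigma>p \<sigma>m \<rho>p \<rho>m G) ans"
    proof (cases R)
      case Nil
      then show ?thesis using final_candidates(1)[OF F, folded R_def]
        by (auto simp: ans_def correct_answer_def feas)
    next
      case (Cons X Xs)
      have "X \<subseteq> {..<n} \<and> sat {..<n} X \<and> (S \<subseteq> {..<n} \<longrightarrow> sat {..<n} S \<longrightarrow> pref g X S)" for S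
        using final_candidates(2)[OF F, folded R_def, OF Cons] .
      then show ?thesis using Cons
        by (auto simp: ans_def correct_answer_def optimal_def feas pref_def)
    qed
    moreover have "t \<le> c * n ^ f w"
    proof -
      let ?k = "d * (r * w)"
      have "2 * n \<le> n * n" using n2 by (rule mult_le_mono1)
      then have "n + 1 \<le> n ^ 2" unfolding power2_eq_square using n2 by linarith
      then have "q \<le> (n ^ 2) ^ ?k" unfolding q_def by (rule power_mono) simp
      then have "q * q \<le> (n ^ 2) ^ ?k * (n ^ 2) ^ ?k" by (rule mult_le_mono) fact
      also have "\<dots> = n ^ (4 * ?k)" by (simp flip: power_mult power_add)
      also have "\<dots> \<le> n ^ (4 * ?k + 3)" by (rule power_increasing) (use n2 in simp_all)
      finally have 1: "q * q \<le> n ^ (4 * ?k + 3)" .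
      have "2 * n + 3 \<le> n ^ 3"
      proof -
        have "2 * 2 * n \<le> n * n * n" by (intro mult_le_mono order_refl n2)
        then show ?thesis unfolding power3_eq_cube using n2 by linarith
      qed
      also have "\<dots> \<le> n ^ (4 * ?k + 3)" by (rule power_increasing) (use n2 in simp_all)
      finally have "B + 1 \<le> 2 * n ^ (4 * ?k + 3)" using 1 by (simp add: B_def)
      also have "\<dots> \<le> n * n ^ (4 * ?k + 3)" using n2 by (rule mult_le_mono1)
      also have "\<dots> = n ^ (4 * ?k + 4)" by (simp add: eval_nat_numeral)
      finally have "(B + 1) ^ e \<le> (n ^ (4 * ?k + 4)) ^ e" by (rule power_mono) simp
      then have "(B + 1) ^ e \<le> n ^ f w" by (simp only: f_def power_mult)
      then have "c * (B + 1) ^ e \<le> c * n ^ f w" by simp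
      then show ?thesis using t(2) ce[of B] by linarith
    qed
    ultimately show ?thesis using t(1) by blast
  qed
  then show ?thesis by (intro exI[of _ f] exI[of _ P] exI[of _ c]) blast
qed

end
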